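(* Let $(\xi_n)_{n\in\mathbb{Z}}$ be a stationary Markov chain with marginal distribution $\pi$ and transition operator $Q$, let $g\in\mathbb{L}_0^2(\pi)$, $X_i:=g(\xi_i)$, $S_n:=\sum_{i=1}^nX_i$, and let $\nu$ be the transition spectral measure of $Q$ with respect to $g$. Let $h$ be slowly varying at infinity. Assume that $Q$ is self-adjoint, that $\alpha\ge1$, and that $\mathrm{var}(S_n)/n\to\infty$ as $n\to\infty$, and let $$c_\alpha:=\frac{\alpha(2-\alpha)}{2\Gamma(3-\alpha)}.$$ Then $$V(x)=\int_{-1}^{1-x}\frac{1}{1-t}\,\nu(\mathrm{d}t)\sim c_\alpha\,x^{1-\alpha}h(1/x)\quad\text{as }x\to0^+$$ if and only if $$\mathrm{var}(S_n)\sim n^\alpha h(n)\quad\text{as }n\to\infty.$$ Furthermore, if $\alpha>1$, then $\mathrm{var}(S_n)\sim n^\alpha h(n)$ as $n\to\infty$ if and only if $$\nu((1-x,1])\sim d_\alpha\,x^{2-\alpha}h(1/x)\quad\text{as }x\to0^+,$$ where $$d_\alpha:=\frac{\alpha(\alpha-1)}{2\Gamma(3-\alpha)}.$$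
   Context: $(\xi_n)_{n\in\mathbb{Z}}$ is a stationary Markov chain with values in a general state space $(S,\mathcal{A})$, marginal law $\pi(A)=\mathbb{P}(\xi_0\in A)$ and regular conditional distribution $Q(x,A)=\mathbb{P}(\xi_1\in A\mid\xi_0=x)$; $Q$ also denotes the transition operator $(Qg)(x)=\int_S g(s)\,Q(x,\mathrm{d}s)$ acting on $\mathbb{L}_0^2(\pi)$, the set of measurable functions $g$ on $S$ with $\int g^2\,\mathrm{d}\pi<\infty$ and $\int g\,\mathrm{d}\pi=0$, with inner product $\langle g,f\rangle=\int_S gf\,\mathrm{d}\pi$. When $Q$ is self-adjoint (the reversible case), the transition spectral measure $\nu$ is the unique measure on $[-1,1]$ with $\mathrm{cov}(X_0,X_n)=\langle g,Q^ng\rangle=\int_{-1}^1t^n\,\nu(\mathrm{d}t)$ for $n\ge0$. A continuous function $h:(0,\infty)\to(0,\infty)$ is slowly varying at infinity if $h(st)/h(t)\to1$ as $t\to\infty$ for every $s>0$. The notation $a\sim b$ means that the ratio $a/b$ tends to $1$ in the indicated limit. $\Gamma$ is the Gamma function.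
   Formalization: The first equivalence is stated only for α ≠ 2, as c_2 = 0 makes "V ~ 0" meaningless, and its direction from V to var(S_n) only when ν({1}) = 0, since V does not see an atom at 1 while such an atom forces var(S_n) to grow like n². *)

theory Defs
  imports "HOL-Probability.Probability" "HOL-Library.Landau_Symbols"
begin

definition past_algebra ::
  "'w measure \<Rightarrow> 's measure \<Rightarrow> (int \<Rightarrow> 'w \<Rightarrow> 's) \<Rightarrow> int \<Rightarrow> 'w measure" where
  "past_algebra M S \<xi> k =
     sigma (space M) (\<Union>j\<in>{..k}. {\<xi> j -` A \<inter> space M | A. A \<in> sets S})"

text \<open>
  Membership of \<open>Q\<close> in the measurable functions from \<open>S\<close> to \<open>prob_algebra S\<close> says that
  \<open>Q\<close> is a Markov kernel on \<open>S\<close>. By stationarity it suffices to know that \<open>Q\<close> is a regular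
  conditional distribution of \<open>\<xi> 1\<close> given \<open>\<xi> 0\<close>; in \<open>markov\<close> this is stated for all
  times together with the Markov property.
\<close>

locale stationary_markov_chain = prob_space M
  for M :: "'w measure" and S :: "'s measure" and \<xi> :: "int \<Rightarrow> 'w \<Rightarrow> 's"
    and \<pi> :: "'s measure" and Q :: "'s \<Rightarrow> 's measure" +
  assumes chain_measurable: "\<And>k. \<xi> k \<in> measurable M S"
    and stationary: "\<And>k. distr M (\<Pi>\<^sub>M i\<in>UNIV. S) (\<lambda>\<omega> i. \<xi> (i + k) \<omega>)
                        = distr M (\<Pi>\<^sub>M i\<in>UNIV. S) (\<lambda>\<omega> i. \<xi> i \<omega>)"
    and marginal: "\<pi> = distr M S (\<xi> 0)"
    and kernel: "Q \<in> measurable S (prob_algebra S)"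
    and markov: "\<And>k A. A \<in> sets S \<Longrightarrow>
      AE \<omega> in M. real_cond_exp M (past_algebra M S \<xi> k)
                    (indicator (\<xi> (k + 1) -` A \<inter> space M)) \<omega>
                 = measure (Q (\<xi> k \<omega>)) A"

definition L2_0 :: "'s measure \<Rightarrow> ('s \<Rightarrow> real) set" where
  "L2_0 \<pi> = {g \<in> borel_measurable \<pi>. integrable \<pi> (\<lambda>x. (g x)\<^sup>2) \<and> (\<integral>x. g x \<partial>\<pi>) = 0}"

definition L2_inner :: "'s measure \<Rightarrow> ('s \<Rightarrow> real) \<Rightarrow> ('s \<Rightarrow> real) \<Rightarrow> real" where
  "L2_inner \<pi> f g = (\<integral>x. f x * g x \<partial>\<pi>)"

text \<open>
  For \<open>g\<close> in \<open>L2_0 \<pi>\<close> the integral below exists for \<open>\<pi>\<close>-almost every \<open>x\<close>; on the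
  exceptional null set the Bochner integral has the value 0.
\<close>

definition transition_op :: "('s \<Rightarrow> 's measure) \<Rightarrow> ('s \<Rightarrow> real) \<Rightarrow> 's \<Rightarrow> real" where
  "transition_op Q g x = (\<integral>s. g s \<partial>(Q x))"

definition self_adjoint_kernel :: "'s measure \<Rightarrow> ('s \<Rightarrow> 's measure) \<Rightarrow> bool" where
  "self_adjoint_kernel \<pi> Q \<longleftrightarrow>
     (\<forall>f \<in> L2_0 \<pi>. \<forall>g \<in> L2_0 \<pi>.
        L2_inner \<pi> (transition_op Q f) g = L2_inner \<pi> f (transition_op Q g))"

text \<open>
  Measures on \<open>[-1, 1]\<close> are represented as Borel measures on the real line that do not charge
  the complement of \<open>[-1, 1]\<close>. Finiteness is explicit because the Bochner integral of 1
  with respect to an infinite measure is 0, so the moment identity for \<open>n = 0\<close> does not give it.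
\<close>

definition transition_spectral_measure ::
  "'s measure \<Rightarrow> ('s \<Rightarrow> 's measure) \<Rightarrow> ('s \<Rightarrow> real) \<Rightarrow> real measure \<Rightarrow> bool" where
  "transition_spectral_measure \<pi> Q g \<nu> \<longleftrightarrow>
     finite_measure \<nu> \<and> sets \<nu> = sets borel \<and> emeasure \<nu> (- {-1..1}) = 0 \<and>
     (\<forall>n. L2_inner \<pi> g ((transition_op Q ^^ n) g) = (\<integral>t. t ^ n \<partial>\<nu>))"

definition slowly_varying :: "(real \<Rightarrow> real) \<Rightarrow> bool" where
  "slowly_varying h \<longleftrightarrow>
     continuous_on {0<..} h \<and> (\<forall>t>0. h t > 0) \<and>
     (\<forall>s>0. ((\<lambda>t. h (s * t) / h t) \<longlongrightarrow> 1) at_top)"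

definition partial_sum_var ::
  "'w measure \<Rightarrow> (int \<Rightarrow> 'w \<Rightarrow> 's) \<Rightarrow> ('s \<Rightarrow> real) \<Rightarrow> nat \<Rightarrow> real" where
  "partial_sum_var M \<xi> g n = prob_space.variance M (\<lambda>\<omega>. \<Sum>i=1..n. g (\<xi> (int i) \<omega>))"

end

theory Submission
  imports Defs
begin

text \<open>
  Substitute s = 1 - t, and let \<mu> be the image of the spectral measure on [0, 2]. Since the covariances are
  the moments of \<nu>, the variance of the n-th partial sum is the \<nu>-integral of the sum of t ^ |i - j| over
  i, j in {1..n}. Up to an error of order n, uniformly in t, this kernel is 2 (exp (- n s) - 1 + n s) / s^2, so
  that, because the variance grows faster than n, it is asymptotic to 2 G n, where G is the second primitive of
  the Laplace transform L of \<mu> (\<open>lag_kernel_approximation\<close>,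
  \<open>growth_iff_regular_second_primitive\<close>). Everything is now a question about \<mu> and three
  functions of a real variable T: L, its primitive P and the primitive G of P.

  L and P are nonnegative and monotone. Regular variation passes from a function to its primitive by dominated
  convergence with Potter's bounds (\<open>abelian_transfer\<close>), and back from a primitive to a monotone
  integrand by comparing difference quotients (\<open>monotone_density\<close>). Hence G ~ T^\<alpha> h(T) / 2 is
  equivalent to P ~ (\<alpha> / 2) T^(\<alpha> - 1) h(T) and, when \<alpha> > 1, to L ~ (\<alpha> (\<alpha> - 1) /
  2) T^(\<alpha> - 2) h(T). For \<alpha> \<le> 2, Karamata's Tauberian theorem (\<open>Karamata_Tauberian\<close>)
  together with its Abelian converse (\<open>abelian_laplace\<close>) turns the last statement into the behaviour
  of \<mu> [0, x), the mass of \<nu> near 1, and divides the constant by \<Gamma>(3 - \<alpha>).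

  For V one uses that, if \<mu> has no atom at 0, then P T = T \<integral> exp (- T x) V x dx
  (\<open>primitive_eq_inverse_tail_laplace\<close>). So P ~ (\<alpha> / 2) T^(\<alpha> - 1) h(T) describes the
  Laplace transform of the measure with density V; Karamata's theorem gives its distribution function, and V,
  being monotone, is again recovered by differentiation. Growth of the variance with an exponent \<alpha> < 2
  itself excludes an atom of \<nu> at 1, which would force quadratic growth.

  For \<alpha> > 2 no asymptotic statement about the variance or the mass can hold, nor one about V if \<nu> has
  no atom at 1. The variance is at most of order n^2, the mass is bounded and V x is at most of order 1 / x, all
  too small for the right-hand sides. The exceptions are the integers \<alpha> \<ge> 3, where c and d are 0
  because 3 - \<alpha> is a pole of \<Gamma>, at which Gamma has the value 0 and so have quotients by it. Then V
  or the mass would have to vanish near 0, which superlinear growth of the variance excludes.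
\<close>

section \<open>Slowly varying functions\<close>

lemma increment_bound_iterate:
  fixes f :: "real \<Rightarrow> real"
  assumes d: "d > 0" and step: "\<And>x z. x \<ge> X \<Longrightarrow> 0 \<le> z \<Longrightarrow> z \<le> d \<Longrightarrow> \<bar>f (x + z) - f x\<bar> \<le> e"
  assumes "x \<ge> X" "0 \<le> z" "z \<le> real k * d"
  shows "\<bar>f (x + z) - f x\<bar> \<le> real k * e"
  using assms(3-5)
proof (induction k arbitrary: x z)
  case 0
  then show ?case by simp
next
  case (Suc k)
  show ?case
  proof (cases "z \<le> d")
    case True
    have "e \<ge> 0" using step[of X 0] d by (auto intro: order_trans[OF abs_ge_zero])
    then have "e \<le> real (Suc k) * e" by (simp add: algebra_simps)
    then show ?thesis using step[of x z] Suc.prems True by linarith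
  next
    case False
    have "\<bar>f ((x + d) + (z - d)) - f (x + d)\<bar> \<le> real k * e"
      using Suc.prems d False by (intro Suc.IH) (auto simp: algebra_simps)
    moreover have "\<bar>f (x + d) - f x\<bar> \<le> e" using step[of x d] Suc.prems d by auto
    ultimately show ?thesis by (simp add: algebra_simps abs_if split: if_splits)
  qed
qed

text \<open>
  This is the uniform convergence theorem for slowly varying functions in additive form. The sets of shifts whose
  increments are small from time n on are closed and cover the unit interval, so by Baire one of them contains an
  interval. Comparing the shifts by m and by m + z, with m the midpoint of that interval, bounds the increment by
  z at the point displaced by m.
\<close>

lemma vanishing_increments_locally_uniform:
  fixes f :: "real \<Rightarrow> real"
  assumes cont: "continuous_on UNIV f"
    and lim: "\<And>u. ((\<lambda>x. f (x + u) - f x) \<longlongrightarrow> 0) at_top"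
    and e: "e > 0"
  obtains d X where "d > 0" "\<And>x z. x \<ge> X \<Longrightarrow> 0 \<le> z \<Longrightarrow> z \<le> d \<Longrightarrow> \<bar>f (x + z) - f x\<bar> \<le> e"
proof -
  define E where "E n = {y \<in> {0..1::real}. \<forall>x\<ge>real n. \<bar>f (x + y) - f x\<bar> \<le> e / 2}" for n
  have closed_E: "closed (E n)" for n
  proof -
    have "E n = (\<Inter>x\<in>{real n..}. {y \<in> {0..1}. \<bar>f (x + y) - f x\<bar> \<le> e / 2})"
      unfolding E_def by auto
    moreover have "closed {y \<in> {0..1}. \<bar>f (x + y) - f x\<bar> \<le> e / 2}" for x
    proof -
      have "continuous_on UNIV (\<lambda>y. \<bar>f (x + y) - f x\<bar>)"
        by (intro continuous_intros continuous_on_compose2[OF cont]) auto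
      then have "closed {y. \<bar>f (x + y) - f x\<bar> \<le> e / 2}"
        by (intro closed_Collect_le) auto
      moreover have "{y \<in> {0..1}. \<bar>f (x + y) - f x\<bar> \<le> e / 2}
          = {0..1} \<inter> {y. \<bar>f (x + y) - f x\<bar> \<le> e / 2}" by auto
      ultimately show ?thesis by (metis closed_Int closed_atLeastAtMost)
    qed
    ultimately show ?thesis by (auto intro!: closed_INT)
  qed
  have cover: "\<exists>n. y \<in> E n" if "y \<in> {0..1}" for y
  proof -
    have "eventually (\<lambda>x. \<bar>f (x + y) - f x\<bar> < e / 2) at_top"
      using tendstoD[OF lim[of y], of "e / 2"] e by (simp add: dist_real_def)
    then obtain X where X: "\<And>x. x \<ge> X \<Longrightarrow> \<bar>f (x + y) - f x\<bar> < e / 2"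
      by (auto simp: eventually_at_top_linorder)
    obtain n where "real n \<ge> X" using real_arch_simple by blast
    with X that have "y \<in> E n" by (auto simp: E_def intro!: less_imp_le)
    then show ?thesis ..
  qed
  obtain n a b where ab: "a < b" "{a<..<b} \<subseteq> E n"
  proof -
    have "\<exists>n. interior (E n) \<noteq> {}"
    proof (rule ccontr)
      assume "\<not> ?thesis"
      then have int: "interior (E n) = {}" for n by auto
      have "UNIV \<subseteq> closure (\<Inter>(range (\<lambda>n. - E n)))"
      proof (rule Baire)
        fix T assume "T \<in> range (\<lambda>n. - E n)"
        then obtain n where "T = - E n" by auto
        then show "openin (top_of_set UNIV) T \<and> UNIV \<subseteq> closure T"
          using closed_E[of n] int[of n] by (auto simp: closure_complement)
      qed auto
      then have "closure (\<Inter>n. - E n) = UNIV" by (rule top.extremum_uniqueI)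
      moreover have "(\<Inter>n. - E n) \<subseteq> - {0<..<1}"
      proof
        fix y assume y: "y \<in> (\<Inter>n. - E n)"
        show "y \<in> - {0<..<1}"
        proof
          assume "y \<in> {0<..<1}"
          then have "y \<in> {0..1}" by simp
          then obtain n where "y \<in> E n" using cover by blast
          with y show False by blast
        qed
      qed
      then have "closure (\<Inter>n. - E n) \<subseteq> - {0<..<1}"
        by (rule closure_minimal) (simp add: closed_Compl)
      moreover have "(1/2::real) \<in> {0<..<1}" by simp
      ultimately show False by (metis Compl_iff UNIV_I subsetD)
    qed
    then obtain n x where "x \<in> interior (E n)" by auto
    then obtain r where r: "r > 0" "ball x r \<subseteq> E n" by (auto simp: mem_interior)
    then show ?thesis
      by (intro that[of "x - r" "x + r" n]) (auto simp: ball_eq_greaterThanLessThan)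
  qed
  define m where "m = (a + b) / 2"
  show ?thesis
  proof (rule that[of "(b - a) / 4" "real n + m"])
    fix x z assume x: "x \<ge> real n + m" and z: "0 \<le> z" "z \<le> (b - a) / 4"
    have "m \<in> {a<..<b}" "m + z \<in> {a<..<b}" using ab(1) z by (auto simp: m_def field_simps)
    then have m: "m \<in> E n" "m + z \<in> E n" using ab(2) by blast+
    have E: "\<bar>f ((x - m) + w) - f (x - m)\<bar> \<le> e / 2" if "w \<in> E n" for w
      using that x unfolding E_def by simp
    note E[OF m(1)] E[OF m(2)]
    then show "\<bar>f (x + z) - f x\<bar> \<le> e" by (simp add: algebra_simps abs_if split: if_splits)
  qed (use ab in auto)
qed

context
  fixes h :: "real \<Rightarrow> real"
  assumes h: "slowly_varying h"
begin

lemma slowly_varying_pos: "t > 0 \<Longrightarrow> h t > 0"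
  using h by (auto simp: slowly_varying_def)

lemma slowly_varying_scale: "s > 0 \<Longrightarrow> ((\<lambda>t. h (s * t) / h t) \<longlongrightarrow> 1) at_top"
  using h by (auto simp: slowly_varying_def)

text \<open>
  In logarithmic coordinates, slow variation says that all increments of \<open>lh\<close> vanish at infinity.
\<close>

private definition "lh x = ln (h (exp x))"

private lemma h_eq: "t > 0 \<Longrightarrow> h t = exp (lh (ln t))"
  by (simp add: lh_def slowly_varying_pos)

private lemma lh_cont: "continuous_on UNIV lh"
proof -
  have "continuous_on {0<..} h" using h by (auto simp: slowly_varying_def)
  then have "continuous_on UNIV (\<lambda>x. h (exp x))"
    by (rule continuous_on_compose2) (auto intro!: continuous_intros)
  moreover have "h (exp x) \<noteq> 0" for x using slowly_varying_pos[of "exp x"] by simp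
  ultimately show ?thesis unfolding lh_def[abs_def] by (intro continuous_on_ln) auto
qed

private lemma lh_increments: "((\<lambda>x. lh (x + u) - lh x) \<longlongrightarrow> 0) at_top"
proof -
  have "((\<lambda>x. h (exp u * exp x) / h (exp x)) \<longlongrightarrow> 1) at_top"
    by (rule filterlim_compose[OF slowly_varying_scale exp_at_top]) auto
  then have "((\<lambda>x. ln (h (exp u * exp x) / h (exp x))) \<longlongrightarrow> ln 1) at_top"
    by (intro tendsto_ln) auto
  moreover have "ln (h (exp u * exp x) / h (exp x)) = lh (x + u) - lh x" for x
    using slowly_varying_pos[of "exp x"] slowly_varying_pos[of "exp u * exp x"]
    by (simp add: lh_def ln_div exp_add mult.commute)
  ultimately show ?thesis by simp
qed

text \<open>
  Pointwise slow variation gives this only for constant factors. Factors that vary but tend to 1 are what the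
  passage from integers to real numbers requires.
\<close>

lemma slowly_varying_near_one:
  assumes y: "(y \<longlongrightarrow> 1) at_top"
  shows "((\<lambda>t. h (t * y t) / h t) \<longlongrightarrow> 1) at_top"
proof -
  let ?d = "\<lambda>t. lh (ln (t * y t)) - lh (ln t)"
  have "(?d \<longlongrightarrow> 0) at_top"
  proof (rule tendstoI)
    fix e :: real assume "e > 0"
    then obtain d X where dX: "d > 0" "\<And>x z. x \<ge> X \<Longrightarrow> 0 \<le> z \<Longrightarrow> z \<le> d \<Longrightarrow> \<bar>lh (x + z) - lh x\<bar> \<le> e / 2"
      using vanishing_increments_locally_uniform[OF lh_cont lh_increments, of "e/2"] by auto
    have "((\<lambda>t. ln (y t)) \<longlongrightarrow> ln 1) at_top" using y by (intro tendsto_ln) auto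
    then have "eventually (\<lambda>t. \<bar>ln (y t)\<bar> < d) at_top"
      using dX(1) by (auto simp: tendsto_iff dist_real_def)
    moreover have "eventually (\<lambda>t. ln t \<ge> X + d) at_top"
      using ln_at_top by (auto simp: filterlim_at_top)
    moreover have "eventually (\<lambda>t. y t > 0) at_top" using y by (intro order_tendstoD) auto
    moreover have "eventually (\<lambda>t::real. t > 0) at_top" by (rule eventually_gt_at_top)
    ultimately show "eventually (\<lambda>t. dist (?d t) 0 < e) at_top"
    proof eventually_elim
      case (elim t)
      have *: "ln (t * y t) = ln t + ln (y t)" using elim by (simp add: ln_mult)
      show ?case
      proof (cases "ln (y t) \<ge> 0")
        case True
        then show ?thesis using dX(2)[of "ln t" "ln (y t)"] elim \<open>e > 0\<close> dX(1) by (simp add: *)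
      next
        case False
        have "\<bar>lh (ln t + ln (y t) + - ln (y t)) - lh (ln t + ln (y t))\<bar> \<le> e / 2"
          using elim False by (intro dX(2)) auto
        then have "\<bar>lh (ln t) - lh (ln t + ln (y t))\<bar> \<le> e / 2" by simp
        then show ?thesis unfolding * dist_real_def using \<open>e > 0\<close> by arith
      qed
    qed
  qed
  then have "((\<lambda>t. exp (?d t)) \<longlongrightarrow> exp 0) at_top" by (rule tendsto_exp)
  moreover have "eventually (\<lambda>t. exp (?d t) = h (t * y t) / h t) at_top"
  proof -
    have "eventually (\<lambda>t. y t > 0) at_top" using y by (intro order_tendstoD) auto
    then show ?thesis using eventually_gt_at_top[of 0]
      by eventually_elim (simp add: h_eq[symmetric] exp_diff)
  qed
  ultimately show ?thesis by (simp add: filterlim_cong)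
qed

text \<open>
  In logarithmic coordinates a unit step changes \<open>lh\<close> by at most \<open>\<delta>\<close>, and the
  remaining fractional part of a shift contributes a bounded amount, which becomes the constant \<open>A\<close>.
  A shift to the left is a shift to the right from the other end, hence the two powers.
\<close>

lemma Potter_bounds:
  assumes \<delta>: "\<delta> > 0"
  obtains A t0 where "A > 0" "t0 > 0"
    "\<And>t y. t \<ge> t0 \<Longrightarrow> y > 0 \<Longrightarrow> t * y \<ge> t0 \<Longrightarrow> h (t * y) \<le> A * (y powr \<delta> + y powr (-\<delta>)) * h t"
proof -
  obtain d X1 where d: "d > 0" and X1: "\<And>x z. x \<ge> X1 \<Longrightarrow> 0 \<le> z \<Longrightarrow> z \<le> d \<Longrightarrow> \<bar>lh (x + z) - lh x\<bar> \<le> 1"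
    using vanishing_increments_locally_uniform[OF lh_cont lh_increments, of 1] by auto
  obtain k where k: "1 \<le> real k * d" using d by (metis ex_less_of_nat_mult less_imp_le)
  have short: "\<bar>lh (x + z) - lh x\<bar> \<le> real k" if "x \<ge> X1" "0 \<le> z" "z \<le> 1" for x z
    using increment_bound_iterate[OF d X1 that(1,2), of k] that k by auto
  have "eventually (\<lambda>x. \<bar>lh (x + 1) - lh x\<bar> < \<delta>) at_top"
    using lh_increments[of 1] \<delta> by (auto simp: tendsto_iff dist_real_def)
  then obtain X2 where X2: "\<And>x. x \<ge> X2 \<Longrightarrow> \<bar>lh (x + 1) - lh x\<bar> < \<delta>"
    by (auto simp: eventually_at_top_linorder)
  have int: "\<bar>lh (x + real m) - lh x\<bar> \<le> real m * \<delta>" if "x \<ge> X2" for x m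
  proof (induction m)
    case (Suc m)
    have "\<bar>lh ((x + real m) + 1) - lh (x + real m)\<bar> < \<delta>" using that by (intro X2) auto
    with Suc show ?case by (simp add: algebra_simps abs_if split: if_splits)
  qed auto
  define X where "X = max X1 X2"
  have lh_bound: "\<bar>lh (x + z) - lh x\<bar> \<le> z * \<delta> + real k" if "x \<ge> X" "z \<ge> 0" for x z
  proof -
    define m where "m = nat \<lfloor>z\<rfloor>"
    have m: "real m \<le> z" "z \<le> real m + 1" using that by (auto simp: m_def)
    have "\<bar>lh ((x + real m) + (z - real m)) - lh (x + real m)\<bar> \<le> real k"
      using m that by (intro short) (auto simp: X_def)
    moreover have "\<bar>lh (x + real m) - lh x\<bar> \<le> real m * \<delta>" using that by (intro int) (auto simp: X_def)
    moreover have "real m * \<delta> \<le> z * \<delta>" using m \<delta> by simp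
    ultimately show ?thesis by (simp add: algebra_simps abs_if split: if_splits)
  qed
  show ?thesis
  proof (rule that[of "exp (real k)" "exp X"])
    fix t y assume t: "t \<ge> exp X" and y: "y > 0" and ty: "t * y \<ge> exp X"
    have t0: "t > 0" using t by (meson exp_gt_zero less_le_trans)
    have X: "ln t \<ge> X" "ln t + ln y \<ge> X"
      using t0 y ln_le_cancel_iff[of "exp X" t] ln_le_cancel_iff[of "exp X" "t * y"] t ty
      by (auto simp: ln_mult)
    have "lh (ln t + ln y) - lh (ln t) \<le> real k + \<delta> * \<bar>ln y\<bar>"
    proof (cases "ln y \<ge> 0")
      case True
      then show ?thesis using lh_bound[of "ln t" "ln y"] X by (simp add: algebra_simps)
    next
      case False
      then show ?thesis using lh_bound[of "ln t + ln y" "- ln y"] X by (simp add: algebra_simps)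
    qed
    then have "exp (lh (ln t + ln y)) \<le> exp (real k + \<delta> * \<bar>ln y\<bar> + lh (ln t))" by simp
    also have "\<dots> = exp (real k) * exp (\<delta> * \<bar>ln y\<bar>) * exp (lh (ln t))" by (simp add: exp_add)
    also have "\<dots> \<le> exp (real k) * (y powr \<delta> + y powr (-\<delta>)) * exp (lh (ln t))"
      using y by (intro mult_right_mono mult_left_mono) (auto simp: powr_def abs_if)
    finally show "h (t * y) \<le> exp (real k) * (y powr \<delta> + y powr (-\<delta>)) * h t"
      using t0 y by (simp add: h_eq ln_mult)
  qed auto
qed

text \<open>
  Potter's bounds with one of the two points frozen.
\<close>

lemma slowly_varying_polynomial_lower_bound:
  assumes \<delta>: "\<delta> > 0"
  shows "\<exists>K>0. \<exists>t0\<ge>1. \<forall>T\<ge>t0. 1 \<le> K * T powr \<delta> * h T"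
proof -
  obtain A t1 where A: "A > 0" "t1 > 0" and potter:
    "\<And>t y. t \<ge> t1 \<Longrightarrow> y > 0 \<Longrightarrow> t * y \<ge> t1 \<Longrightarrow> h (t * y) \<le> A * (y powr \<delta> + y powr (-\<delta>)) * h t"
    using Potter_bounds[OF \<delta>] by blast
  define t0 where "t0 = max t1 1"
  have t0: "t0 \<ge> t1" "t0 \<ge> 1" by (auto simp: t0_def)
  have h0: "h t0 > 0" using t0 by (intro slowly_varying_pos) simp
  define K where "K = 2 * A * t0 powr (-\<delta>) / h t0"
  have "1 \<le> K * T powr \<delta> * h T" if T: "T \<ge> t0" for T
  proof -
    have y: "t0 / T > 0" "t0 / T \<le> 1" "T * (t0 / T) = t0" using T t0 by auto
    have "(t0 / T) powr \<delta> \<le> (t0 / T) powr (-\<delta>)" using y \<delta> by (intro powr_mono') auto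
    then have "A * ((t0 / T) powr \<delta> + (t0 / T) powr (-\<delta>)) * h T \<le> A * (2 * (t0 / T) powr (-\<delta>)) * h T"
      using A slowly_varying_pos[of T] T t0 by (intro mult_right_mono mult_left_mono) auto
    moreover have "h t0 \<le> A * ((t0 / T) powr \<delta> + (t0 / T) powr (-\<delta>)) * h T"
      using potter[of T "t0 / T"] y T t0 by simp
    moreover have "(t0 / T) powr (-\<delta>) = t0 powr (-\<delta>) * T powr \<delta>"
      using T t0 by (simp add: powr_divide powr_minus field_simps)
    ultimately show ?thesis using h0 by (simp add: K_def field_simps)
  qed
  moreover have "K > 0" using A t0 h0 by (simp add: K_def)
  ultimately show ?thesis using t0(2) by blast
qed

lemma slowly_varying_times_powr_at_top:
  assumes \<delta>: "\<delta> > 0" shows "filterlim (\<lambda>T. T powr \<delta> * h T) at_top at_top"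
proof -
  have \<delta>2: "\<delta> / 2 > 0" using \<delta> by simp
  obtain K t0 where K: "K > 0" "t0 \<ge> 1" "\<And>T. T \<ge> t0 \<Longrightarrow> 1 \<le> K * T powr (\<delta> / 2) * h T"
    using slowly_varying_polynomial_lower_bound[OF \<delta>2] by meson
  have "filterlim (\<lambda>T. exp (\<delta> / 2 * ln T)) at_top at_top"
    using \<delta>2 by (intro filterlim_compose[OF exp_at_top] filterlim_tendsto_pos_mult_at_top[OF tendsto_const _ ln_at_top])
  moreover have "eventually (\<lambda>T. exp (\<delta> / 2 * ln T) = T powr (\<delta> / 2)) at_top"
    using eventually_gt_at_top[of 0] by eventually_elim (simp add: powr_def)
  ultimately have "filterlim (\<lambda>T::real. T powr (\<delta> / 2)) at_top at_top"
    by (simp cong: filterlim_cong)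
  then have "filterlim (\<lambda>T. 1 / K * T powr (\<delta> / 2)) at_top at_top"
    using K by (intro filterlim_tendsto_pos_mult_at_top[OF tendsto_const]) auto
  moreover have "eventually (\<lambda>T. 1 / K * T powr (\<delta> / 2) \<le> T powr \<delta> * h T) at_top"
    using eventually_ge_at_top[of t0]
  proof eventually_elim
    case (elim T)
    have "1 / K \<le> T powr (\<delta> / 2) * h T" using K(3)[OF elim] K(1) by (simp add: field_simps)
    then have "1 / K * T powr (\<delta> / 2) \<le> T powr (\<delta> / 2) * h T * T powr (\<delta> / 2)" by (rule mult_right_mono) simp
    also have "\<dots> = T powr (\<delta> / 2 + \<delta> / 2) * h T" by (simp only: powr_add mult_ac)
    finally show ?case by simp
  qed
  ultimately show ?thesis by (rule filterlim_at_top_mono)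
qed

end

lemma slowly_varying_inverse: "slowly_varying h \<Longrightarrow> slowly_varying (\<lambda>t. inverse (h t))"
  unfolding slowly_varying_def
proof (intro conjI allI impI)
  fix s :: real
  assume h: "continuous_on {0<..} h \<and> (\<forall>t>0. h t > 0) \<and> (\<forall>s>0. ((\<lambda>t. h (s * t) / h t) \<longlongrightarrow> 1) at_top)" and s: "s > 0"
  from h s have "((\<lambda>t. inverse (h (s * t) / h t)) \<longlongrightarrow> inverse 1) at_top" by (intro tendsto_inverse) auto
  then show "((\<lambda>t. inverse (h (s * t)) / inverse (h t)) \<longlongrightarrow> 1) at_top" by (simp add: divide_inverse mult.commute)
qed (auto intro!: continuous_intros)

lemma slowly_varying_over_powr:
  assumes h: "slowly_varying h" and \<delta>: "\<delta> > 0" shows "((\<lambda>T. h T / T powr \<delta>) \<longlongrightarrow> 0) at_top"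
  using tendsto_inverse_0_at_top[OF slowly_varying_times_powr_at_top[OF slowly_varying_inverse[OF h] \<delta>]]
  by (simp add: divide_inverse mult.commute)

section \<open>Integrating regularly varying functions\<close>

text \<open>
  Dominated convergence: for fixed y the quotient tends to \<open>D * y powr \<sigma>\<close>. Where \<open>T *
  y\<close> is large, Potter's bounds dominate it by powers of y on either side of \<open>\<sigma>\<close>; where
  \<open>T * y\<close> stays bounded, so does f, and the nonpositive exponent \<open>a\<close> absorbs the decay
  of the normalization. Taking an arbitrary measure and an arbitrary function y covers both integration over an
  initial segment and Laplace transforms.
\<close>

lemma abelian_transfer:
  fixes N :: "'b measure" and y :: "'b \<Rightarrow> real" and f h :: "real \<Rightarrow> real"
  assumes h: "slowly_varying h"
    and [measurable]: "y \<in> borel_measurable N"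
    and meas: "\<And>T. T > 0 \<Longrightarrow> (\<lambda>v. f (T * y v)) \<in> borel_measurable N"
    and y_pos: "AE v in N. y v > 0"
    and lim: "((\<lambda>t. f t / (t powr \<sigma> * h t)) \<longlongrightarrow> D) at_top"
    and bdd: "\<And>t0. \<exists>B. \<forall>t. 0 < t \<and> t \<le> t0 \<longrightarrow> \<bar>f t\<bar> \<le> B"
    and ab: "a < \<sigma>" "\<sigma> < b" "a \<le> 0"
    and int: "integrable N (\<lambda>v. y v powr a)" "integrable N (\<lambda>v. y v powr b)"
  shows "((\<lambda>T. (\<integral>v. f (T * y v) \<partial>N) / (T powr \<sigma> * h T)) \<longlongrightarrow> D * (\<integral>v. y v powr \<sigma> \<partial>N)) at_top"
proof -
  let ?r = "\<lambda>T. T powr \<sigma> * h T"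
  have hpos: "t > 0 \<Longrightarrow> h t > 0" for t using slowly_varying_pos[OF h] .
  define \<delta> where "\<delta> = min (\<sigma> - a) (b - \<sigma>)"
  have \<delta>: "\<delta> > 0" "\<delta> \<le> \<sigma> - a" "\<delta> \<le> b - \<sigma>" using ab by (auto simp: \<delta>_def)
  obtain A t0 where A: "A > 0" "t0 > 0" and potter:
    "\<And>t y. t \<ge> t0 \<Longrightarrow> y > 0 \<Longrightarrow> t * y \<ge> t0 \<Longrightarrow> h (t * y) \<le> A * (y powr \<delta> + y powr (-\<delta>)) * h t"
    using Potter_bounds[OF h \<delta>(1)] by blast
  have "eventually (\<lambda>t. \<bar>f t / ?r t\<bar> < \<bar>D\<bar> + 1) at_top"
    by (rule order_tendstoD(2)[OF tendsto_rabs[OF lim]]) simp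
  then obtain t2 where t2: "\<And>t. t \<ge> t2 \<Longrightarrow> \<bar>f t / ?r t\<bar> < \<bar>D\<bar> + 1"
    by (auto simp: eventually_at_top_linorder)
  obtain K t3 where K0: "K > 0" and t3: "t3 \<ge> 1" and h_lower': "\<And>T. T \<ge> t3 \<Longrightarrow> 1 \<le> K * T powr \<delta> * h T"
    using slowly_varying_polynomial_lower_bound[OF h \<delta>(1)] by meson
  define t1 where "t1 = max t0 (max t2 t3)"
  have t1: "t1 \<ge> t0" "t1 \<ge> t2" "t1 \<ge> 1" using t3 by (auto simp: t1_def)
  have h_lower: "1 \<le> K * T powr \<delta> * h T" if "T \<ge> t1" for T
    using that by (intro h_lower') (simp add: t1_def)
  have f_large: "\<bar>f t\<bar> \<le> (\<bar>D\<bar> + 1) * ?r t" if "t \<ge> t1" for t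
  proof -
    have "?r t > 0" using that t1 hpos[of t] by simp
    then show ?thesis using t2[of t] that t1 by (simp add: divide_less_eq abs_divide)
  qed
  obtain B where B: "\<And>t. 0 < t \<Longrightarrow> t \<le> t1 \<Longrightarrow> \<bar>f t\<bar> \<le> B" using bdd[of t1] by auto
  have B0: "B \<ge> 0" using B[of t1] t1 by linarith
  define C where "C = 2 * (\<bar>D\<bar> + 1) * A + B * K * t1 powr (-a)"
  have powr_between: "z powr c \<le> z powr a + z powr b" if "z > 0" "a \<le> c" "c \<le> b" for z c
  proof (cases "z \<ge> 1")
    case True
    then have "z powr c \<le> z powr b" using that by (intro powr_mono) auto
    then show ?thesis by (simp add: add_increasing)
  next
    case False
    then have "z powr c \<le> z powr a" using that by (intro powr_mono') auto
    then show ?thesis by (simp add: add_increasing2)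
  qed
  have bound: "\<bar>f (T * z) / ?r T\<bar> \<le> C * (z powr a + z powr b)"
    if T: "T \<ge> t1" and z: "z > 0" for T z
  proof -
    have T0: "T > 0" "T \<ge> 1" using T t1 by auto
    have den: "?r T > 0" using T0 hpos by simp
    have sum0: "z powr a + z powr b \<ge> 0" by simp
    show ?thesis
    proof (cases "T * z \<ge> t1")
      case True
      have "\<bar>f (T * z)\<bar> \<le> (\<bar>D\<bar> + 1) * ?r (T * z)" by (rule f_large[OF True])
      also have "\<dots> \<le> (\<bar>D\<bar> + 1) * ((T * z) powr \<sigma> * (A * (z powr \<delta> + z powr (-\<delta>)) * h T))"
        using potter[of T z] T z t1 True by (intro mult_left_mono) auto
      also have "\<dots> = (\<bar>D\<bar> + 1) * A * (z powr (\<sigma> + \<delta>) + z powr (\<sigma> - \<delta>)) * ?r T"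
        using z T0 by (simp add: powr_mult powr_add powr_diff powr_minus field_simps)
      also have "\<dots> \<le> (\<bar>D\<bar> + 1) * A * (2 * (z powr a + z powr b)) * ?r T"
        using powr_between[OF z, of "\<sigma> + \<delta>"] powr_between[OF z, of "\<sigma> - \<delta>"] \<delta> A den
        by (intro mult_right_mono mult_left_mono) auto
      finally have "\<bar>f (T * z)\<bar> / ?r T \<le> (\<bar>D\<bar> + 1) * A * (2 * (z powr a + z powr b))"
        using den by (simp add: pos_divide_le_eq)
      also have "\<dots> = (2 * (\<bar>D\<bar> + 1) * A) * (z powr a + z powr b)" by (simp only: mult_ac)
      also have "\<dots> \<le> C * (z powr a + z powr b)"
        using sum0 B0 K0 by (intro mult_right_mono) (auto simp: C_def)
      finally show ?thesis using den hpos[of T] T0 by (simp add: abs_divide abs_mult)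
    next
      case False
      have "\<bar>f (T * z)\<bar> \<le> B * 1" using B[of "T * z"] False T0 z by simp
      also have "\<dots> \<le> B * (K * T powr \<delta> * h T)" using h_lower[OF T] B0 by (rule mult_left_mono)
      also have "\<dots> = B * K * T powr (\<delta> - \<sigma>) * ?r T"
        using T0 by (simp add: powr_diff)
      also have "\<dots> \<le> B * K * (t1 powr (-a) * z powr a) * ?r T"
      proof (intro mult_right_mono mult_left_mono)
        have "T powr (\<delta> - \<sigma>) \<le> T powr (-a)" using T0 \<delta> by (intro powr_mono) auto
        also have "\<dots> \<le> (t1 / z) powr (-a)"
          using False z T0 ab by (intro powr_mono2) (auto simp: field_simps)
        also have "\<dots> = t1 powr (-a) * z powr a" using z t1 by (simp add: powr_divide powr_minus field_simps)
        finally show "T powr (\<delta> - \<sigma>) \<le> t1 powr (-a) * z powr a" .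
      qed (use B0 K0 den in auto)
      finally have "\<bar>f (T * z)\<bar> / ?r T \<le> B * K * (t1 powr (-a) * z powr a)"
        using den by (simp add: pos_divide_le_eq)
      also have "\<dots> = (B * K * t1 powr (-a)) * z powr a" by simp
      also have "\<dots> \<le> C * (z powr a + z powr b)"
        using B0 K0 A by (intro mult_mono) (auto simp: C_def)
      finally show ?thesis using den hpos[of T] T0 by (simp add: abs_divide abs_mult)
    qed
  qed
  have ptw: "((\<lambda>T. f (T * z) / ?r T) \<longlongrightarrow> D * z powr \<sigma>) at_top" if z: "z > 0" for z
  proof -
    have Tz: "filterlim (\<lambda>T. T * z) at_top at_top"
      using z filterlim_tendsto_pos_mult_at_top[OF tendsto_const z filterlim_ident]
      by (simp add: mult.commute)
    have "((\<lambda>T. f (T * z) / ?r (T * z) * z powr \<sigma> * (h (z * T) / h T))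
        \<longlongrightarrow> D * z powr \<sigma> * 1) at_top"
      by (intro tendsto_mult tendsto_const filterlim_compose[OF lim Tz] slowly_varying_scale[OF h z])
    moreover have "eventually (\<lambda>T. f (T * z) / ?r (T * z) * z powr \<sigma> * (h (z * T) / h T)
        = f (T * z) / ?r T) at_top"
      using eventually_gt_at_top[of 0]
    proof eventually_elim
      case (elim T)
      then have "h (T * z) > 0" using hpos z by simp
      then show ?case using elim z by (simp add: powr_mult mult.commute)
    qed
    ultimately show ?thesis by (simp add: filterlim_cong)
  qed
  have "((\<lambda>T. \<integral>v. f (max T 1 * y v) / ?r T \<partial>N) \<longlongrightarrow> (\<integral>v. D * y v powr \<sigma> \<partial>N)) at_top"
  proof (rule integral_dominated_convergence_at_top)
    show "integrable N (\<lambda>v. C * (y v powr a + y v powr b))" using int by simp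
    show "AE v in N. ((\<lambda>T. f (max T 1 * y v) / ?r T) \<longlongrightarrow> D * y v powr \<sigma>) at_top"
      using y_pos
    proof eventually_elim
      case (elim v)
      have "eventually (\<lambda>T. f (T * y v) / ?r T = f (max T 1 * y v) / ?r T) at_top"
        using eventually_ge_at_top[of 1] by eventually_elim (simp add: max_def)
      with ptw[OF elim] show ?case by (rule Lim_transform_eventually)
    qed
    show "eventually (\<lambda>T. AE v in N. norm (f (max T 1 * y v) / ?r T) \<le> C * (y v powr a + y v powr b)) at_top"
      using eventually_ge_at_top[of t1]
    proof eventually_elim
      case (elim T)
      have "max T 1 = T" using elim t1 by simp
      then show ?case using y_pos bound[OF elim] by (auto elim!: eventually_mono)
    qed
  qed (use meas in \<open>auto intro!: borel_measurable_divide\<close>)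
  then have "((\<lambda>T. \<integral>v. f (max T 1 * y v) / ?r T \<partial>N) \<longlongrightarrow> D * (\<integral>v. y v powr \<sigma> \<partial>N)) at_top"
    by simp
  moreover have "eventually (\<lambda>T. (\<integral>v. f (max T 1 * y v) / ?r T \<partial>N)
      = (\<integral>v. f (T * y v) \<partial>N) / ?r T) at_top"
    using eventually_ge_at_top[of 1] by eventually_elim (simp add: max_def)
  ultimately show ?thesis by (rule Lim_transform_eventually)
qed

lemma has_bochner_integral_lborel_nonneg:
  fixes f :: "real \<Rightarrow> real"
  assumes "(f has_integral I) A" "\<And>x. x \<in> A \<Longrightarrow> f x \<ge> 0"
    and meas: "(\<lambda>x. indicator A x * f x) \<in> borel_measurable borel"
  shows "has_bochner_integral lborel (\<lambda>x. indicator A x * f x) I"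
proof (rule has_bochner_integral_nn_integral)
  show "0 \<le> I" using assms(1,2) by (rule has_integral_nonneg)
  show "(\<integral>\<^sup>+ x. ennreal (indicator A x * f x) \<partial>lborel) = ennreal I"
    by (rule nn_integral_has_integral_lebesgue[OF assms(2,1)])
  show "AE x in lborel. 0 \<le> indicator A x * f x" using assms(2) by (auto simp: indicator_def)
qed (use meas in simp)

lemma gamma_integral_scaled:
  assumes "x > 0" "k > (0::real)"
  shows "has_bochner_integral lborel (\<lambda>u. indicator {0<..} u * (u powr (x - 1) * exp (- (k * u))))
           (Gamma x * k powr (- x))"
proof -
  have "has_bochner_integral lborel (\<lambda>u. indicator {0..} u * (u powr (x - 1) / exp u)) (Gamma x)"
    by (rule has_bochner_integral_lborel_nonneg[OF Gamma_integral_real[OF assms(1)]]) auto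
  then have "has_bochner_integral lborel (\<lambda>u. indicator {0..} (0 + k * u) * ((0 + k * u) powr (x - 1) / exp (0 + k * u)))
      (Gamma x /\<^sub>R \<bar>k\<bar>)"
    using assms(2) by (intro lborel_has_bochner_integral_real_affine_iff[THEN iffD1]) auto
  then have "has_bochner_integral lborel (\<lambda>u. k powr (1 - x) * (indicator {0..} (0 + k * u) * ((0 + k * u) powr (x - 1) / exp (0 + k * u))))
      (k powr (1 - x) * (Gamma x /\<^sub>R \<bar>k\<bar>))"
    by (rule has_bochner_integral_mult_right)
  moreover have "k powr (1 - x) * (indicator {0..} (0 + k * u) * ((0 + k * u) powr (x - 1) / exp (0 + k * u)))
      = indicator {0<..} u * (u powr (x - 1) * exp (- (k * u)))" for u
    using assms by (cases "u > 0"; cases "u = 0")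
      (auto simp: indicator_def zero_le_mult_iff powr_mult powr_diff exp_minus field_simps)
  moreover have "k powr (1 - x) * (Gamma x /\<^sub>R \<bar>k\<bar>) = Gamma x * k powr (- x)"
    using assms by (simp add: powr_diff powr_minus field_simps)
  ultimately show ?thesis by (simp only:)
qed

text \<open>
  Karamata's theorem on integrals: after the substitution \<open>r = T * v\<close>, the primitive of a function of
  index \<open>\<sigma>\<close> has index \<open>\<sigma> + 1\<close>.
\<close>

lemma abelian_unit_interval:
  fixes f h :: "real \<Rightarrow> real"
  assumes h: "slowly_varying h" and [measurable]: "f \<in> borel_measurable borel"
    and \<sigma>: "\<sigma> > -1"
    and lim: "((\<lambda>t. f t / (t powr \<sigma> * h t)) \<longlongrightarrow> D) at_top"
    and bdd: "\<And>t0. \<exists>B. \<forall>t. 0 < t \<and> t \<le> t0 \<longrightarrow> \<bar>f t\<bar> \<le> B"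
  shows "((\<lambda>T. (LINT v:{0..1}|lborel. f (T * v)) / (T powr \<sigma> * h T)) \<longlongrightarrow> D / (\<sigma> + 1)) at_top"
proof -
  define N where "N = restrict_space lborel {0..1::real}"
  have N: "(\<integral>v. g v \<partial>N) = (LINT v:{0..1}|lborel. g v)" for g :: "real \<Rightarrow> real"
    unfolding N_def by (simp add: integral_restrict_space set_lebesgue_integral_def)
  have powr: "has_bochner_integral lborel (\<lambda>v. indicator {0..1} v * v powr c) (1 / (c + 1))" if "c > -1" for c :: real
    using has_bochner_integral_lborel_nonneg[OF has_integral_powr_from_0[OF that, of 1]] by simp
  have int: "integrable N (\<lambda>v. v powr c)" if "c > -1" for c :: real
    using powr[OF that] unfolding N_def by (simp add: integrable_restrict_space set_integrable_def has_bochner_integral_iff)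
  \<comment> \<open>The midpoint of -1 and min \<sigma> 0: integrable at 0, below \<sigma> and nonpositive.\<close>
  define a where "a = (min \<sigma> 0 - 1) / 2"
  have a: "a > -1" "a < \<sigma>" "a \<le> 0" using \<sigma> by (auto simp: a_def min_def)
  have "((\<lambda>T. (\<integral>v. f (T * v) \<partial>N) / (T powr \<sigma> * h T)) \<longlongrightarrow> D * (\<integral>v. v powr \<sigma> \<partial>N)) at_top"
  proof (rule abelian_transfer[OF h _ _ _ lim bdd a(2) _ a(3), where b = "\<sigma> + 1"])
    show "AE v in N. v > 0"
      using AE_lborel_singleton[of "0::real"] unfolding N_def
      by (auto simp: AE_restrict_space_iff elim!: eventually_mono)
  qed (use a \<sigma> int in \<open>auto simp: N_def intro!: measurable_restrict_space1\<close>)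
  moreover have "(\<integral>v. v powr \<sigma> \<partial>N) = 1 / (\<sigma> + 1)"
    unfolding N using powr[OF \<sigma>] by (simp add: set_lebesgue_integral_def has_bochner_integral_iff)
  ultimately show ?thesis by (simp add: N)
qed

text \<open>
  Here y is 1 / u under the exponential weight, so behaviour of f at 0 is turned into behaviour at infinity, and
  the moment of y is a Gamma integral.
\<close>

lemma abelian_laplace:
  fixes f h :: "real \<Rightarrow> real"
  assumes h: "slowly_varying h" and meas: "(\<lambda>x. indicator {0<..} x * f x) \<in> borel_measurable borel"
    and \<sigma>: "\<sigma> < 1"
    and lim: "((\<lambda>t. f (1 / t) / (t powr \<sigma> * h t)) \<longlongrightarrow> D) at_top"
    and bdd: "\<And>t0. \<exists>B. \<forall>t. 0 < t \<and> t \<le> t0 \<longrightarrow> \<bar>f (1 / t)\<bar> \<le> B"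
  shows "((\<lambda>T. (LINT u:{0<..}|lborel. exp (- u) * f (u / T)) / (T powr \<sigma> * h T)) \<longlongrightarrow> D * Gamma (1 - \<sigma>)) at_top"
proof -
  let ?J = "\<lambda>T. LINT u:{0<..}|lborel. exp (- u) * f (u / T)"
  define w where "w u = indicator {0<..} u * exp (- u)" for u :: real
  have w[measurable]: "w \<in> borel_measurable borel" and w0: "w u \<ge> 0" for u
    unfolding w_def[abs_def] by auto
  define N where "N = density lborel (\<lambda>u. ennreal (w u))"
  define y :: "real \<Rightarrow> real" where "y u = 1 / u" for u
  have powr: "has_bochner_integral N (\<lambda>u. y u powr c) (Gamma (1 - c))" if "c < 1" for c
  proof -
    have "has_bochner_integral lborel (\<lambda>u. indicator {0<..} u * (u powr (- c) * exp (- u))) (Gamma (1 - c))"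
      using gamma_integral_scaled[of "1 - c" 1] that by simp
    moreover have "indicator {0<..} u * (u powr (- c) * exp (- u)) = w u *\<^sub>R y u powr c" for u
      by (auto simp: w_def y_def indicator_def powr_minus_divide powr_divide)
    ultimately show ?thesis unfolding N_def using w0
      by (intro has_bochner_integral_density) (auto simp: y_def)
  qed
  define a where "a = min \<sigma> 0 - 1"
  \<comment> \<open>Measurability of f is assumed on the positive half-line; the extension by 0 is measurable everywhere.\<close>
  define f' where "f' x = indicator {0<..} x * f x" for x
  let ?N = "\<lambda>T. \<integral>u. f' (1 / (T * y u)) \<partial>N"
  have [measurable]: "f' \<in> borel_measurable borel" using meas by (simp add: f'_def[abs_def])
  have lim': "((\<lambda>t. f' (1 / t) / (t powr \<sigma> * h t)) \<longlongrightarrow> D) at_top"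
  proof (rule Lim_transform_eventually[OF lim])
    show "eventually (\<lambda>t. f (1 / t) / (t powr \<sigma> * h t) = f' (1 / t) / (t powr \<sigma> * h t)) at_top"
      using eventually_gt_at_top[of 0] by eventually_elim (simp add: f'_def)
  qed
  have "((\<lambda>T. ?N T / (T powr \<sigma> * h T)) \<longlongrightarrow> D * (\<integral>u. y u powr \<sigma> \<partial>N)) at_top"
  proof (rule abelian_transfer[OF h _ _ _ lim', where a = a and b = "(\<sigma> + 1) / 2"])
    show "\<exists>B. \<forall>t. 0 < t \<and> t \<le> t0 \<longrightarrow> \<bar>f' (1 / t)\<bar> \<le> B" for t0
      using bdd[of t0] by (auto simp: f'_def)
    show "AE u in N. y u > 0"
      unfolding N_def by (auto simp: AE_density w_def y_def indicator_def)
    show "integrable N (\<lambda>u. y u powr a)" "integrable N (\<lambda>u. y u powr ((\<sigma> + 1) / 2))"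
      using powr[of a] powr[of "(\<sigma> + 1) / 2"] \<sigma> by (auto simp: a_def has_bochner_integral_iff)
    show "(\<lambda>u. f' (1 / (T * y u))) \<in> borel_measurable N" for T
      unfolding N_def y_def by measurable
    show "y \<in> borel_measurable N" unfolding N_def y_def[abs_def] by measurable
  qed (use \<sigma> in \<open>auto simp: a_def\<close>)
  moreover have "(\<integral>u. y u powr \<sigma> \<partial>N) = Gamma (1 - \<sigma>)"
    using powr[OF \<sigma>] by (simp add: has_bochner_integral_iff)
  moreover have "?N T = ?J T" if "T > 0" for T
  proof -
    have "?N T = (\<integral>u. w u *\<^sub>R f' (1 / (T * y u)) \<partial>lborel)"
      unfolding N_def y_def using w0 by (intro integral_density) auto
    also have "\<dots> = ?J T"
      unfolding set_lebesgue_integral_def using that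
      by (intro Bochner_Integration.integral_cong) (auto simp: w_def y_def f'_def indicator_def)
    finally show ?thesis .
  qed
  then have "eventually (\<lambda>T. ?N T / (T powr \<sigma> * h T)
      = ?J T / (T powr \<sigma> * h T)) at_top"
    by (intro eventually_mono[OF eventually_gt_at_top[of "0::real"]]) simp
  ultimately show ?thesis by (auto intro: Lim_transform_eventually)
qed

section \<open>Differentiating regularly varying functions\<close>

lemma powr_difference_quotient:
  "((\<lambda>l::real. (C * l powr \<beta> - C) / (l - 1)) \<longlongrightarrow> C * \<beta>) (at 1)"
proof -
  have "((\<lambda>l::real. C * l powr \<beta>) has_field_derivative C * (\<beta> * 1 powr (\<beta> - 1))) (at 1)"
    by (rule derivative_eq_intros refl | simp)+
  then show ?thesis by (simp add: has_field_derivative_iff)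
qed

text \<open>
  For l > 1 the increment of G from T to l T is at least (l - 1) T g T, and for l < 1 the increment from l T to T
  is at most (1 - l) T g T. After division by R T the difference quotients of \<open>C * l powr \<beta>\<close>
  bound the limit points of T g T / R T, and they tend to the derivative at 1. The filter is arbitrary because the
  lemma serves both at infinity and at zero.
\<close>

lemma monotone_density:
  fixes G g R :: "real \<Rightarrow> real"
  assumes pos: "eventually (\<lambda>T. T > 0 \<and> R T > 0) F"
    and lim: "\<And>l. l > 0 \<Longrightarrow> ((\<lambda>T. G (l * T) / R T) \<longlongrightarrow> C * l powr \<beta>) F"
    and lower: "\<And>a b. 0 < a \<Longrightarrow> a < b \<Longrightarrow> (b - a) * g a \<le> G b - G a"
    and upper: "\<And>a b. 0 < a \<Longrightarrow> a < b \<Longrightarrow> G b - G a \<le> (b - a) * g b"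
  shows "((\<lambda>T. T * g T / R T) \<longlongrightarrow> C * \<beta>) F"
proof -
  have quot: "((\<lambda>T. (G (l * T) - G T) / R T / (l - 1)) \<longlongrightarrow> (C * l powr \<beta> - C) / (l - 1)) F"
    if l: "l > 0" "l \<noteq> 1" for l
  proof -
    have "((\<lambda>T. (G (l * T) / R T - G (1 * T) / R T) / (l - 1)) \<longlongrightarrow> (C * l powr \<beta> - C * 1 powr \<beta>) / (l - 1)) F"
      using l by (intro tendsto_divide tendsto_diff lim tendsto_const) auto
    then show ?thesis by (simp add: diff_divide_distrib)
  qed
  show ?thesis
  proof (rule order_tendstoI)
    fix c assume "c < C * \<beta>"
    then have "eventually (\<lambda>l. c < (C * l powr \<beta> - C) / (l - 1)) (at_left 1)"
      using powr_difference_quotient[of C \<beta>]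
      by (auto intro: order_tendstoD simp: filterlim_at_split)
    moreover have "eventually (\<lambda>l::real. 0 < l \<and> l < 1) (at_left 1)"
      using eventually_at_left_real[of 0 1] by (auto elim: eventually_mono)
    ultimately have "eventually (\<lambda>l. c < (C * l powr \<beta> - C) / (l - 1) \<and> 0 < l \<and> l < 1) (at_left 1)"
      by eventually_elim auto
    then obtain l where l: "c < (C * l powr \<beta> - C) / (l - 1)" "0 < l" "l < 1"
      using eventually_happens[of _ "at_left (1::real)"] by (auto simp: trivial_limit_at_left_real)
    have "eventually (\<lambda>T. c < (G (l * T) - G T) / R T / (l - 1)) F"
      using l by (intro order_tendstoD(1)[OF quot]) auto
    with pos show "eventually (\<lambda>T. c < T * g T / R T) F"
    proof eventually_elim
      case (elim T)
      have "G T - G (l * T) \<le> (T - l * T) * g T" using elim l by (intro upper) auto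
      then have "(G T - G (l * T)) / (1 - l) \<le> T * g T" using l by (simp add: pos_divide_le_eq algebra_simps)
      then have "(G T - G (l * T)) / (1 - l) / R T \<le> T * g T / R T" using elim by (intro divide_right_mono) auto
      moreover have "(G T - G (l * T)) / (1 - l) / R T = (G (l * T) - G T) / R T / (l - 1)"
        using minus_divide_divide[of "G (l * T) - G T" "l - 1"] by (simp add: field_simps)
      ultimately show ?case using elim by simp
    qed
  next
    fix c assume "c > C * \<beta>"
    then have "eventually (\<lambda>l. c > (C * l powr \<beta> - C) / (l - 1)) (at_right 1)"
      using powr_difference_quotient[of C \<beta>]
      by (auto intro: order_tendstoD simp: filterlim_at_split)
    moreover have "eventually (\<lambda>l::real. l > 1) (at_right 1)"
      by (simp add: eventually_at_right_less)
    ultimately have "eventually (\<lambda>l. c > (C * l powr \<beta> - C) / (l - 1) \<and> l > 1) (at_right 1)"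
      by eventually_elim auto
    then obtain l where l: "c > (C * l powr \<beta> - C) / (l - 1)" "l > 1"
      using eventually_happens[of _ "at_right (1::real)"] by (auto simp: trivial_limit_at_right_real)
    have "eventually (\<lambda>T. c > (G (l * T) - G T) / R T / (l - 1)) F"
      using l by (intro order_tendstoD(2)[OF quot]) auto
    with pos show "eventually (\<lambda>T. c > T * g T / R T) F"
    proof eventually_elim
      case (elim T)
      have "(l * T - T) * g T \<le> G (l * T) - G T" using elim l by (intro lower) auto
      then have "T * g T \<le> (G (l * T) - G T) / (l - 1)" using l by (simp add: pos_le_divide_eq algebra_simps)
      then have "T * g T / R T \<le> (G (l * T) - G T) / (l - 1) / R T" using elim by (intro divide_right_mono) auto
      moreover have "(G (l * T) - G T) / (l - 1) / R T = (G (l * T) - G T) / R T / (l - 1)"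
        by (simp add: mult.commute)
      ultimately show ?case using elim by linarith
    qed
  qed
qed

lemma antimonotone_density:
  fixes G g R :: "real \<Rightarrow> real"
  assumes pos: "eventually (\<lambda>T. T > 0 \<and> R T > 0) F"
    and lim: "\<And>l. l > 0 \<Longrightarrow> ((\<lambda>T. G (l * T) / R T) \<longlongrightarrow> C * l powr \<beta>) F"
    and lower: "\<And>a b. 0 < a \<Longrightarrow> a < b \<Longrightarrow> (b - a) * g b \<le> G b - G a"
    and upper: "\<And>a b. 0 < a \<Longrightarrow> a < b \<Longrightarrow> G b - G a \<le> (b - a) * g a"
  shows "((\<lambda>T. T * g T / R T) \<longlongrightarrow> C * \<beta>) F"
proof -
  have "((\<lambda>T. T * (- g T) / R T) \<longlongrightarrow> (- C) * \<beta>) F"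
  proof (rule monotone_density[OF pos, where G = "\<lambda>T. - G T"])
    show "((\<lambda>T. - G (l * T) / R T) \<longlongrightarrow> - C * l powr \<beta>) F" if "l > 0" for l
      using tendsto_minus[OF lim[OF that]] by simp
  next
    fix a b :: real assume "0 < a" "a < b"
    then show "(b - a) * (- g a) \<le> - G b - (- G a)" "- G b - (- G a) \<le> (b - a) * (- g b)"
      using upper[of a b] lower[of a b] by auto
  qed
  from tendsto_minus[OF this] show ?thesis by simp
qed

section \<open>Karamata's Tauberian theorem\<close>

text \<open>
  The measure whose Laplace transform is the power with exponent \<open>- \<rho>\<close>: a point mass at 0 if
  \<open>\<rho> = 0\<close>, a multiple of the measure with density u powr (\<rho> - 1) otherwise. It gives no
  mass to 1, the boundary of the test set \<open>{..<1}\<close>.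
\<close>

lemma gamma_measure_exists:
  fixes \<rho> :: real assumes "\<rho> \<ge> 0"
  obtains \<gamma> :: "real measure" where "sets \<gamma> = sets borel" "AE u in \<gamma>. u \<ge> 0" "AE u in \<gamma>. u \<noteq> 1"
    "\<And>k::nat. k \<ge> 1 \<Longrightarrow> has_bochner_integral \<gamma> (\<lambda>u. exp (- (real k * u))) (real k powr (- \<rho>))"
    "measure \<gamma> {..<1} = 1 / Gamma (1 + \<rho>)"
proof (cases "\<rho> = 0")
  case True
  show ?thesis
  proof (rule that[of "return borel 0"])
    fix k :: nat assume "k \<ge> 1"
    interpret prob_space "return borel (0::real)" by (rule prob_space_return) simp
    have "integrable (return borel 0) (\<lambda>u. exp (- (real k * u)))"
    proof (rule integrable_cong_AE[THEN iffD1])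
      show "integrable (return borel (0::real)) (\<lambda>u. 1::real)" by simp
    qed (auto simp: AE_return)
    then have "has_bochner_integral (return borel 0) (\<lambda>u. exp (- (real k * u))) 1"
      by (simp add: has_bochner_integral_iff integral_return)
    then show "has_bochner_integral (return borel 0) (\<lambda>u. exp (- (real k * u))) (real k powr (- \<rho>))"
      using True \<open>k \<ge> 1\<close> by simp
  qed (auto simp: AE_return True measure_return emeasure_return)
next
  case False
  then have \<rho>: "\<rho> > 0" using assms by simp
  have G: "Gamma \<rho> > 0" using \<rho> by (rule Gamma_real_pos)
  define w where "w u = indicator {0<..} u * (u powr (\<rho> - 1) / Gamma \<rho>)" for u :: real
  have w[measurable]: "w \<in> borel_measurable borel" and w0: "w u \<ge> 0" for u
    using G unfolding w_def[abs_def] by (auto simp: indicator_def)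
  define \<gamma> where "\<gamma> = density lborel (\<lambda>u. ennreal (w u))"
  have part: "has_bochner_integral lborel (\<lambda>u. w u * indicator {..<1} u) (1 / Gamma (1 + \<rho>))"
  proof -
    let ?c = "1 / Gamma \<rho>" and ?v = "1 powr (\<rho> - 1 + 1) / (\<rho> - 1 + 1)"
    let ?f = "\<lambda>u::real. indicator {0..1} u * u powr (\<rho> - 1)"
    have "has_bochner_integral lborel ?f ?v"
      using \<rho> by (intro has_bochner_integral_lborel_nonneg has_integral_powr_from_0) auto
    then have "has_bochner_integral lborel (\<lambda>u. ?c * ?f u) (?c * ?v)"
      by (rule has_bochner_integral_mult_right)
    moreover have "AE u in lborel. ?c * ?f u = w u * indicator {..<1} u"
      using AE_lborel_singleton[of "0::real"] AE_lborel_singleton[of "1::real"]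
      by eventually_elim (auto simp: w_def indicator_def)
    ultimately have "has_bochner_integral lborel (\<lambda>u. w u * indicator {..<1} u) (?c * ?v)"
      by (subst (asm) has_bochner_integral_cong_AE) auto
    moreover have "Gamma (1 + \<rho>) = \<rho> * Gamma \<rho>"
      using Gamma_plus1[of \<rho>] \<rho> nonpos_Ints_nonpos[of \<rho>] by (auto simp: add.commute)
    ultimately show ?thesis by (simp add: mult.commute)
  qed
  have em: "emeasure \<gamma> {..<1} = ennreal (1 / Gamma (1 + \<rho>))"
  proof -
    have "emeasure \<gamma> {..<1} = (\<integral>\<^sup>+u. ennreal (w u * indicator {..<1} u) \<partial>lborel)"
      unfolding \<gamma>_def using w0 by (subst emeasure_density) (auto intro!: nn_integral_cong simp: indicator_def)
    also have "\<dots> = ennreal (1 / Gamma (1 + \<rho>))"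
      using part w0 by (subst nn_integral_eq_integral) (auto simp: has_bochner_integral_iff)
    finally show ?thesis .
  qed
  show ?thesis
  proof (rule that[of \<gamma>])
    fix k :: nat assume "k \<ge> 1"
    have "has_bochner_integral lborel (\<lambda>u. (1 / Gamma \<rho>) * (indicator {0<..} u * (u powr (\<rho> - 1) * exp (- (real k * u)))))
        ((1 / Gamma \<rho>) * (Gamma \<rho> * real k powr (- \<rho>)))"
      using \<open>k \<ge> 1\<close> \<rho> by (intro has_bochner_integral_mult_right gamma_integral_scaled) auto
    then have "has_bochner_integral lborel (\<lambda>u. w u *\<^sub>R exp (- (real k * u))) (real k powr (- \<rho>))"
      using G by (simp add: w_def[abs_def] mult_ac)
    then show "has_bochner_integral \<gamma> (\<lambda>u. exp (- (real k * u))) (real k powr (- \<rho>))"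
      unfolding \<gamma>_def using w0 by (intro has_bochner_integral_density) auto
  next
    show "AE u in \<gamma>. u \<ge> 0" "AE u in \<gamma>. u \<noteq> 1"
      using AE_lborel_singleton[of "1::real"] unfolding \<gamma>_def
      by (auto simp: AE_density w_def indicator_def)
    show "measure \<gamma> {..<1} = 1 / Gamma (1 + \<rho>)"
      using em Gamma_real_pos[of "1 + \<rho>"] \<rho> by (auto simp: measure_def)
  qed (simp add: \<gamma>_def)
qed

lemma weighted_integral_close:
  fixes w f p :: "'a \<Rightarrow> real"
  assumes fp: "AE x in N. \<bar>f x - p x\<bar> \<le> \<eta>"
    and i: "integrable N (\<lambda>x. w x * f x)" "integrable N (\<lambda>x. w x * p x)" "integrable N w"
    and w: "\<And>x. w x \<ge> 0"
  shows "\<bar>(\<integral>x. w x * f x \<partial>N) - (\<integral>x. w x * p x \<partial>N)\<bar> \<le> \<eta> * (\<integral>x. w x \<partial>N)"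
proof -
  have "\<bar>\<integral>x. w x * f x - w x * p x \<partial>N\<bar> \<le> (\<integral>x. \<eta> * w x \<partial>N)"
  proof (rule integral_abs_bound[THEN order_trans], rule integral_mono_AE)
    show "AE x in N. \<bar>w x * f x - w x * p x\<bar> \<le> \<eta> * w x"
      using fp
    proof eventually_elim
      case (elim x)
      have "\<bar>w x * f x - w x * p x\<bar> = w x * \<bar>f x - p x\<bar>"
        unfolding right_diff_distrib[symmetric] abs_mult using w by simp
      then show ?case using mult_left_mono[OF elim w[of x]] by (simp only: mult.commute)
    qed
  qed (use i in auto)
  then show ?thesis by (simp only: Bochner_Integration.integral_diff[OF i(1,2)] integral_mult_right_zero)
qed

context
  fixes \<mu> \<gamma> :: "real measure" and R :: "real \<Rightarrow> real" and C :: real and a :: "nat \<Rightarrow> real"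
  assumes fin: "finite_measure \<mu>" and sets_\<mu>: "sets \<mu> = sets borel" and nonneg_\<mu>: "AE s in \<mu>. s \<ge> 0"
    and sets_\<gamma>: "sets \<gamma> = sets borel" and nonneg_\<gamma>: "AE u in \<gamma>. u \<ge> 0"
    and R: "eventually (\<lambda>T. R T > 0) at_top" and C: "C \<ge> 0"
    and moments: "\<And>k. k \<ge> 1 \<Longrightarrow> has_bochner_integral \<gamma> (\<lambda>u. exp (- (real k * u))) (a k)"
    and lim: "\<And>k. k \<ge> 1 \<Longrightarrow> ((\<lambda>T. (\<integral>s. exp (- (real k * T * s)) \<partial>\<mu>) / R T) \<longlongrightarrow> C * a k) at_top"
begin

text \<open>
  Test functions are evaluated at z = exp (- T s), which lies in the unit interval. The additional weight exp (- T
  s) keeps the limit functional finite although \<open>\<gamma>\<close> may be infinite.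
\<close>

private definition "scaled T f = (\<integral>s. exp (- (T * s)) * f (exp (- (T * s))) \<partial>\<mu>) / R T"
private definition "target f = C * (\<integral>u. exp (- u) * f (exp (- u)) \<partial>\<gamma>)"

private lemma borel_\<mu>: "f \<in> borel_measurable borel \<Longrightarrow> f \<in> borel_measurable \<mu>"
  using sets_\<mu> by (simp cong: measurable_cong_sets)

private lemma borel_\<gamma>: "f \<in> borel_measurable borel \<Longrightarrow> f \<in> borel_measurable \<gamma>"
  using sets_\<gamma> by (simp cong: measurable_cong_sets)

private lemma integrable_scaled:
  assumes [measurable]: "f \<in> borel_measurable borel" and b: "\<And>z. z \<in> {0..1} \<Longrightarrow> \<bar>f z\<bar> \<le> b" and T: "T \<ge> 0"
  shows "integrable \<mu> (\<lambda>s. exp (- (T * s)) * f (exp (- (T * s))))"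
proof -
  interpret finite_measure \<mu> by (rule fin)
  show ?thesis
  proof (rule integrable_const_bound[where B = b])
    show "AE s in \<mu>. norm (exp (- (T * s)) * f (exp (- (T * s)))) \<le> b"
      using nonneg_\<mu>
    proof eventually_elim
      case (elim s)
      have "norm (exp (- (T * s)) * f (exp (- (T * s)))) \<le> 1 * b"
        unfolding norm_mult using elim T b[of "exp (- (T * s))"] by (intro mult_mono) auto
      then show ?case by simp
    qed
  qed (rule borel_\<mu>, measurable)
qed

private lemma integrable_target:
  assumes [measurable]: "f \<in> borel_measurable borel" and b: "\<And>z. z \<in> {0..1} \<Longrightarrow> \<bar>f z\<bar> \<le> b"
  shows "integrable \<gamma> (\<lambda>u. exp (- u) * f (exp (- u)))"
proof (rule Bochner_Integration.integrable_bound[where f = "\<lambda>u. exp (- u) * b"])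
  show "integrable \<gamma> (\<lambda>u. exp (- u) * b)"
    using moments[of 1] by (simp add: has_bochner_integral_iff)
  show "AE u in \<gamma>. norm (exp (- u) * f (exp (- u))) \<le> norm (exp (- u) * b)"
    using nonneg_\<gamma>
  proof eventually_elim
    case (elim u)
    then show ?case using b[of "exp (- u)"] by (simp add: abs_mult mult_left_mono)
  qed
qed (rule borel_\<gamma>, measurable)

text \<open>
  On monomials the functionals are Laplace transforms at integer multiples of T.
\<close>

private lemma tendsto_polynomial:
  "((\<lambda>T. scaled T (\<lambda>z. \<Sum>i\<le>n. c i * z ^ i)) \<longlongrightarrow> target (\<lambda>z. \<Sum>i\<le>n. c i * z ^ i)) at_top"
proof -
  have pw: "exp (- w) * (c i * exp (- w) ^ i) = c i * exp (- (real (Suc i) * w))" for w i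
    by (simp add: exp_of_nat_mult[symmetric] exp_add[symmetric] algebra_simps)
  have "integrable \<gamma> (\<lambda>u. exp (- (real (Suc i) * u)))" for i
    using moments[of "Suc i"] by (simp add: has_bochner_integral_iff)
  then have "target (\<lambda>z. \<Sum>i\<le>n. c i * z ^ i) = C * (\<Sum>i\<le>n. c i * (\<integral>u. exp (- (real (Suc i) * u)) \<partial>\<gamma>))"
    unfolding target_def by (simp only: sum_distrib_left pw) (simp add: sum_distrib_left)
  also have "\<dots> = C * (\<Sum>i\<le>n. c i * a (Suc i))"
    by (intro arg_cong2[where f = "(*)"] sum.cong refl has_bochner_integral_integral_eq[OF moments]) simp
  also have "\<dots> = (\<Sum>i\<le>n. c i * (C * a (Suc i)))"
    by (simp add: sum_distrib_left mult_ac)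
  finally have t: "target (\<lambda>z. \<Sum>i\<le>n. c i * z ^ i) = (\<Sum>i\<le>n. c i * (C * a (Suc i)))" .
  have s: "scaled T (\<lambda>z. \<Sum>i\<le>n. c i * z ^ i) = (\<Sum>i\<le>n. c i * ((\<integral>s. exp (- (real (Suc i) * T * s)) \<partial>\<mu>) / R T))"
    if "T \<ge> 0" for T
  proof -
    have pw': "exp (- (T * s)) * (c i * exp (- (T * s)) ^ i) = c i * exp (- (real (Suc i) * T * s))" for s i
      using pw[of "T * s" i] by (simp add: mult_ac)
    have "integrable \<mu> (\<lambda>s. exp (- (real (Suc i) * T * s)))" for i
      using integrable_scaled[of "\<lambda>z. 1" 1 "real (Suc i) * T"] that by simp
    then show ?thesis
      unfolding scaled_def by (simp only: sum_distrib_left pw') (simp add: sum_divide_distrib)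
  qed
  have "((\<lambda>T. \<Sum>i\<le>n. c i * ((\<integral>s. exp (- (real (Suc i) * T * s)) \<partial>\<mu>) / R T)) \<longlongrightarrow> (\<Sum>i\<le>n. c i * (C * a (Suc i)))) at_top"
    by (intro tendsto_sum tendsto_mult_left lim) auto
  then show ?thesis unfolding t
  proof (rule Lim_transform_eventually)
    show "eventually (\<lambda>T. (\<Sum>i\<le>n. c i * ((\<integral>s. exp (- (real (Suc i) * T * s)) \<partial>\<mu>) / R T)) = scaled T (\<lambda>z. \<Sum>i\<le>n. c i * z ^ i)) at_top"
      using eventually_ge_at_top[of 0] by eventually_elim (rule s[symmetric])
  qed
qed

private lemma scaled_nonneg: "eventually (\<lambda>T. scaled T (\<lambda>z. 1) \<ge> 0) at_top"
  using R by eventually_elim (auto simp: scaled_def)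

text \<open>
  Weierstrass approximation, with the error controlled by the convergent values at the constant function 1.
\<close>

private lemma tendsto_continuous:
  assumes f: "continuous_on UNIV f"
  shows "((\<lambda>T. scaled T f) \<longlongrightarrow> target f) at_top"
proof (rule tendstoI)
  fix e :: real assume e: "e > 0"
  have lim1: "((\<lambda>T. scaled T (\<lambda>z. 1)) \<longlongrightarrow> target (\<lambda>z. 1)) at_top"
    using tendsto_polynomial[where n = 0 and c = "\<lambda>_. 1"] by simp
  define K where "K = target (\<lambda>z. 1) + 1"
  have "target (\<lambda>z. 1) \<ge> 0"
    by (rule tendsto_lowerbound[OF lim1 scaled_nonneg]) simp
  then have K: "K > 0" "target (\<lambda>z. 1) \<le> K" by (auto simp: K_def)
  \<comment> \<open>K bounds the functionals at the constant 1, so an approximation up to \<eta> costs at most e / 4 on each side.\<close>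
  define \<eta> where "\<eta> = e / (4 * K)"
  have \<eta>: "\<eta> > 0" using e K by (simp add: \<eta>_def)
  obtain p where p: "real_polynomial_function p" "\<And>z. z \<in> {0..1} \<Longrightarrow> \<bar>f z - p z\<bar> < \<eta>"
    using Stone_Weierstrass_real_polynomial_function[of "{0..1}" f \<eta>] continuous_on_subset[OF f] \<eta> by auto
  obtain c n where pc: "p = (\<lambda>z. \<Sum>i\<le>n. c i * z ^ i)"
    using p(1) real_polynomial_function_iff_sum by auto
  have fm[measurable]: "f \<in> borel_measurable borel" using f by (rule borel_measurable_continuous_onI)
  have pm[measurable]: "p \<in> borel_measurable borel" unfolding pc by measurable
  have fp: "\<bar>f z - p z\<bar> \<le> \<eta>" if "z \<in> {0..1}" for z using p(2)[OF that] by simp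
  have bounded_on_unit: "\<exists>b. \<forall>z\<in>{0..1}. \<bar>q z\<bar> \<le> b" if "continuous_on UNIV q" for q :: "real \<Rightarrow> real"
  proof -
    have "compact (q ` {0..1})" using continuous_on_subset[OF that] by (intro compact_continuous_image) auto
    then show ?thesis by (auto dest!: compact_imp_bounded simp: bounded_iff)
  qed
  obtain bf where bf: "\<And>z. z \<in> {0..1} \<Longrightarrow> \<bar>f z\<bar> \<le> bf" using bounded_on_unit[OF f] by blast
  have "continuous_on UNIV p" unfolding pc by (intro continuous_intros)
  then obtain bp where bp: "\<And>z. z \<in> {0..1} \<Longrightarrow> \<bar>p z\<bar> \<le> bp" using bounded_on_unit by blast
  have near_scaled: "\<bar>scaled T f - scaled T p\<bar> \<le> \<eta> * scaled T (\<lambda>z. 1)" if T: "T \<ge> 0" "R T > 0" for T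
  proof -
    have "AE s in \<mu>. \<bar>f (exp (- (T * s))) - p (exp (- (T * s)))\<bar> \<le> \<eta>"
      using nonneg_\<mu> by eventually_elim (use T in \<open>auto intro!: fp\<close>)
    from weighted_integral_close[OF this integrable_scaled[OF fm bf T(1)] integrable_scaled[OF pm bp T(1)]] T
    show ?thesis using integrable_scaled[of "\<lambda>z. 1" 1 T]
      by (simp add: scaled_def diff_divide_distrib[symmetric] abs_divide divide_right_mono)
  qed
  have near_target: "\<bar>target f - target p\<bar> \<le> \<eta> * target (\<lambda>z. 1)"
  proof -
    have "AE u in \<gamma>. \<bar>f (exp (- u)) - p (exp (- u))\<bar> \<le> \<eta>"
      using nonneg_\<gamma> by eventually_elim (auto intro!: fp)
    from weighted_integral_close[OF this integrable_target[OF fm bf] integrable_target[OF pm bp]]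
    show ?thesis using integrable_target[of "\<lambda>z. 1" 1] mult_left_mono[OF _ C]
      by (simp add: target_def right_diff_distrib[symmetric] abs_mult C mult.left_commute)
  qed
  have \<eta>K: "\<eta> * K = e / 4" using K by (simp add: \<eta>_def)
  have "((\<lambda>T. scaled T p) \<longlongrightarrow> target p) at_top" unfolding pc by (rule tendsto_polynomial)
  then have "eventually (\<lambda>T. dist (scaled T p) (target p) < e / 4) at_top"
    using e by (intro tendstoD) auto
  moreover have "eventually (\<lambda>T. scaled T (\<lambda>z. 1) < K) at_top"
    by (rule order_tendstoD(2)[OF lim1]) (simp add: K_def)
  ultimately show "eventually (\<lambda>T. dist (scaled T f) (target f) < e) at_top"
    using R eventually_ge_at_top[of 0]
  proof eventually_elim
    case (elim T)
    have "\<bar>scaled T f - scaled T p\<bar> \<le> e / 4"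
      using near_scaled[of T] elim mult_left_mono[of "scaled T (\<lambda>z. 1)" K \<eta>] \<eta> \<eta>K by auto
    moreover have "\<bar>target f - target p\<bar> \<le> e / 4"
      using near_target mult_left_mono[OF K(2), of \<eta>] \<eta> \<eta>K by auto
    ultimately show ?case using elim e unfolding dist_real_def by arith
  qed
qed

text \<open>
  The indicator of u < 1, divided by the weight, is the function \<open>cutoff\<close> of z = exp (- u); it jumps
  at \<open>z0\<close>. Ramps of slope n on either side of the jump give continuous functions below and above it.
\<close>

private definition "z0 = exp (-1 :: real)"
private definition "ramp b n z = max 0 (min 1 (real n * (z - z0) + b)) / max z z0"
private definition "cutoff z = indicator {z0<..} z / max z z0"

private lemma z0_pos: "z0 > 0" by (simp add: z0_def)

private lemma continuous_ramp: "continuous_on UNIV (ramp b n)"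
  unfolding ramp_def[abs_def] using z0_pos
  by (auto intro!: continuous_intros simp: less_max_iff_disj dest: less_imp_neq)

private lemma cutoff_meas: "cutoff \<in> borel_measurable borel"
  unfolding cutoff_def[abs_def] by measurable

private lemma ramp_bounds:
  "ramp 0 n z \<le> cutoff z" "cutoff z \<le> ramp 1 n z" "\<bar>cutoff z\<bar> \<le> 1 / z0" "\<bar>ramp b n z\<bar> \<le> 1 / z0"
proof -
  have m: "max z z0 > 0" using z0_pos by simp
  show "ramp 0 n z \<le> cutoff z" "cutoff z \<le> ramp 1 n z"
    unfolding ramp_def cutoff_def using m
    by (auto intro!: divide_right_mono simp: indicator_def mult_nonneg_nonpos min.coboundedI2)
  have "\<bar>c / max z z0\<bar> \<le> 1 / z0" if "0 \<le> c" "c \<le> 1" for c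
    using that z0_pos m by (simp add: abs_divide frac_le)
  then show "\<bar>cutoff z\<bar> \<le> 1 / z0" "\<bar>ramp b n z\<bar> \<le> 1 / z0"
    unfolding ramp_def cutoff_def by (auto simp: indicator_def)
qed

private lemma ramp_limit:
  assumes "z \<noteq> z0" and b: "0 \<le> b" "b \<le> 1"
  shows "(\<lambda>n. ramp b n z) \<longlonglongrightarrow> cutoff z"
proof -
  have "\<bar>z - z0\<bar> > 0" using assms by simp
  then obtain N where N: "real N * \<bar>z - z0\<bar> > 1" by (metis reals_Archimedean3)
  have "ramp b n z = cutoff z" if n: "n \<ge> N" for n
  proof -
    have "real N * \<bar>z - z0\<bar> \<le> real n * \<bar>z - z0\<bar>" using n by (intro mult_right_mono) auto
    then have steep: "real n * \<bar>z - z0\<bar> > 1" using N by simp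
    show ?thesis
    proof (cases "z > z0")
      case True
      then show ?thesis using steep b by (simp add: ramp_def cutoff_def)
    next
      case False
      then have "real n * (z - z0) < -1" using steep by (simp add: algebra_simps)
      then show ?thesis using False b by (simp add: ramp_def cutoff_def)
    qed
  qed
  then show ?thesis by (intro tendsto_eventually eventually_sequentiallyI[of N])
qed

private lemma weighted_cutoff: "exp (- w) * cutoff (exp (- w)) = indicator {..<1} w" for w
  by (auto simp: cutoff_def z0_def indicator_def max_def)

text \<open>
  The limits for the ramps agree in the limit of steep slope, since \<open>\<gamma>\<close> does not charge the
  jump.
\<close>

lemma tauberian_of_moments:
  assumes ne1: "AE u in \<gamma>. u \<noteq> 1"
  shows "((\<lambda>T. measure \<mu> {..<1 / T} / R T) \<longlongrightarrow> C * measure \<gamma> {..<1}) at_top"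
proof -
  note ramp_meas = continuous_ramp[THEN borel_measurable_continuous_onI]
  have target_lim: "(\<lambda>n. target (ramp b n)) \<longlonglongrightarrow> target cutoff"
    if b: "0 \<le> b" "b \<le> 1" for b
    unfolding target_def
  proof (intro tendsto_mult_left integral_dominated_convergence)
    show "integrable \<gamma> (\<lambda>u. exp (- u) * (1 / z0))"
      using integrable_target[of "\<lambda>z. 1 / z0" "1 / z0"] z0_pos by simp
    show "AE u in \<gamma>. (\<lambda>n. exp (- u) * ramp b n (exp (- u))) \<longlonglongrightarrow> exp (- u) * cutoff (exp (- u))"
      using ne1 by eventually_elim (auto intro!: tendsto_mult_left ramp_limit b simp: z0_def)
    show "AE u in \<gamma>. norm (exp (- u) * ramp b n (exp (- u))) \<le> exp (- u) * (1 / z0)" for n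
      unfolding norm_mult using ramp_bounds(4) by (intro AE_I2 mult_mono) auto
    show "(\<lambda>u. exp (- u) * ramp b n (exp (- u))) \<in> borel_measurable \<gamma>" for n
      by (intro borel_\<gamma> borel_measurable_times measurable_compose[OF _ ramp_meas]) auto
    show "(\<lambda>u. exp (- u) * cutoff (exp (- u))) \<in> borel_measurable \<gamma>"
      by (intro borel_\<gamma> borel_measurable_times measurable_compose[OF _ cutoff_meas]) auto
  qed
  have "((\<lambda>T. scaled T cutoff) \<longlongrightarrow> target cutoff) at_top"
  proof (rule order_tendstoI)
    fix c assume "c < target cutoff"
    then have "eventually (\<lambda>n. c < target (ramp 0 n)) sequentially"
      by (intro order_tendstoD(1)[OF target_lim]) auto
    then obtain n where n: "c < target (ramp 0 n)" by (auto dest: eventually_happens)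
    have "eventually (\<lambda>T. c < scaled T (ramp 0 n)) at_top"
      by (rule order_tendstoD(1)[OF tendsto_continuous[OF continuous_ramp] n])
    then show "eventually (\<lambda>T. c < scaled T cutoff) at_top"
      using R eventually_ge_at_top[of 0]
    proof eventually_elim
      case (elim T)
      have "scaled T (ramp 0 n) \<le> scaled T cutoff" unfolding scaled_def
        using elim ramp_meas cutoff_meas
        by (intro divide_right_mono integral_mono integrable_scaled[where b = "1 / z0"] mult_left_mono ramp_bounds) auto
      then show ?case using elim by simp
    qed
  next
    fix c assume "c > target cutoff"
    then have "eventually (\<lambda>n. c > target (ramp 1 n)) sequentially"
      by (intro order_tendstoD(2)[OF target_lim]) auto
    then obtain n where n: "c > target (ramp 1 n)" by (auto dest: eventually_happens)
    have "eventually (\<lambda>T. c > scaled T (ramp 1 n)) at_top"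
      by (rule order_tendstoD(2)[OF tendsto_continuous[OF continuous_ramp] n])
    then show "eventually (\<lambda>T. c > scaled T cutoff) at_top"
      using R eventually_ge_at_top[of 0]
    proof eventually_elim
      case (elim T)
      have "scaled T cutoff \<le> scaled T (ramp 1 n)" unfolding scaled_def
        using elim ramp_meas cutoff_meas
        by (intro divide_right_mono integral_mono integrable_scaled[where b = "1 / z0"] mult_left_mono ramp_bounds) auto
      then show ?case using elim by simp
    qed
  qed
  moreover have "target cutoff = C * measure \<gamma> {..<1}"
    unfolding target_def weighted_cutoff
    using sets_\<gamma> sets_eq_imp_space_eq[OF sets_\<gamma>] by simp
  moreover have "eventually (\<lambda>T. scaled T cutoff = measure \<mu> {..<1 / T} / R T) at_top"
    using eventually_gt_at_top[of 0]
  proof eventually_elim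
    case (elim T)
    have "indicator {..<1} (T * s) = (indicator {..<1 / T} s :: real)" for s
      using elim by (auto simp: indicator_def field_simps)
    then show ?case unfolding scaled_def weighted_cutoff
      using sets_\<mu> sets_eq_imp_space_eq[OF sets_\<mu>] by simp
  qed
  ultimately show ?thesis by (auto intro: Lim_transform_eventually)
qed

end

text \<open>
  The proof is Karamata's: convergence of Laplace transforms is convergence on polynomials in exp (- T s), extends
  to continuous functions, and then to a jump that the limit measure does not charge.
\<close>

theorem Karamata_Tauberian:
  fixes \<mu> :: "real measure"
  assumes "finite_measure \<mu>" "sets \<mu> = sets borel" "AE s in \<mu>. s \<ge> 0"
    and "eventually (\<lambda>T. R T > 0) at_top" and C: "C \<ge> 0" and \<rho>: "\<rho> \<ge> 0"
    and lim: "\<And>k::real. k > 0 \<Longrightarrow> ((\<lambda>T. (\<integral>s. exp (- (k * T * s)) \<partial>\<mu>) / R T) \<longlongrightarrow> C * k powr (- \<rho>)) at_top"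
  shows "((\<lambda>T. measure \<mu> {..<1 / T} / R T) \<longlongrightarrow> C / Gamma (1 + \<rho>)) at_top"
proof -
  obtain \<gamma> :: "real measure" where \<gamma>: "sets \<gamma> = sets borel" "AE u in \<gamma>. u \<ge> 0" "AE u in \<gamma>. u \<noteq> 1"
    "\<And>k::nat. k \<ge> 1 \<Longrightarrow> has_bochner_integral \<gamma> (\<lambda>u. exp (- (real k * u))) (real k powr (- \<rho>))"
    "measure \<gamma> {..<1} = 1 / Gamma (1 + \<rho>)"
    using gamma_measure_exists[OF \<rho>] by blast
  show ?thesis
    using tauberian_of_moments[OF assms(1-3) \<gamma>(1,2) assms(4) C \<gamma>(4) lim \<gamma>(3)] \<gamma>(5) by simp
qed

section \<open>The Laplace transform of a measure and its primitives\<close>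

text \<open>
  Tonelli's theorem for real-valued integrands: for a nonnegative kernel it suffices that almost every slice is
  integrable.
\<close>

lemma nn_integral_integral_swap:
  fixes K :: "'a \<Rightarrow> 'b \<Rightarrow> real"
  assumes "sigma_finite_measure N" "sigma_finite_measure \<mu>"
    and [measurable]: "case_prod K \<in> borel_measurable (N \<Otimes>\<^sub>M \<mu>)"
    and K: "\<And>v s. K v s \<ge> 0"
    and int: "AE v in N. integrable \<mu> (K v)" "AE s in \<mu>. integrable N (\<lambda>v. K v s)"
  shows "(\<integral>\<^sup>+v. ennreal (\<integral>s. K v s \<partial>\<mu>) \<partial>N) = (\<integral>\<^sup>+s. ennreal (\<integral>v. K v s \<partial>N) \<partial>\<mu>)"
proof -
  interpret N: sigma_finite_measure N by fact
  interpret \<mu>: sigma_finite_measure \<mu> by fact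
  interpret pair_sigma_finite N \<mu> ..
  have "(\<integral>\<^sup>+v. ennreal (\<integral>s. K v s \<partial>\<mu>) \<partial>N) = (\<integral>\<^sup>+v. \<integral>\<^sup>+s. ennreal (K v s) \<partial>\<mu> \<partial>N)"
    using int(1) by (intro nn_integral_cong_AE) (auto elim!: eventually_mono simp: nn_integral_eq_integral K)
  also have "\<dots> = (\<integral>\<^sup>+s. \<integral>\<^sup>+v. ennreal (K v s) \<partial>N \<partial>\<mu>)"
    by (rule Fubini'[symmetric]) measurable
  also have "\<dots> = (\<integral>\<^sup>+s. ennreal (\<integral>v. K v s \<partial>N) \<partial>\<mu>)"
    using int(2) by (intro nn_integral_cong_AE) (auto elim!: eventually_mono simp: nn_integral_eq_integral K)
  finally show ?thesis .
qed

lemma integral_integral_swap: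
  fixes K :: "'a \<Rightarrow> 'b \<Rightarrow> real"
  assumes sf: "sigma_finite_measure N" "sigma_finite_measure \<mu>"
    and [measurable]: "case_prod K \<in> borel_measurable (N \<Otimes>\<^sub>M \<mu>)"
    and K: "\<And>v s. K v s \<ge> 0"
    and int: "AE v in N. integrable \<mu> (K v)" "AE s in \<mu>. integrable N (\<lambda>v. K v s)"
  shows "(\<integral>v. (\<integral>s. K v s \<partial>\<mu>) \<partial>N) = (\<integral>s. (\<integral>v. K v s \<partial>N) \<partial>\<mu>)"
proof -
  interpret N: sigma_finite_measure N by fact
  interpret \<mu>: sigma_finite_measure \<mu> by fact
  interpret P: pair_sigma_finite N \<mu> ..
  have [measurable]: "(\<lambda>v. \<integral>s. K v s \<partial>\<mu>) \<in> borel_measurable N"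
    by (rule \<mu>.borel_measurable_lebesgue_integral) measurable
  have [measurable]: "(\<lambda>s. \<integral>v. K v s \<partial>N) \<in> borel_measurable \<mu>"
    by (rule N.borel_measurable_lebesgue_integral) measurable
  show ?thesis
    using nn_integral_integral_swap[OF assms]
    by (subst (1 3) integral_eq_nn_integral) (auto simp: K)
qed

text \<open>
  The primitive in T of exp (- T s) that vanishes at T = 0; the case s = 0 is the continuous extension.
\<close>

definition primitive_kernel :: "real \<Rightarrow> real \<Rightarrow> real" where
  "primitive_kernel T s = (if s = 0 then T else (1 - exp (- (T * s))) / s)"

text \<open>
  The primitive in T of \<open>primitive_kernel\<close>. Twice its value is, for large T, the contribution of a
  spectral point t = 1 - s to the variance.
\<close>

definition second_primitive_kernel :: "real \<Rightarrow> real \<Rightarrow> real" where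
  "second_primitive_kernel T s = (if s = 0 then T\<^sup>2 / 2 else (exp (- (T * s)) - 1 + T * s) / s\<^sup>2)"

lemma primitive_kernel_measurable [measurable]:
  assumes [measurable]: "f \<in> borel_measurable M" "g \<in> borel_measurable M"
  shows "(\<lambda>x. primitive_kernel (f x) (g x)) \<in> borel_measurable M"
  unfolding primitive_kernel_def by measurable

lemma second_primitive_kernel_measurable [measurable]:
  assumes [measurable]: "g \<in> borel_measurable M"
  shows "(\<lambda>x. second_primitive_kernel T (g x)) \<in> borel_measurable M"
  unfolding second_primitive_kernel_def by measurable

lemma primitive_kernel_deriv:
  "((\<lambda>T. primitive_kernel T s) has_real_derivative exp (- (T * s))) (at T within A)"
  by (cases "s = 0") (auto simp: primitive_kernel_def intro!: derivative_eq_intros)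

lemma second_primitive_kernel_deriv:
  "((\<lambda>T. second_primitive_kernel T s) has_real_derivative primitive_kernel T s) (at T within A)"
  by (cases "s = 0") (auto simp: primitive_kernel_def second_primitive_kernel_def power2_eq_square field_simps
      intro!: derivative_eq_intros)

lemma primitive_kernel_0 [simp]: "primitive_kernel 0 s = 0" "second_primitive_kernel 0 s = 0"
  by (auto simp: primitive_kernel_def second_primitive_kernel_def)

lemma increment_bounds:
  fixes G g :: "real \<Rightarrow> real"
  assumes "a \<le> b" and deriv: "\<And>T. (G has_real_derivative g T) (at T)"
  obtains z where "a \<le> z" "z \<le> b" "G b - G a = (b - a) * g z"
proof (cases "a = b")
  case False
  then have "a < b" using assms by simp
  from MVT2[OF this deriv] obtain z where "a < z" "z < b" "G b - G a = (b - a) * g z" by auto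
  then show ?thesis using that[of z] by auto
qed (use that in auto)

lemma primitive_kernel_increment:
  assumes "s \<ge> 0" "a \<le> b"
  shows "(b - a) * exp (- (b * s)) \<le> primitive_kernel b s - primitive_kernel a s"
    and "primitive_kernel b s - primitive_kernel a s \<le> (b - a) * exp (- (a * s))"
proof -
  obtain z where z: "a \<le> z" "z \<le> b" "primitive_kernel b s - primitive_kernel a s = (b - a) * exp (- (z * s))"
    using increment_bounds[OF assms(2) primitive_kernel_deriv] by blast
  have "z * s \<le> b * s" "a * s \<le> z * s" using z assms by (auto intro: mult_right_mono)
  then show "(b - a) * exp (- (b * s)) \<le> primitive_kernel b s - primitive_kernel a s"
    "primitive_kernel b s - primitive_kernel a s \<le> (b - a) * exp (- (a * s))"
    unfolding z using assms by (auto intro!: mult_left_mono)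
qed

lemma primitive_kernel_mono: "a \<le> b \<Longrightarrow> s \<ge> 0 \<Longrightarrow> primitive_kernel a s \<le> primitive_kernel b s"
  using primitive_kernel_increment(1)[of s a b] by (smt (verit) exp_ge_zero mult_nonneg_nonneg)

lemma second_primitive_kernel_increment:
  assumes "s \<ge> 0" "a \<le> b"
  shows "(b - a) * primitive_kernel a s \<le> second_primitive_kernel b s - second_primitive_kernel a s"
    and "second_primitive_kernel b s - second_primitive_kernel a s \<le> (b - a) * primitive_kernel b s"
proof -
  obtain z where z: "a \<le> z" "z \<le> b"
      "second_primitive_kernel b s - second_primitive_kernel a s = (b - a) * primitive_kernel z s"
    using increment_bounds[OF assms(2) second_primitive_kernel_deriv] by blast
  then show "(b - a) * primitive_kernel a s \<le> second_primitive_kernel b s - second_primitive_kernel a s"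
    "second_primitive_kernel b s - second_primitive_kernel a s \<le> (b - a) * primitive_kernel b s"
    using assms by (auto intro!: mult_left_mono primitive_kernel_mono)
qed

lemma primitive_kernel_bounds:
  assumes "T \<ge> 0" shows "0 \<le> primitive_kernel T s" and "s \<ge> 0 \<Longrightarrow> primitive_kernel T s \<le> T"
proof -
  obtain z where "primitive_kernel T s - primitive_kernel 0 s = (T - 0) * exp (- (z * s))"
    using increment_bounds[OF assms primitive_kernel_deriv] by blast
  then show "0 \<le> primitive_kernel T s" using assms by simp
  show "primitive_kernel T s \<le> T" if "s \<ge> 0" using primitive_kernel_increment(2)[OF that assms] by simp
qed

lemma second_primitive_kernel_bounds:
  assumes "T \<ge> 0" shows "0 \<le> second_primitive_kernel T s" and "s \<ge> 0 \<Longrightarrow> second_primitive_kernel T s \<le> T\<^sup>2"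
proof -
  obtain z where "0 \<le> z" "second_primitive_kernel T s - second_primitive_kernel 0 s = (T - 0) * primitive_kernel z s"
    using increment_bounds[OF assms second_primitive_kernel_deriv] by blast
  then show "0 \<le> second_primitive_kernel T s" using assms primitive_kernel_bounds(1)[of z s] by simp
  show "second_primitive_kernel T s \<le> T\<^sup>2" if "s \<ge> 0"
  proof -
    have "second_primitive_kernel T s \<le> T * primitive_kernel T s"
      using second_primitive_kernel_increment(2)[OF that assms] by simp
    also have "\<dots> \<le> T * T" using primitive_kernel_bounds(2)[OF assms that] assms by (rule mult_left_mono)
    finally show ?thesis by (simp add: power2_eq_square)
  qed
qed

lemma unit_integral_of_derivative:
  fixes G g :: "real \<Rightarrow> real"
  assumes deriv: "\<And>T. (G has_real_derivative g T) (at T)" and cont: "continuous_on UNIV g" and T: "T > 0"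
  shows "has_bochner_integral lborel (\<lambda>v. indicator {0..1} v * g (T * v)) ((G T - G 0) / T)"
proof -
  have "has_bochner_integral lborel (\<lambda>v. indicator {0..1} v *\<^sub>R g (T * v)) (G (T * 1) / T - G (T * 0) / T)"
  proof (rule has_bochner_integral_FTC_Icc)
    show "((\<lambda>v. G (T * v) / T) has_vector_derivative g (T * x)) (at x within {0..1})" for x
    proof -
      have "((\<lambda>v. G (T * v)) has_real_derivative g (T * x) * T) (at x)"
        by (rule DERIV_chain2[OF deriv]) (auto intro!: derivative_eq_intros)
      then have "((\<lambda>v. G (T * v) / T) has_real_derivative g (T * x) * T / T) (at x)"
        by (rule DERIV_cdivide)
      then show ?thesis using T
        by (simp add: has_real_derivative_iff_has_vector_derivative has_vector_derivative_at_within)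
    qed
    show "continuous_on {0..1} (\<lambda>v. g (T * v))"
      by (rule continuous_on_compose2[OF cont]) (auto intro!: continuous_intros)
  qed simp
  then show ?thesis by (simp add: diff_divide_distrib)
qed

text \<open>
  The image of a spectral measure under t \<mapsto> 1 - t: the point t = 1, which governs long-range dependence,
  is moved to s = 0.
\<close>

locale shifted_spectral_measure = finite_measure \<mu> for \<mu> :: "real measure" +
  assumes sets_eq [measurable_cong]: "sets \<mu> = sets borel" and support: "AE s in \<mu>. 0 \<le> s \<and> s \<le> 2"
begin

abbreviation "total_mass \<equiv> measure \<mu> (space \<mu>)"

definition "laplace T = (\<integral>s. exp (- (T * s)) \<partial>\<mu>)"
definition "primitive T = (\<integral>s. primitive_kernel T s \<partial>\<mu>)"
definition "second_primitive T = (\<integral>s. second_primitive_kernel T s \<partial>\<mu>)"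
text \<open>
  In the variable t = 1 - s this is the function V of the theorem.
\<close>

definition "inverse_tail x = (\<integral>s. (if x \<le> s then 1 / s else 0) \<partial>\<mu>)"

lemma nonneg: "AE s in \<mu>. 0 \<le> s"
  using support by eventually_elim simp

lemma integrable_kernels:
  assumes "T \<ge> 0"
  shows "integrable \<mu> (\<lambda>s. exp (- (T * s)))" "integrable \<mu> (primitive_kernel T)"
    "integrable \<mu> (second_primitive_kernel T)"
proof -
  show "integrable \<mu> (\<lambda>s. exp (- (T * s)))"
    by (rule integrable_const_bound[where B = 1]) (use nonneg assms in \<open>auto elim!: eventually_mono\<close>)
  show "integrable \<mu> (primitive_kernel T)"
    by (rule integrable_const_bound[where B = T])
      (use nonneg primitive_kernel_bounds assms in \<open>auto elim!: eventually_mono\<close>)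
  show "integrable \<mu> (second_primitive_kernel T)"
    by (rule integrable_const_bound[where B = "T\<^sup>2"])
      (use nonneg second_primitive_kernel_bounds assms in \<open>auto elim!: eventually_mono\<close>)
qed

lemma laplace_bounds: "T \<ge> 0 \<Longrightarrow> 0 \<le> laplace T" "T \<ge> 0 \<Longrightarrow> laplace T \<le> total_mass"
proof -
  assume T: "T \<ge> 0"
  show "0 \<le> laplace T" by (simp add: laplace_def)
  have "laplace T \<le> (\<integral>s. 1 \<partial>\<mu>)" unfolding laplace_def
    by (rule integral_mono_AE[OF integrable_kernels(1)[OF T]])
      (use nonneg T in \<open>auto elim!: eventually_mono\<close>)
  then show "laplace T \<le> total_mass" by simp
qed

lemma primitive_bounds: "T \<ge> 0 \<Longrightarrow> 0 \<le> primitive T" "T \<ge> 0 \<Longrightarrow> primitive T \<le> T * total_mass"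
proof -
  assume T: "T \<ge> 0"
  show "0 \<le> primitive T" using primitive_kernel_bounds(1)[OF T] by (simp add: primitive_def)
  have "primitive T \<le> (\<integral>s. T \<partial>\<mu>)" unfolding primitive_def
    by (rule integral_mono_AE[OF integrable_kernels(2)[OF T]])
      (use nonneg T primitive_kernel_bounds in \<open>auto elim!: eventually_mono\<close>)
  then show "primitive T \<le> T * total_mass" by (simp add: mult.commute)
qed

lemma laplace_measurable [measurable]: "laplace \<in> borel_measurable borel"
  unfolding laplace_def[abs_def] by (rule borel_measurable_lebesgue_integral) measurable

lemma primitive_measurable [measurable]: "primitive \<in> borel_measurable borel"
  unfolding primitive_def[abs_def] by (rule borel_measurable_lebesgue_integral) measurable

lemma primitive_increment:
  assumes "0 \<le> a" "a \<le> b"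
  shows "(b - a) * laplace b \<le> primitive b - primitive a" "primitive b - primitive a \<le> (b - a) * laplace a"
proof -
  have i: "integrable \<mu> (\<lambda>s. (b - a) * exp (- (b * s)))" "integrable \<mu> (\<lambda>s. (b - a) * exp (- (a * s)))"
      "integrable \<mu> (\<lambda>s. primitive_kernel b s - primitive_kernel a s)"
    using integrable_kernels[of a] integrable_kernels[of b] assms by auto
  have eq: "primitive b - primitive a = (\<integral>s. primitive_kernel b s - primitive_kernel a s \<partial>\<mu>)"
    "\<And>T. (b - a) * laplace T = (\<integral>s. (b - a) * exp (- (T * s)) \<partial>\<mu>)"
    using integrable_kernels[of a] integrable_kernels[of b] assms by (auto simp: primitive_def laplace_def)
  show "(b - a) * laplace b \<le> primitive b - primitive a" "primitive b - primitive a \<le> (b - a) * laplace a"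
    unfolding eq using nonneg
    by (auto intro!: integral_mono_AE i primitive_kernel_increment assms simp del: integral_mult_right_zero elim!: eventually_mono)
qed

lemma second_primitive_increment:
  assumes "0 \<le> a" "a \<le> b"
  shows "(b - a) * primitive a \<le> second_primitive b - second_primitive a"
    "second_primitive b - second_primitive a \<le> (b - a) * primitive b"
proof -
  have i: "integrable \<mu> (\<lambda>s. (b - a) * primitive_kernel b s)" "integrable \<mu> (\<lambda>s. (b - a) * primitive_kernel a s)"
      "integrable \<mu> (\<lambda>s. second_primitive_kernel b s - second_primitive_kernel a s)"
    using integrable_kernels[of a] integrable_kernels[of b] assms by auto
  have eq: "second_primitive b - second_primitive a = (\<integral>s. second_primitive_kernel b s - second_primitive_kernel a s \<partial>\<mu>)"
    "\<And>T. (b - a) * primitive T = (\<integral>s. (b - a) * primitive_kernel T s \<partial>\<mu>)"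
    using integrable_kernels[of a] integrable_kernels[of b] assms by (auto simp: primitive_def second_primitive_def)
  show "(b - a) * primitive a \<le> second_primitive b - second_primitive a"
    "second_primitive b - second_primitive a \<le> (b - a) * primitive b"
    unfolding eq using nonneg
    by (auto intro!: integral_mono_AE i second_primitive_kernel_increment assms simp del: integral_mult_right_zero elim!: eventually_mono)
qed

lemma second_primitive_mono:
  assumes "0 \<le> a" "a \<le> b" shows "second_primitive a \<le> second_primitive b"
  using second_primitive_increment(1)[OF assms] primitive_bounds(1)[OF assms(1)] assms
  by (smt (verit) mult_nonneg_nonneg)

text \<open>
  The fundamental theorem of calculus for each s, followed by an exchange of integrals. The range of integration
  is rescaled to the unit interval, as \<open>abelian_unit_interval\<close> requires.
\<close>

lemma unit_integral_swap:
  assumes deriv: "\<And>s T. ((\<lambda>T. G T s) has_real_derivative g T s) (at T)" and G0: "\<And>s. G 0 s = 0"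
    and cont: "\<And>s. continuous_on UNIV (\<lambda>T. g T s)"
    and [measurable]: "(\<lambda>(T, s). g T s) \<in> borel_measurable borel"
    and g: "\<And>T s. T \<ge> 0 \<Longrightarrow> g T s \<ge> 0" and int: "\<And>T. T \<ge> 0 \<Longrightarrow> integrable \<mu> (g T)" and T: "T > 0"
  shows "(\<integral>s. G T s \<partial>\<mu>) = T * (LINT v:{0..1}|lborel. (\<integral>s. g (T * v) s \<partial>\<mu>))"
proof -
  have FTC: "has_bochner_integral lborel (\<lambda>v. indicator {0..1} v * g (T * v) s) (G T s / T)" for s
    using unit_integral_of_derivative[OF deriv cont T, of s] G0 by simp
  have [measurable]: "(\<lambda>x. g (fst x) (snd x)) \<in> borel_measurable (borel \<Otimes>\<^sub>M borel)"
    using assms(4) by (simp add: case_prod_beta' borel_prod)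
  have "(\<integral>v. (\<integral>s. indicator {0..1} v * g (T * v) s \<partial>\<mu>) \<partial>lborel) = (\<integral>s. (\<integral>v. indicator {0..1} v * g (T * v) s \<partial>lborel) \<partial>\<mu>)"
  proof (rule integral_integral_swap)
    have "(\<lambda>x. indicator {0..1} (fst x) * g (T * fst x) (snd x)) \<in> borel_measurable (lborel \<Otimes>\<^sub>M \<mu>)"
    proof -
      have "(\<lambda>x. (T * fst x, snd x)) \<in> lborel \<Otimes>\<^sub>M \<mu> \<rightarrow>\<^sub>M borel \<Otimes>\<^sub>M borel" by measurable
      from measurable_compose[OF this, of "\<lambda>x. g (fst x) (snd x)" borel]
      have [measurable]: "(\<lambda>x. g (T * fst x) (snd x)) \<in> borel_measurable (lborel \<Otimes>\<^sub>M \<mu>)" by simp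
      show ?thesis by measurable
    qed
    then show "(\<lambda>(v, s). indicator {0..1} v * g (T * v) s) \<in> borel_measurable (lborel \<Otimes>\<^sub>M \<mu>)"
      by (simp add: case_prod_beta')
    show "0 \<le> indicator {0..1} v * g (T * v) s" for v s
      using g[of "T * v" s] T by (auto simp: indicator_def)
    show "AE v in lborel. integrable \<mu> (\<lambda>s. indicator {0..1} v * g (T * v) s)"
      using int T by (auto simp: indicator_def)
    show "AE s in \<mu>. integrable lborel (\<lambda>v. indicator {0..1} v * g (T * v) s)"
      using FTC by (auto simp: has_bochner_integral_iff)
  qed (unfold_locales)
  also have "\<dots> = (\<integral>s. G T s / T \<partial>\<mu>)"
    using FTC by (simp add: has_bochner_integral_iff)
  finally show ?thesis using T by (simp add: set_lebesgue_integral_def)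
qed

lemma primitive_eq_unit_integral: "T > 0 \<Longrightarrow> primitive T = T * (LINT v:{0..1}|lborel. laplace (T * v))"
  unfolding primitive_def laplace_def
  by (rule unit_integral_swap[OF primitive_kernel_deriv _ _ _ _ integrable_kernels(1)])
    (auto simp: case_prod_beta' borel_prod[symmetric] intro!: continuous_intros)

lemma second_primitive_eq_unit_integral:
  "T > 0 \<Longrightarrow> second_primitive T = T * (LINT v:{0..1}|lborel. primitive (T * v))"
  unfolding primitive_def second_primitive_def
  by (rule unit_integral_swap[OF second_primitive_kernel_deriv _ _ _ _ integrable_kernels(2)])
    (auto simp: case_prod_beta' borel_prod[symmetric] intro!: primitive_kernel_bounds continuous_at_imp_continuous_on DERIV_isCont[OF primitive_kernel_deriv])

text \<open>
  Write exp (- T s) as the probability that a standard exponential variable exceeds T s and exchange the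
  integrals.
\<close>

lemma laplace_eq_distribution_integral:
  assumes T: "T > 0"
  shows "laplace T = (LINT u:{0<..}|lborel. exp (- u) * measure \<mu> {..<u / T})"
proof -
  let ?e = "\<lambda>s u. indicator {0<..} (- (T * s) + 1 * u) * ((- (T * s) + 1 * u) powr (1 - 1) * exp (- (1 * (- (T * s) + 1 * u))))"
  have space: "space \<mu> = UNIV" using sets_eq_imp_space_eq[OF sets_eq] by simp
  define K where "K u s = indicator {0<..} u * (exp (- u) * indicator {s. T * s < u} s)" for u s :: real
  have expo: "has_bochner_integral lborel (\<lambda>u. K u s) (exp (- (T * s)))" if "s \<ge> 0" for s
  proof -
    have "has_bochner_integral lborel (?e s)
        (Gamma 1 * 1 powr - 1 /\<^sub>R \<bar>1\<bar>)"
      by (intro lborel_has_bochner_integral_real_affine_iff[THEN iffD1] gamma_integral_scaled) auto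
    then have "has_bochner_integral lborel (\<lambda>u. exp (- (T * s)) * ?e s u)
        (exp (- (T * s)) * (Gamma 1 * 1 powr - 1 /\<^sub>R \<bar>1\<bar>))"
      by (rule has_bochner_integral_mult_right)
    moreover have "exp (- (T * s)) * ?e s u = K u s" for u
    proof -
      have "T * s \<ge> 0" using that T by simp
      then show ?thesis by (auto simp: K_def indicator_def exp_add[symmetric])
    qed
    ultimately show ?thesis by (simp only:) simp
  qed
  have "(\<integral>u. (\<integral>s. K u s \<partial>\<mu>) \<partial>lborel) = (\<integral>s. (\<integral>u. K u s \<partial>lborel) \<partial>\<mu>)"
  proof (rule integral_integral_swap)
    show "case_prod K \<in> borel_measurable (lborel \<Otimes>\<^sub>M \<mu>)"
      unfolding K_def[abs_def] by measurable
    show "AE u in lborel. integrable \<mu> (K u)"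
    proof (rule AE_I2)
      fix u
      show "integrable \<mu> (K u)" unfolding K_def[abs_def]
        by (rule integrable_const_bound[where B = 1]) (auto simp: indicator_def)
    qed
    show "AE s in \<mu>. integrable lborel (\<lambda>u. K u s)"
      using nonneg expo by (auto simp: has_bochner_integral_iff elim!: eventually_mono)
  qed (unfold_locales, simp add: K_def)
  moreover have "(\<integral>s. (\<integral>u. K u s \<partial>lborel) \<partial>\<mu>) = laplace T"
    unfolding laplace_def
  proof (rule integral_cong_AE)
    show "AE s in \<mu>. (\<integral>u. K u s \<partial>lborel) = exp (- (T * s))"
      using nonneg expo by (auto simp: has_bochner_integral_iff elim!: eventually_mono)
    show "(\<lambda>s. \<integral>u. K u s \<partial>lborel) \<in> borel_measurable \<mu>"
      unfolding K_def by measurable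
  qed measurable
  moreover have "(\<integral>s. K u s \<partial>\<mu>) = indicator {0<..} u *\<^sub>R (exp (- u) * measure \<mu> {..<u / T})" for u
  proof -
    have "{s. T * s < u} = {..<u / T}" using T by (auto simp: field_simps)
    then show ?thesis unfolding K_def by (simp add: space)
  qed
  ultimately show ?thesis by (simp add: set_lebesgue_integral_def)
qed

lemma measure_zero_AE: "measure \<mu> {0} = 0 \<Longrightarrow> AE s in \<mu>. 0 < s"
proof -
  assume "measure \<mu> {0} = 0"
  then have "emeasure \<mu> {0} = 0" by (simp add: emeasure_eq_measure)
  then have "AE s in \<mu>. s \<noteq> 0" by (intro AE_I[of _ _ "{0}"]) (auto simp: sets_eq)
  with nonneg show ?thesis by eventually_elim simp
qed

lemma integrable_inverse_tail: "x > 0 \<Longrightarrow> integrable \<mu> (\<lambda>s. (if x \<le> s then 1 / s else 0))"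
  by (rule integrable_const_bound[where B = "1 / x"]) (auto simp: indicator_def frac_le)

lemma inverse_tail_nonneg: "x > 0 \<Longrightarrow> inverse_tail x \<ge> 0"
  unfolding inverse_tail_def by (intro integral_nonneg_AE AE_I2) (auto simp: indicator_def)

lemma inverse_tail_antimono:
  assumes "0 < x" "x \<le> y" shows "inverse_tail y \<le> inverse_tail x"
  unfolding inverse_tail_def
  by (intro integral_mono integrable_inverse_tail) (use assms in \<open>auto simp: indicator_def\<close>)

lemma inverse_tail_le: "x > 0 \<Longrightarrow> inverse_tail x \<le> total_mass / x"
proof -
  assume x: "x > 0"
  have "inverse_tail x \<le> (\<integral>s. 1 / x \<partial>\<mu>)" unfolding inverse_tail_def
    by (intro integral_mono integrable_inverse_tail) (use x in \<open>auto simp: indicator_def frac_le\<close>)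
  then show ?thesis by simp
qed

lemma inverse_tail_measurable [measurable]: "inverse_tail \<in> borel_measurable borel"
  unfolding inverse_tail_def[abs_def] by (rule borel_measurable_lebesgue_integral) measurable

lemma exponential_layer_integral:
  assumes "T \<ge> 0" "s > 0"
  shows "has_bochner_integral lborel (\<lambda>x. indicator {0<..} x * exp (- (T * x)) * (if x \<le> s then 1 / s else 0)) (primitive_kernel s T / s)"
proof -
  have "has_bochner_integral lborel (\<lambda>x. indicator {0..s} x *\<^sub>R (exp (- (x * T)) / s)) (primitive_kernel s T / s - primitive_kernel 0 T / s)"
  proof (rule has_bochner_integral_FTC_Icc)
    show "((\<lambda>x. primitive_kernel x T / s) has_vector_derivative exp (- (x * T)) / s) (at x within {0..s})" for x
      using DERIV_cdivide[OF primitive_kernel_deriv]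
      by (simp add: has_real_derivative_iff_has_vector_derivative)
  qed (use assms in \<open>auto intro!: continuous_intros\<close>)
  moreover have "AE x in lborel. indicator {0..s} x *\<^sub>R (exp (- (x * T)) / s) = indicator {0<..} x * exp (- (T * x)) * (if x \<le> s then 1 / s else 0)"
    using AE_lborel_singleton[of "0::real"] by eventually_elim (auto simp: indicator_def mult.commute)
  moreover have "(\<lambda>x. indicator {0<..} x * exp (- (T * x)) * (if x \<le> s then 1 / s else 0)) \<in> borel_measurable lborel"
    by measurable
  ultimately show ?thesis by (subst (asm) has_bochner_integral_cong_AE) (auto simp: has_bochner_integral_iff dest: borel_measurable_integrable)
qed

text \<open>
  For fixed s > 0 the weights 1 / s on the layer 0 < x \<le> s integrate exp (- T x) to \<open>primitive_kernel s
  T / s\<close>, with the roles of the two arguments exchanged. The case T = 0 shows that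
  \<open>inverse_tail\<close> is integrable over the positive half-line.
\<close>

lemma inverse_tail_layers:
  assumes T: "T \<ge> 0" and zero: "measure \<mu> {0} = 0"
  shows "has_bochner_integral lborel (\<lambda>x. indicator {0<..} x * exp (- (T * x)) * inverse_tail x)
           (\<integral>s. primitive_kernel s T / s \<partial>\<mu>)"
proof -
  let ?I = "\<integral>s. primitive_kernel s T / s \<partial>\<mu>"
  let ?f = "\<lambda>x. indicator {0<..} x * exp (- (T * x)) * inverse_tail x"
  define K where "K x s = indicator {0<..} x * exp (- (T * x)) * (if x \<le> s then 1 / s else 0)" for x s :: real
  have K0: "K x s \<ge> 0" for x s by (auto simp: K_def indicator_def)
  have intK: "has_bochner_integral \<mu> (K x) (?f x)" for x
  proof (cases "x > 0")
    case True
    show ?thesis unfolding K_def[abs_def] inverse_tail_def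
      by (intro has_bochner_integral_mult_right has_bochner_integral_integrable integrable_inverse_tail True)
  qed (simp add: K_def[abs_def] has_bochner_integral_zero)
  have layer: "AE s in \<mu>. has_bochner_integral lborel (\<lambda>x. K x s) (primitive_kernel s T / s)"
    using measure_zero_AE[OF zero] unfolding K_def by eventually_elim (rule exponential_layer_integral[OF T])
  have [measurable]: "case_prod K \<in> borel_measurable (lborel \<Otimes>\<^sub>M \<mu>)"
    unfolding K_def[abs_def] by measurable
  have bound: "AE s in \<mu>. 0 \<le> primitive_kernel s T / s \<and> primitive_kernel s T / s \<le> 1"
    using measure_zero_AE[OF zero]
  proof eventually_elim
    case (elim s)
    then show ?case using primitive_kernel_bounds[of s T] T by simp
  qed
  have int: "integrable \<mu> (\<lambda>s. primitive_kernel s T / s)"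
  proof (rule integrable_const_bound[where B = 1])
    show "AE s in \<mu>. norm (primitive_kernel s T / s) \<le> 1"
      using bound by eventually_elim (unfold real_norm_def, linarith)
  qed measurable
  have "(\<integral>\<^sup>+x. ennreal (\<integral>s. K x s \<partial>\<mu>) \<partial>lborel) = (\<integral>\<^sup>+s. ennreal (\<integral>x. K x s \<partial>lborel) \<partial>\<mu>)"
  proof (rule nn_integral_integral_swap)
    show "AE x in lborel. integrable \<mu> (K x)" "AE s in \<mu>. integrable lborel (\<lambda>x. K x s)"
      using intK layer by (auto simp: has_bochner_integral_iff elim!: eventually_mono)
  qed (use K0 in \<open>unfold_locales, auto\<close>)
  also have "\<dots> = (\<integral>\<^sup>+s. ennreal (primitive_kernel s T / s) \<partial>\<mu>)"
  proof (rule nn_integral_cong_AE)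
    show "AE s in \<mu>. ennreal (\<integral>x. K x s \<partial>lborel) = ennreal (primitive_kernel s T / s)"
      using layer by eventually_elim (simp add: has_bochner_integral_iff)
  qed
  also have "\<dots> = ennreal ?I"
    using bound by (intro nn_integral_eq_integral int) (auto elim!: eventually_mono)
  finally have "(\<integral>\<^sup>+x. ennreal (?f x) \<partial>lborel) = ennreal ?I"
    using has_bochner_integral_integral_eq[OF intK] by simp
  moreover have "0 \<le> ?I"
    using bound by (intro integral_nonneg_AE) (auto elim!: eventually_mono)
  moreover have "0 \<le> ?f x" for x
    using inverse_tail_nonneg[of x] by (auto simp: indicator_def)
  ultimately show ?thesis by (intro has_bochner_integral_nn_integral) auto
qed

text \<open>
  The quotient (1 - exp (- T s)) / (s T) is symmetric in s and T.
\<close>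

lemma primitive_eq_inverse_tail_laplace:
  assumes T: "T > 0" and zero: "measure \<mu> {0} = 0"
  shows "has_bochner_integral lborel (\<lambda>x. indicator {0<..} x * exp (- (T * x)) * inverse_tail x) (primitive T / T)"
proof -
  have "(\<integral>s. primitive_kernel s T / s \<partial>\<mu>) = (\<integral>s. primitive_kernel T s / T \<partial>\<mu>)"
  proof (rule integral_cong_AE)
    show "AE s in \<mu>. primitive_kernel s T / s = primitive_kernel T s / T"
      using measure_zero_AE[OF zero] by eventually_elim (use T in \<open>simp add: primitive_kernel_def mult.commute\<close>)
  qed measurable
  then show ?thesis using inverse_tail_layers[of T] T zero by (simp add: primitive_def)
qed

end

section \<open>Regular variation at infinity\<close>

text \<open>
  For D \<noteq> 0 this says f t ~ D t^\<sigma> h(t); stated as a limit it is meaningful for D = 0 as well.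
\<close>

definition regular_limit :: "(real \<Rightarrow> real) \<Rightarrow> (real \<Rightarrow> real) \<Rightarrow> real \<Rightarrow> real \<Rightarrow> bool" where
  "regular_limit h f \<sigma> D \<longleftrightarrow> ((\<lambda>t. f t / (t powr \<sigma> * h t)) \<longlongrightarrow> D) at_top"

lemma regular_limit_cong:
  assumes "eventually (\<lambda>t. f t = g t) at_top"
  shows "regular_limit h f \<sigma> D \<longleftrightarrow> regular_limit h g \<sigma> D"
  unfolding regular_limit_def by (rule filterlim_cong) (use assms in \<open>auto elim: eventually_mono\<close>)

lemma regular_limit_times_power:
  "regular_limit h (\<lambda>t. t * f t) (\<sigma> + 1) D \<longleftrightarrow> regular_limit h f \<sigma> D"
  unfolding regular_limit_def
proof (rule filterlim_cong[OF refl refl])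
  show "eventually (\<lambda>t. t * f t / (t powr (\<sigma> + 1) * h t) = f t / (t powr \<sigma> * h t)) at_top"
    using eventually_gt_at_top[of 0] by eventually_elim (simp add: powr_add)
qed

context
  fixes h :: "real \<Rightarrow> real"
  assumes h: "slowly_varying h"
begin

lemma regular_limit_scale:
  assumes f: "regular_limit h f \<sigma> D" and l: "l > 0"
  shows "((\<lambda>T. f (l * T) / (T powr \<sigma> * h T)) \<longlongrightarrow> D * l powr \<sigma>) at_top"
proof -
  let ?r = "\<lambda>T. T powr \<sigma> * h T"
  have "filterlim (\<lambda>T. l * T) at_top at_top"
    using l by (intro filterlim_tendsto_pos_mult_at_top[OF tendsto_const]) (auto simp: filterlim_ident)
  then have "((\<lambda>T. f (l * T) / ?r (l * T) * l powr \<sigma> * (h (l * T) / h T)) \<longlongrightarrow> D * l powr \<sigma> * 1) at_top"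
    by (intro tendsto_mult tendsto_const filterlim_compose[OF f[unfolded regular_limit_def]] slowly_varying_scale[OF h l])
  moreover have "eventually (\<lambda>T. f (l * T) / ?r (l * T) * l powr \<sigma> * (h (l * T) / h T)
      = f (l * T) / ?r T) at_top"
    using eventually_gt_at_top[of 0]
  proof eventually_elim
    case (elim T)
    then have "h (l * T) > 0" using slowly_varying_pos[OF h] l by simp
    then show ?case using elim l by (simp add: powr_mult)
  qed
  ultimately show ?thesis by (auto intro: Lim_transform_eventually)
qed

text \<open>
  A monotone function lies between its values at the neighbouring integers, and h changes by a factor tending to 1
  between them.
\<close>

lemma regular_limit_sequence:
  assumes mono: "\<And>a b. 0 \<le> a \<Longrightarrow> a \<le> b \<Longrightarrow> F a \<le> F b"
  shows "regular_limit h F \<alpha> C \<longleftrightarrow> ((\<lambda>n. F (real n) / (real n powr \<alpha> * h (real n))) \<longlonglongrightarrow> C)"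
proof
  assume "regular_limit h F \<alpha> C"
  then show "(\<lambda>n. F (real n) / (real n powr \<alpha> * h (real n))) \<longlonglongrightarrow> C"
    unfolding regular_limit_def by (rule filterlim_compose) (rule filterlim_real_sequentially)
next
  assume L: "(\<lambda>n. F (real n) / (real n powr \<alpha> * h (real n))) \<longlonglongrightarrow> C"
  let ?r = "\<lambda>T. T powr \<alpha> * h T"
  let ?k = "\<lambda>T::real. nat \<lfloor>T\<rfloor>"
  have along: "((\<lambda>T. F (real (N T)) / ?r T) \<longlongrightarrow> C) at_top"
    if N: "filterlim N sequentially at_top" and ratio: "((\<lambda>T. real (N T) / T) \<longlongrightarrow> 1) at_top" for N
  proof -
    have "((\<lambda>T. (F (real (N T)) / ?r (real (N T))) * (real (N T) / T) powr \<alpha> * (h (T * (real (N T) / T)) / h T)) \<longlongrightarrow> C * 1 powr \<alpha> * 1) at_top"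
      by (intro tendsto_mult filterlim_compose[OF L N] slowly_varying_near_one[OF h] ratio tendsto_powr tendsto_const) simp
    moreover have "eventually (\<lambda>T. N T > 0) at_top"
      by (rule eventually_compose_filterlim[OF eventually_gt_at_top N])
    then have "eventually (\<lambda>T. (F (real (N T)) / ?r (real (N T))) * (real (N T) / T) powr \<alpha> * (h (T * (real (N T) / T)) / h T)
        = F (real (N T)) / ?r T) at_top"
      using eventually_gt_at_top[of 0]
    proof eventually_elim
      case (elim T)
      then have "h (real (N T)) > 0" using slowly_varying_pos[OF h] by simp
      then show ?case using elim by (simp add: powr_divide)
    qed
    ultimately show ?thesis by (auto intro: Lim_transform_eventually)
  qed
  have fl: "filterlim ?k sequentially at_top"
    by (rule filterlim_compose[OF filterlim_nat_sequentially filterlim_floor_sequentially])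
  have inv: "((\<lambda>T::real. 1 / T) \<longlongrightarrow> 0) at_top"
    using tendsto_inverse_0_at_top[OF filterlim_ident] by (simp add: inverse_eq_divide)
  have r1: "((\<lambda>T. real (?k T) / T) \<longlongrightarrow> 1) at_top"
  proof (rule tendsto_sandwich)
    show "((\<lambda>T::real. 1 - 1 / T) \<longlongrightarrow> 1) at_top" using tendsto_diff[OF tendsto_const[of 1] inv] by simp
    show "eventually (\<lambda>T. 1 - 1 / T \<le> real (?k T) / T) at_top"
      using eventually_gt_at_top[of 0]
    proof eventually_elim
      case (elim T)
      then have "T - 1 \<le> real (?k T)" by linarith
      then have "(T - 1) / T \<le> real (?k T) / T" using elim by (intro divide_right_mono) auto
      then show ?case using elim by (simp add: diff_divide_distrib)
    qed
    show "eventually (\<lambda>T. real (?k T) / T \<le> 1) at_top"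
      using eventually_gt_at_top[of 0] by eventually_elim (simp add: divide_le_eq_1)
  qed simp
  have r2: "((\<lambda>T. real (Suc (?k T)) / T) \<longlongrightarrow> 1) at_top"
    using tendsto_add[OF r1 inv] by (simp add: add_divide_distrib add.commute)
  have fl2: "filterlim (\<lambda>T::real. Suc (?k T)) sequentially at_top"
    by (rule filterlim_compose[OF filterlim_Suc fl])
  show "regular_limit h F \<alpha> C" unfolding regular_limit_def
  proof (rule tendsto_sandwich[OF _ _ along[OF fl r1] along[OF fl2 r2]])
    have den: "?r T > 0" if "T > 0" for T using that slowly_varying_pos[OF h] by simp
    show "eventually (\<lambda>T. F (real (?k T)) / ?r T \<le> F T / ?r T) at_top"
      using eventually_gt_at_top[of 0]
    proof eventually_elim
      case (elim T)
      then show ?case using den[OF elim] by (intro divide_right_mono mono) auto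
    qed
    show "eventually (\<lambda>T. F T / ?r T \<le> F (real (Suc (?k T))) / ?r T) at_top"
      using eventually_gt_at_top[of 0]
    proof eventually_elim
      case (elim T)
      have "T \<le> real (Suc (?k T))" using elim by linarith
      then show ?case using den[OF elim] elim by (intro divide_right_mono mono) auto
    qed
  qed
qed

end

section \<open>Tauberian equivalences for the spectral measure\<close>

text \<open>
  Integration raises the index by one and divides the constant by the new index; monotonicity of the integrand, in
  either direction, makes this reversible.
\<close>

lemma regular_limit_primitive_iff:
  assumes h: "slowly_varying h" and f: "f \<in> borel_measurable borel" and \<beta>: "\<beta> > 0"
    and bdd: "\<And>t t0. 0 < t \<Longrightarrow> t \<le> t0 \<Longrightarrow> \<bar>f t\<bar> \<le> B t0"
    and G: "\<And>T. T > 0 \<Longrightarrow> G T = T * (LINT v:{0..1}|lborel. f (T * v))"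
    and increments: "(\<forall>a b. 0 < a \<longrightarrow> a < b \<longrightarrow> (b - a) * f a \<le> G b - G a \<and> G b - G a \<le> (b - a) * f b) \<or>
      (\<forall>a b. 0 < a \<longrightarrow> a < b \<longrightarrow> (b - a) * f b \<le> G b - G a \<and> G b - G a \<le> (b - a) * f a)"
  shows "regular_limit h G \<beta> C \<longleftrightarrow> regular_limit h f (\<beta> - 1) (C * \<beta>)"
proof
  assume L: "regular_limit h f (\<beta> - 1) (C * \<beta>)"
  have "regular_limit h (\<lambda>T. LINT v:{0..1}|lborel. f (T * v)) (\<beta> - 1) (C * \<beta> / (\<beta> - 1 + 1))"
    unfolding regular_limit_def
    using \<beta> bdd by (intro abelian_unit_interval[OF h f _ L[unfolded regular_limit_def]]) auto
  then have "regular_limit h (\<lambda>T. T * (LINT v:{0..1}|lborel. f (T * v))) \<beta> C"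
    using \<beta> regular_limit_times_power[of h _ "\<beta> - 1"] by simp
  moreover have "eventually (\<lambda>T. G T = T * (LINT v:{0..1}|lborel. f (T * v))) at_top"
    using eventually_gt_at_top[of 0] by eventually_elim (rule G)
  ultimately show "regular_limit h G \<beta> C" by (simp only: regular_limit_cong)
next
  assume L: "regular_limit h G \<beta> C"
  have pos: "eventually (\<lambda>T. T > 0 \<and> T powr \<beta> * h T > 0) at_top"
    using eventually_gt_at_top[of 0] by eventually_elim (simp add: slowly_varying_pos[OF h])
  note scaled = regular_limit_scale[OF h L]
  have "((\<lambda>T. T * f T / (T powr \<beta> * h T)) \<longlongrightarrow> C * \<beta>) at_top"
    using increments by (elim disjE)
      (intro monotone_density[OF pos scaled] antimonotone_density[OF pos scaled]; simp)+
  then show "regular_limit h f (\<beta> - 1) (C * \<beta>)"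
    using regular_limit_times_power[of h f "\<beta> - 1" "C * \<beta>"] by (simp add: regular_limit_def)
qed

context shifted_spectral_measure
begin

lemma regular_second_primitive_iff:
  assumes h: "slowly_varying h" and \<beta>: "\<beta> > 0"
  shows "regular_limit h second_primitive \<beta> C \<longleftrightarrow> regular_limit h primitive (\<beta> - 1) (C * \<beta>)"
proof (rule regular_limit_primitive_iff[OF h primitive_measurable \<beta> _ second_primitive_eq_unit_integral])
  show "\<bar>primitive t\<bar> \<le> t0 * total_mass" if "0 < t" "t \<le> t0" for t t0
    using primitive_bounds[of t] that mult_right_mono[of t t0 "total_mass"] by auto
qed (use second_primitive_increment in auto)

lemma regular_primitive_iff:
  assumes h: "slowly_varying h" and \<beta>: "\<beta> > 0"
  shows "regular_limit h primitive \<beta> C \<longleftrightarrow> regular_limit h laplace (\<beta> - 1) (C * \<beta>)"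
proof (rule regular_limit_primitive_iff[OF h laplace_measurable \<beta> _ primitive_eq_unit_integral])
  show "\<bar>laplace t\<bar> \<le> total_mass" if "0 < t" for t
    using laplace_bounds[of t] that by auto
qed (use primitive_increment in auto)

lemma space_UNIV: "space \<mu> = UNIV"
  using sets_eq_imp_space_eq[OF sets_eq] by simp

text \<open>
  Karamata's Tauberian theorem in one direction, the Abelian lemma for the distribution function in the other.
\<close>

lemma regular_laplace_iff:
  assumes h: "slowly_varying h" and \<sigma>: "\<sigma> \<le> 0" and C: "C \<ge> 0"
  shows "regular_limit h laplace \<sigma> C \<longleftrightarrow> regular_limit h (\<lambda>t. measure \<mu> {..<1 / t}) \<sigma> (C / Gamma (1 - \<sigma>))"
proof
  assume L: "regular_limit h laplace \<sigma> C"
  have "((\<lambda>T. measure \<mu> {..<1 / T} / (T powr \<sigma> * h T)) \<longlongrightarrow> C / Gamma (1 + (- \<sigma>))) at_top"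
  proof (rule Karamata_Tauberian[OF finite_measure_axioms sets_eq nonneg _ C])
    show "eventually (\<lambda>T. T powr \<sigma> * h T > 0) at_top"
      using eventually_gt_at_top[of 0] by eventually_elim (simp add: slowly_varying_pos[OF h])
    show "((\<lambda>T. (\<integral>s. exp (- (k * T * s)) \<partial>\<mu>) / (T powr \<sigma> * h T)) \<longlongrightarrow> C * k powr (- (- \<sigma>))) at_top" if "k > 0" for k
      using regular_limit_scale[OF h L that] by (simp add: laplace_def)
  qed (use \<sigma> in simp)
  then show "regular_limit h (\<lambda>t. measure \<mu> {..<1 / t}) \<sigma> (C / Gamma (1 - \<sigma>))"
    by (simp add: regular_limit_def)
next
  assume U: "regular_limit h (\<lambda>t. measure \<mu> {..<1 / t}) \<sigma> (C / Gamma (1 - \<sigma>))"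
  have [measurable]: "(\<lambda>x. measure \<mu> {..<x}) \<in> borel_measurable borel"
    by (rule borel_measurable_mono) (auto simp: mono_def sets_eq intro!: finite_measure_mono)
  have "((\<lambda>T. (LINT u:{0<..}|lborel. exp (- u) * measure \<mu> {..<u / T}) / (T powr \<sigma> * h T)) \<longlongrightarrow> C / Gamma (1 - \<sigma>) * Gamma (1 - \<sigma>)) at_top"
  proof (rule abelian_laplace[OF h _ _ U[unfolded regular_limit_def]])
    show "\<exists>B. \<forall>t. 0 < t \<and> t \<le> t0 \<longrightarrow> \<bar>measure \<mu> {..<1 / t}\<bar> \<le> B" for t0
      using bounded_measure by auto
  qed (use \<sigma> in auto)
  moreover have "Gamma (1 - \<sigma>) > 0" using \<sigma> by (intro Gamma_real_pos) simp
  moreover have "eventually (\<lambda>T. (LINT u:{0<..}|lborel. exp (- u) * measure \<mu> {..<u / T}) / (T powr \<sigma> * h T) = laplace T / (T powr \<sigma> * h T)) at_top"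
    using eventually_gt_at_top[of 0] by eventually_elim (simp add: laplace_eq_distribution_integral)
  ultimately show "regular_limit h laplace \<sigma> C"
    unfolding regular_limit_def by (auto intro: Lim_transform_eventually)
qed

lemma regular_inverse_tail_imp_primitive:
  assumes h: "slowly_varying h" and \<sigma>: "\<sigma> < 1" and zero: "measure \<mu> {0} = 0"
    and V: "regular_limit h (\<lambda>t. inverse_tail (1 / t)) \<sigma> D"
  shows "regular_limit h primitive \<sigma> (D * Gamma (1 - \<sigma>))"
proof -
  let ?J = "\<lambda>T. LINT u:{0<..}|lborel. exp (- u) * inverse_tail (u / T)"
  have "((\<lambda>T. ?J T / (T powr \<sigma> * h T)) \<longlongrightarrow> D * Gamma (1 - \<sigma>)) at_top"
  proof (rule abelian_laplace[OF h _ \<sigma> V[unfolded regular_limit_def]])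
    fix t0
    have "\<bar>inverse_tail (1 / t)\<bar> \<le> inverse_tail (1 / t0)" if "0 < t" "t \<le> t0" for t
      using that inverse_tail_nonneg[of "1 / t"] inverse_tail_antimono[of "1 / t0" "1 / t"] by (simp add: frac_le)
    then show "\<exists>B. \<forall>t. 0 < t \<and> t \<le> t0 \<longrightarrow> \<bar>inverse_tail (1 / t)\<bar> \<le> B" by blast
  qed measurable
  moreover have "?J T = primitive T" if T: "T > 0" for T
  proof -
    have "?J T
        = \<bar>T\<bar> *\<^sub>R (\<integral>x. indicator {0<..} (0 + T * x) *\<^sub>R (exp (- (0 + T * x)) * inverse_tail ((0 + T * x) / T)) \<partial>lborel)"
      unfolding set_lebesgue_integral_def using T by (intro lborel_integral_real_affine) simp
    also have "\<dots> = T * (\<integral>x. indicator {0<..} x * exp (- (T * x)) * inverse_tail x \<partial>lborel)"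
      using T by (simp add: indicator_def zero_less_mult_iff mult.assoc)
    also have "\<dots> = primitive T"
      using primitive_eq_inverse_tail_laplace[OF T zero] T by (simp add: has_bochner_integral_iff)
    finally show ?thesis .
  qed
  then have "eventually (\<lambda>T. ?J T / (T powr \<sigma> * h T) = primitive T / (T powr \<sigma> * h T)) at_top"
    by (intro eventually_mono[OF eventually_gt_at_top[of 0]]) simp
  ultimately show ?thesis unfolding regular_limit_def by (rule Lim_transform_eventually)
qed

text \<open>
  The measure with density \<open>inverse_tail\<close> has Laplace transform P T / T, with P the primitive.
  Karamata's theorem gives its distribution function U near 0; since the density is decreasing, it is recovered
  from U by \<open>antimonotone_density\<close> at the filter \<open>at_right 0\<close>.
\<close>

lemma regular_primitive_imp_inverse_tail:
  assumes h: "slowly_varying h" and \<sigma>: "\<sigma> < 1" and zero: "measure \<mu> {0} = 0" and C: "C \<ge> 0"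
    and L: "regular_limit h primitive \<sigma> C"
  shows "regular_limit h (\<lambda>t. inverse_tail (1 / t)) \<sigma> (C * (1 - \<sigma>) / Gamma (2 - \<sigma>))"
proof -
  let ?q = "\<lambda>x. x powr (1 - \<sigma>) * h (1 / x)"
  let ?r = "\<lambda>T. T powr (\<sigma> - 1) * h T"
  define w where "w x = indicator {0<..} x * inverse_tail x" for x
  have [measurable]: "w \<in> borel_measurable borel" unfolding w_def[abs_def] by measurable
  have w0: "w x \<ge> 0" for x using inverse_tail_nonneg[of x] by (auto simp: w_def indicator_def)
  define N where "N = density lborel (\<lambda>x. ennreal (w x))"
  have sets_N: "sets N = sets borel" by (simp add: N_def)
  have space_N: "space N = UNIV" by (simp add: N_def)
  have wint: "integrable lborel w"
    using inverse_tail_layers[of 0] zero by (simp add: w_def[abs_def] has_bochner_integral_iff)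
  have fin: "finite_measure N"
  proof
    have "emeasure N (space N) = (\<integral>\<^sup>+x. ennreal (w x) \<partial>lborel)"
      by (simp add: N_def emeasure_density)
    also have "\<dots> < \<infinity>" using wint w0 by (simp add: integrable_iff_bounded)
    finally show "emeasure N (space N) \<noteq> \<infinity>" by simp
  qed
  interpret N: finite_measure N by (rule fin)
  define U where "U x = measure N {..<x}" for x
  have "((\<lambda>T. measure N {..<1 / T} / ?r T) \<longlongrightarrow> C / Gamma (1 + (1 - \<sigma>))) at_top"
  proof (rule Karamata_Tauberian[OF fin sets_N _ _ C])
    show "AE x in N. 0 \<le> x" unfolding N_def by (auto simp: AE_density w_def indicator_def)
    show "eventually (\<lambda>T. ?r T > 0) at_top"
      using eventually_gt_at_top[of 0] by eventually_elim (simp add: slowly_varying_pos[OF h])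
    fix k :: real assume k: "k > 0"
    have lap: "(\<integral>x. exp (- (T * x)) \<partial>N) = primitive T / T" if "T > 0" for T
    proof -
      have "(\<integral>x. exp (- (T * x)) \<partial>N) = (\<integral>x. w x *\<^sub>R exp (- (T * x)) \<partial>lborel)"
        unfolding N_def using w0 by (intro integral_density) auto
      also have "\<dots> = primitive T / T"
        using primitive_eq_inverse_tail_laplace[OF that zero] by (simp add: w_def has_bochner_integral_iff mult_ac)
      finally show ?thesis .
    qed
    have 1: "((\<lambda>T. primitive (k * T) / (T powr \<sigma> * h T) * (1 / k)) \<longlongrightarrow> C * k powr \<sigma> * (1 / k)) at_top"
      by (intro tendsto_mult tendsto_const regular_limit_scale[OF h L k])
    have 2: "eventually (\<lambda>T. primitive (k * T) / (T powr \<sigma> * h T) * (1 / k) = (\<integral>s. exp (- (k * T * s)) \<partial>N) / ?r T) at_top"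
      using eventually_gt_at_top[of 0]
    proof eventually_elim
      case (elim T)
      have "(\<integral>s. exp (- (k * T * s)) \<partial>N) = primitive (k * T) / (k * T)" using elim k by (intro lap) simp
      then show ?case using elim k by (simp add: powr_diff)
    qed
    have 3: "C * k powr \<sigma> * (1 / k) = C * k powr (- (1 - \<sigma>))" using k by (simp add: powr_diff)
    show "((\<lambda>T. (\<integral>s. exp (- (k * T * s)) \<partial>N) / ?r T) \<longlongrightarrow> C * k powr (- (1 - \<sigma>))) at_top"
      using Lim_transform_eventually[OF 1 2] unfolding 3 .
  qed (use \<sigma> in simp)
  then have RU: "regular_limit h (\<lambda>t. U (1 / t)) (\<sigma> - 1) (C / Gamma (2 - \<sigma>))"
    by (simp add: regular_limit_def U_def)
  have U_incr: "(b - a) * inverse_tail b \<le> U b - U a \<and> U b - U a \<le> (b - a) * inverse_tail a" if ab: "0 < a" "a < b" for a b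
  proof -
    have "U b - U a = measure N {a..<b}"
      unfolding U_def using ab by (subst N.finite_measure_Diff[symmetric]) (auto simp: sets_N intro!: arg_cong[where f = "measure N"])
    also have "\<dots> = (\<integral>x. indicator {a..<b} x \<partial>N)" by (simp add: space_N)
    also have "\<dots> = (\<integral>x. w x *\<^sub>R indicator {a..<b} x \<partial>lborel)"
      unfolding N_def using w0 by (intro integral_density) auto
    finally have eq: "U b - U a = (\<integral>x. w x * indicator {a..<b} x \<partial>lborel)" by simp
    have i: "integrable lborel (\<lambda>x. w x * indicator {a..<b} x)"
      using integrable_real_mult_indicator[OF _ wint, of "{a..<b}"] by simp
    have c: "integrable lborel (\<lambda>x. c * indicator {a..<b} x)" "(\<integral>x. c * indicator {a..<b} x \<partial>lborel) = (b - a) * c" for c :: real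
      using ab by (auto simp: mult.commute)
    show ?thesis unfolding eq c(2)[symmetric]
      using ab by (intro conjI integral_mono i c(1)) (auto simp: w_def indicator_def inverse_tail_antimono)
  qed
  have "((\<lambda>x. x * inverse_tail x / ?q x) \<longlongrightarrow> C / Gamma (2 - \<sigma>) * (1 - \<sigma>)) (at_right 0)"
  proof (rule antimonotone_density[where G = U])
    show "eventually (\<lambda>x. 0 < x \<and> 0 < ?q x) (at_right 0)"
      using eventually_at_right_less[of 0] by eventually_elim (simp add: slowly_varying_pos[OF h])
    fix l :: real assume l: "l > 0"
    have "((\<lambda>T. U (1 / (1 / l * T)) / ?r T) \<longlongrightarrow> C / Gamma (2 - \<sigma>) * (1 / l) powr (\<sigma> - 1)) at_top"
      using regular_limit_scale[OF h RU, of "1 / l"] l by simp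
    moreover have "(1 / l) powr (\<sigma> - 1) = l powr (1 - \<sigma>)"
      using l by (simp add: powr_divide powr_diff field_simps)
    moreover have "eventually (\<lambda>T. U (1 / (1 / l * T)) / ?r T = U (l * inverse T) / ?q (inverse T)) at_top"
      using eventually_gt_at_top[of 0]
      by eventually_elim (use l in \<open>simp add: powr_diff inverse_eq_divide powr_divide field_simps\<close>)
    ultimately show "((\<lambda>x. U (l * x) / ?q x) \<longlongrightarrow> C / Gamma (2 - \<sigma>) * l powr (1 - \<sigma>)) (at_right 0)"
      unfolding filterlim_at_right_to_top by (simp add: filterlim_cong)
  qed (use U_incr in auto)
  then have "((\<lambda>T. inverse T * inverse_tail (inverse T) / ?q (inverse T)) \<longlongrightarrow> C / Gamma (2 - \<sigma>) * (1 - \<sigma>)) at_top"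
    unfolding filterlim_at_right_to_top .
  moreover have "eventually (\<lambda>T. inverse T * inverse_tail (inverse T) / ?q (inverse T) = inverse_tail (1 / T) / (T powr \<sigma> * h T)) at_top"
    using eventually_gt_at_top[of 0]
    by eventually_elim (simp add: powr_diff inverse_eq_divide powr_divide field_simps)
  ultimately show ?thesis unfolding regular_limit_def by (auto intro: Lim_transform_eventually simp: mult.commute)
qed

end

section \<open>The variance of partial sums as a spectral integral\<close>

text \<open>
  The variance of a sum of n variables with variance 1 and correlations t ^ |i - j|.
\<close>

definition lag_kernel :: "nat \<Rightarrow> real \<Rightarrow> real" where
  "lag_kernel n t = (\<Sum>i=1..n. \<Sum>j=1..n. t ^ nat \<bar>int i - int j\<bar>)"

lemma geometric_reversed: "(1 - t) * (\<Sum>i=1..n. t ^ (Suc n - i)) = t * (1 - t ^ n)" for t :: real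
proof (induction n)
  case (Suc n)
  have "(\<Sum>i=1..Suc n. t ^ (Suc (Suc n) - i)) = t * (\<Sum>i=1..n. t ^ (Suc n - i)) + t"
    by (simp add: Suc_diff_le sum_distrib_left)
  then have "(1 - t) * (\<Sum>i=1..Suc n. t ^ (Suc (Suc n) - i)) = t * ((1 - t) * (\<Sum>i=1..n. t ^ (Suc n - i))) + t * (1 - t)"
    by (simp only: distrib_left mult.left_commute mult.commute[of "1 - t" t])
  also have "\<dots> = t * (1 - t ^ Suc n)" by (simp only: Suc.IH) (simp add: algebra_simps)
  finally show ?case .
qed simp

lemma lag_kernel_Suc: "lag_kernel (Suc n) t = lag_kernel n t + 1 + 2 * (\<Sum>i=1..n. t ^ (Suc n - i))"
proof -
  have "nat \<bar>int i - int (Suc n)\<bar> = Suc n - i" "nat \<bar>int (Suc n) - int i\<bar> = Suc n - i" if "i \<in> {1..n}" for i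
    using that by auto
  then have "(\<Sum>i=1..n. t ^ nat \<bar>int i - int (Suc n)\<bar>) = (\<Sum>i=1..n. t ^ (Suc n - i))"
    "(\<Sum>i=1..n. t ^ nat \<bar>int (Suc n) - int i\<bar>) = (\<Sum>i=1..n. t ^ (Suc n - i))"
    by (auto intro: sum.cong)
  then show ?thesis by (simp add: lag_kernel_def sum.distrib)
qed

lemma lag_kernel_closed: "(1 - t)\<^sup>2 * lag_kernel n t = real n * (1 - t\<^sup>2) - 2 * t * (1 - t ^ n)"
proof (induction n)
  case (Suc n)
  have "(1 - t)\<^sup>2 * lag_kernel (Suc n) t
      = (1 - t)\<^sup>2 * lag_kernel n t + (1 - t)\<^sup>2 + 2 * (1 - t) * ((1 - t) * (\<Sum>i=1..n. t ^ (Suc n - i)))"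
    by (simp add: lag_kernel_Suc power2_eq_square algebra_simps)
  also have "\<dots> = real n * (1 - t\<^sup>2) - 2 * t * (1 - t ^ n) + (1 - t)\<^sup>2 + 2 * (1 - t) * (t * (1 - t ^ n))"
    by (simp only: Suc.IH geometric_reversed)
  also have "\<dots> = real (Suc n) * (1 - t\<^sup>2) - 2 * t * (1 - t ^ Suc n)"
    by (simp add: power2_eq_square algebra_simps)
  finally show ?case .
qed (simp add: lag_kernel_def)

text \<open>
  With s = 1 - t, the difference of the two kernels is - n + 2 (1 - t^n) / s + 2 (t^n - exp (- n s)) / s^2. For s
  \<le> 1 the second term is at most 2 n by Bernoulli's inequality, and the third because t and exp (- s) differ
  by at most s^2, so that their n-th powers differ by at most n s^2. For s \<ge> 1 both terms are bounded.
\<close>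

lemma lag_kernel_approximation:
  assumes t: "-1 \<le> t" "t \<le> 1"
  shows "\<bar>lag_kernel n t - 2 * second_primitive_kernel (real n) (1 - t)\<bar> \<le> 9 * real n"
proof (cases "t = 1 \<or> n = 0")
  case True
  then show ?thesis
    by (auto simp: lag_kernel_def second_primitive_kernel_def power2_eq_square)
next
  case False
  define s where "s = 1 - t"
  have s: "s > 0" "s \<le> 2" "t = 1 - s" "s \<noteq> 0" and n: "real n \<ge> 1" using t False by (auto simp: s_def)
  define E where "E = exp (- (real n * s))"
  have E: "0 \<le> E" "E \<le> 1" "E = exp (- s) ^ n" using s by (auto simp: E_def exp_of_nat_mult[symmetric])
  have tn: "\<bar>t ^ n\<bar> \<le> 1" using t by (auto simp: power_abs intro: power_le_one)
  have "lag_kernel n t = (real n * (1 - t\<^sup>2) - 2 * t * (1 - t ^ n)) / s\<^sup>2"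
    using lag_kernel_closed[of t n] s(4) unfolding s_def[symmetric] by (metis nonzero_mult_div_cancel_left power_not_zero)
  then have "lag_kernel n t - 2 * second_primitive_kernel (real n) s
      = (real n * (1 - t\<^sup>2) - 2 * t * (1 - t ^ n) - 2 * (E - 1 + real n * s)) / s\<^sup>2"
    using s(4) by (simp add: second_primitive_kernel_def E_def diff_divide_distrib)
  also have "real n * (1 - t\<^sup>2) - 2 * t * (1 - t ^ n) - 2 * (E - 1 + real n * s)
      = (- real n * s + 2 * (1 - t ^ n)) * s + 2 * (t ^ n - E)"
    by (simp add: s(3) power2_eq_square algebra_simps)
  also have "((- real n * s + 2 * (1 - t ^ n)) * s + 2 * (t ^ n - E)) / s\<^sup>2 = - real n + 2 * ((1 - t ^ n) / s) + 2 * ((t ^ n - E) / s\<^sup>2)"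
    using s(4) by (simp add: power2_eq_square add_divide_distrib diff_divide_distrib)
  finally have eq: "lag_kernel n t - 2 * second_primitive_kernel (real n) s = \<dots>" .
  have "\<bar>(1 - t ^ n) / s\<bar> \<le> 2 * real n \<and> \<bar>(t ^ n - E) / s\<^sup>2\<bar> \<le> 2 * real n"
  proof (cases "s \<le> 1")
    case True
    have "1 + real n * (- s) \<le> (1 + (- s)) ^ n" using True by (intro Bernoulli_inequality) simp
    then have "0 \<le> 1 - t ^ n" "1 - t ^ n \<le> real n * s" using tn by (auto simp: s(3))
    then have "\<bar>(1 - t ^ n) / s\<bar> \<le> real n" using s(1) by (simp add: abs_divide pos_divide_le_eq)
    moreover have "\<bar>(t ^ n - E) / s\<^sup>2\<bar> \<le> real n"
    proof -
      have e1: "1 - s \<le> exp (- s)" using exp_ge_add_one_self[of "- s"] by simp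
      have "exp (- s) \<le> 1 / (1 + s)"
        using exp_ge_add_one_self[of s] s(1) by (simp add: exp_minus divide_simps)
      also have "1 \<le> (1 + s) * (1 - s + s\<^sup>2)" using s(1) by (simp add: power2_eq_square algebra_simps)
      then have "1 / (1 + s) \<le> 1 - s + s\<^sup>2" using s(1) by (simp add: pos_divide_le_eq mult.commute)
      finally have "\<bar>t - exp (- s)\<bar> \<le> s\<^sup>2" using e1 by (simp add: s(3))
      moreover have "norm (t ^ n - exp (- s) ^ n) \<le> real n * norm (t - exp (- s))"
        using True s(1,2) t by (intro norm_power_diff) auto
      ultimately have "\<bar>t ^ n - E\<bar> \<le> real n * s\<^sup>2"
        unfolding E(3) real_norm_def using mult_left_mono[of "\<bar>t - exp (- s)\<bar>" "s\<^sup>2" "real n"] by linarith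
      then show ?thesis using s(1) by (simp add: abs_divide pos_divide_le_eq)
    qed
    ultimately show ?thesis by simp
  next
    case False
    then have "1 \<le> s\<^sup>2" by (simp add: one_le_power)
    have shrink: "\<bar>x / y\<bar> \<le> \<bar>x\<bar>" if "y \<ge> 1" for x y :: real
      using that mult_left_mono[of 1 y "\<bar>x\<bar>"] by (simp add: abs_divide divide_le_eq)
    have "\<bar>(1 - t ^ n) / s\<bar> \<le> \<bar>1 - t ^ n\<bar>" "\<bar>(t ^ n - E) / s\<^sup>2\<bar> \<le> \<bar>t ^ n - E\<bar>"
      using False \<open>1 \<le> s\<^sup>2\<close> by (intro shrink; simp)+
    moreover have "\<bar>1 - t ^ n\<bar> \<le> 2" "\<bar>t ^ n - E\<bar> \<le> 2" using tn E(1,2) by auto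
    ultimately show ?thesis using n by linarith
  qed
  then show ?thesis unfolding s_def[symmetric] eq by linarith
qed

lemma spectral_measure_support:
  assumes "transition_spectral_measure \<pi> Q g \<nu>" shows "AE t in \<nu>. -1 \<le> t \<and> t \<le> 1"
  using assms by (intro AE_I[of _ _ "- {-1..1}"]) (auto simp: transition_spectral_measure_def)

lemma spectral_measure_powers_integrable:
  assumes \<nu>: "transition_spectral_measure \<pi> Q g \<nu>" shows "integrable \<nu> (\<lambda>t. t ^ k)"
proof -
  interpret finite_measure \<nu> using \<nu> by (simp add: transition_spectral_measure_def)
  have "sets \<nu> = sets borel" using \<nu> by (simp add: transition_spectral_measure_def)
  then have "(\<lambda>t. t ^ k) \<in> borel_measurable \<nu>" by (simp cong: measurable_cong_sets)
  moreover have "AE t in \<nu>. norm (t ^ k) \<le> 1"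
    using spectral_measure_support[OF \<nu>] by eventually_elim (simp add: power_abs power_le_one abs_le_iff)
  ultimately show ?thesis by (intro integrable_const_bound[where B = 1])
qed

context stationary_markov_chain
begin

lemma sets_marginal: "sets \<pi> = sets S" and space_marginal: "space \<pi> = space S"
  by (auto simp: marginal)

lemma borel_measurable_marginal: "f \<in> borel_measurable \<pi> \<longleftrightarrow> f \<in> borel_measurable S"
  by (rule arg_cong[where f = "\<lambda>X. f \<in> X"], rule measurable_cong_sets) (auto simp: sets_marginal)

lemma path_measurable: "(\<lambda>\<omega> i. \<xi> (i + k) \<omega>) \<in> measurable M (\<Pi>\<^sub>M i\<in>UNIV. S)"
  by (rule measurable_PiM_single') (use chain_measurable measurable_space[OF chain_measurable] in auto)

lemma integral_shift:
  fixes F :: "(int \<Rightarrow> 's) \<Rightarrow> real"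
  assumes F: "F \<in> borel_measurable (\<Pi>\<^sub>M i\<in>UNIV. S)"
  shows "(\<integral>\<omega>. F (\<lambda>i. \<xi> (i + k) \<omega>) \<partial>M) = (\<integral>\<omega>. F (\<lambda>i. \<xi> i \<omega>) \<partial>M)"
proof -
  have "(\<integral>x. F x \<partial>distr M (\<Pi>\<^sub>M i\<in>UNIV. S) (\<lambda>\<omega> i. \<xi> (i + k) \<omega>)) = (\<integral>x. F x \<partial>distr M (\<Pi>\<^sub>M i\<in>UNIV. S) (\<lambda>\<omega> i. \<xi> i \<omega>))"
    by (simp only: stationary)
  then show ?thesis
    using integral_distr[OF path_measurable F, of k] integral_distr[OF path_measurable F, of 0] by simp
qed

lemma distr_chain: "distr M S (\<xi> k) = \<pi>"
proof -
  have p: "(\<lambda>x. x 0) \<in> measurable (\<Pi>\<^sub>M i\<in>(UNIV :: int set). S) S" by measurable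
  have "distr (distr M (\<Pi>\<^sub>M i\<in>UNIV. S) (\<lambda>\<omega> i. \<xi> (i + k) \<omega>)) S (\<lambda>x. x 0) = distr (distr M (\<Pi>\<^sub>M i\<in>UNIV. S) (\<lambda>\<omega> i. \<xi> i \<omega>)) S (\<lambda>x. x 0)"
    by (simp only: stationary)
  then show ?thesis
    using distr_distr[OF p path_measurable[of k]] distr_distr[OF p path_measurable[of 0]]
    by (simp add: o_def marginal)
qed

lemma nn_integral_chain: "f \<in> borel_measurable S \<Longrightarrow> (\<integral>\<^sup>+\<omega>. f (\<xi> k \<omega>) \<partial>M) = (\<integral>\<^sup>+x. f x \<partial>\<pi>)"
  unfolding distr_chain[of k, symmetric] by (rule nn_integral_distr[symmetric, OF chain_measurable]) simp

lemma integral_chain: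
  fixes f :: "'s \<Rightarrow> real" shows "f \<in> borel_measurable S \<Longrightarrow> (\<integral>\<omega>. f (\<xi> k \<omega>) \<partial>M) = (\<integral>x. f x \<partial>\<pi>)"
  unfolding distr_chain[of k, symmetric] by (rule integral_distr[symmetric, OF chain_measurable])

lemma integrable_chain:
  fixes f :: "'s \<Rightarrow> real" shows "f \<in> borel_measurable S \<Longrightarrow> integrable M (\<lambda>\<omega>. f (\<xi> k \<omega>)) \<longleftrightarrow> integrable \<pi> f"
  unfolding distr_chain[of k, symmetric] by (rule integrable_distr_eq[symmetric, OF chain_measurable])

lemma AE_chain: "(AE x in \<pi>. P x) \<Longrightarrow> (AE \<omega> in M. P (\<xi> k \<omega>))"
  unfolding distr_chain[of k, symmetric] by (rule AE_distrD[OF chain_measurable])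

lemma kernel_subprob: "Q \<in> measurable S (subprob_algebra S)"
  using kernel by (rule measurable_prob_algebraD)

lemma kernel_prob: "x \<in> space S \<Longrightarrow> prob_space (Q x)" "x \<in> space S \<Longrightarrow> sets (Q x) = sets S"
  using measurable_space[OF kernel] by (auto simp: space_prob_algebra)

lemma kernel_nn_integral_measurable:
  "f \<in> borel_measurable S \<Longrightarrow> (\<lambda>x. \<integral>\<^sup>+s. f s \<partial>Q x) \<in> borel_measurable S"
  by (rule measurable_compose[OF kernel_subprob nn_integral_measurable_subprob_algebra])

lemma past_subalgebra: "subalgebra M (past_algebra M S \<xi> k)"
proof -
  have "(\<Union>j\<in>{..k}. {\<xi> j -` A \<inter> space M | A. A \<in> sets S}) \<subseteq> sets M"
    using measurable_sets[OF chain_measurable] by auto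
  then show ?thesis unfolding subalgebra_def past_algebra_def
    by (auto simp: space_measure_of_conv sets_measure_of_conv intro: sets.sigma_sets_subset[THEN subsetD])
qed

lemma past_measurable:
  assumes "j \<le> k" shows "\<xi> j \<in> measurable (past_algebra M S \<xi> k) S"
proof (rule measurableI)
  have sp: "space (past_algebra M S \<xi> k) = space M" using past_subalgebra by (auto simp: subalgebra_def)
  show "\<xi> j x \<in> space S" if "x \<in> space (past_algebra M S \<xi> k)" for x
    using that measurable_space[OF chain_measurable] by (simp add: sp)
  fix A assume A: "A \<in> sets S"
  have "\<xi> j -` A \<inter> space M \<in> (\<Union>j\<in>{..k}. {\<xi> j -` A \<inter> space M | A. A \<in> sets S})" using A assms by auto
  then show "\<xi> j -` A \<inter> space (past_algebra M S \<xi> k) \<in> sets (past_algebra M S \<xi> k)"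
    unfolding sp unfolding past_algebra_def
    by (subst sets_measure_of) (auto intro: sigma_sets.Basic)
qed

text \<open>
  The Markov property at time k, tested against a function of the state at time 0, which belongs to the past.
\<close>

lemma one_step_indicator:
  assumes [measurable]: "\<phi> \<in> borel_measurable S" and int: "integrable M (\<lambda>\<omega>. \<phi> (\<xi> 0 \<omega>))"
    and pos: "\<And>x. \<phi> x \<ge> 0" and k: "k \<ge> 0" and B: "B \<in> sets S"
  shows "(\<integral>\<^sup>+\<omega>. ennreal (\<phi> (\<xi> 0 \<omega>)) * indicator B (\<xi> (k + 1) \<omega>) \<partial>M)
       = (\<integral>\<^sup>+\<omega>. ennreal (\<phi> (\<xi> 0 \<omega>)) * emeasure (Q (\<xi> k \<omega>)) B \<partial>M)"
proof -
  let ?B = "\<xi> (k + 1) -` B \<inter> space M"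
  let ?q = "\<lambda>\<omega>. \<phi> (\<xi> 0 \<omega>) * measure (Q (\<xi> k \<omega>)) B"
  let ?p = "\<lambda>\<omega>. \<phi> (\<xi> 0 \<omega>) * indicator ?B \<omega>"
  let ?F = "past_algebra M S \<xi> k"
  note chain_measurable[measurable]
  interpret finite_measure_subalgebra M ?F by unfold_locales (rule past_subalgebra)
  have e: "indicator ?B \<omega> = (indicator B (\<xi> (k + 1) \<omega>) :: real)" if "\<omega> \<in> space M" for \<omega>
    using that by (auto simp: indicator_def)
  have Bm: "?B \<in> sets M" using B by measurable
  have i: "integrable M ?p"
    using int Bm by (rule integrable_real_mult_indicator[rotated])
  have mF: "(\<lambda>\<omega>. \<phi> (\<xi> 0 \<omega>)) \<in> borel_measurable ?F"
    using past_measurable[OF k] by measurable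
  note c = real_cond_exp_intg[OF i mF borel_measurable_indicator[OF Bm]]
  have qm[measurable]: "(\<lambda>x. measure (Q x) B) \<in> borel_measurable S"
    by (rule measurable_compose[OF kernel_subprob measurable_measure_subprob_algebra[OF B]])
  have ae: "AE \<omega> in M. \<phi> (\<xi> 0 \<omega>) * real_cond_exp M ?F (indicator ?B) \<omega>
      = ?q \<omega>"
    using markov[OF B, of k] by eventually_elim simp
  have i2: "integrable M ?q"
    using c(1) ae by (subst (asm) integrable_cong_AE) auto
  have "(\<integral>\<^sup>+\<omega>. ennreal (\<phi> (\<xi> 0 \<omega>)) * indicator B (\<xi> (k + 1) \<omega>) \<partial>M)
      = (\<integral>\<^sup>+\<omega>. ennreal (?p \<omega>) \<partial>M)"
    using pos by (intro nn_integral_cong) (auto simp: indicator_def)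
  also have "\<dots> = ennreal (\<integral>\<omega>. ?p \<omega> \<partial>M)"
    using pos by (intro nn_integral_eq_integral i) auto
  also have "\<dots> = ennreal (\<integral>\<omega>. ?q \<omega> \<partial>M)"
    using c(2) integral_cong_AE[OF _ _ ae] i2 c(1) by simp
  also have "\<dots> = (\<integral>\<^sup>+\<omega>. ennreal (?q \<omega>) \<partial>M)"
    using pos by (intro nn_integral_eq_integral[symmetric] i2) auto
  also have "\<dots> = (\<integral>\<^sup>+\<omega>. ennreal (\<phi> (\<xi> 0 \<omega>)) * emeasure (Q (\<xi> k \<omega>)) B \<partial>M)"
  proof (rule nn_integral_cong)
    fix \<omega> assume "\<omega> \<in> space M"
    then have "\<xi> k \<omega> \<in> space S" by (rule measurable_space[OF chain_measurable])
    then interpret q: prob_space "Q (\<xi> k \<omega>)" by (rule kernel_prob)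
    show "ennreal (?q \<omega>) = ennreal (\<phi> (\<xi> 0 \<omega>)) * emeasure (Q (\<xi> k \<omega>)) B"
      using pos by (simp add: q.emeasure_eq_measure ennreal_mult)
  qed
  finally show ?thesis .
qed

text \<open>
  After weighting the probability by \<open>\<phi> (\<xi> 0)\<close>, the indicator case says that the law of
  \<open>\<xi> (k + 1)\<close> is the law of \<open>\<xi> k\<close> followed by the kernel.
\<close>

lemma one_step_nn:
  assumes [measurable]: "\<phi> \<in> borel_measurable S" and int: "integrable M (\<lambda>\<omega>. \<phi> (\<xi> 0 \<omega>))"
    and pos: "\<And>x. \<phi> x \<ge> 0" and k: "k \<ge> 0" and f: "f \<in> borel_measurable S"
  shows "(\<integral>\<^sup>+\<omega>. ennreal (\<phi> (\<xi> 0 \<omega>)) * f (\<xi> (k + 1) \<omega>) \<partial>M)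
       = (\<integral>\<^sup>+\<omega>. ennreal (\<phi> (\<xi> 0 \<omega>)) * (\<integral>\<^sup>+s. f s \<partial>Q (\<xi> k \<omega>)) \<partial>M)"
proof -
  note [measurable] = chain_measurable f
  have qm[measurable]: "(\<lambda>\<omega>. \<integral>\<^sup>+s. u s \<partial>Q (\<xi> k \<omega>)) \<in> borel_measurable M" if "u \<in> borel_measurable S" for u
    by (rule measurable_compose[OF chain_measurable kernel_nn_integral_measurable[OF that]])
  define D where "D = density M (\<lambda>\<omega>. ennreal (\<phi> (\<xi> 0 \<omega>)))"
  have D: "(\<integral>\<^sup>+\<omega>. u \<omega> \<partial>D) = (\<integral>\<^sup>+\<omega>. ennreal (\<phi> (\<xi> 0 \<omega>)) * u \<omega> \<partial>M)" if "u \<in> borel_measurable M" for u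
    unfolding D_def using that by (intro nn_integral_density) auto
  have \<xi>D: "\<xi> j \<in> measurable D S" for j unfolding D_def by measurable
  have distr: "(\<integral>\<^sup>+x. u x \<partial>distr D S (\<xi> j)) = (\<integral>\<^sup>+\<omega>. u (\<xi> j \<omega>) \<partial>D)" if "u \<in> borel_measurable S" for u j
    by (rule nn_integral_distr[OF \<xi>D]) (use that in simp)
  have ne: "space (distr D S (\<xi> k)) \<noteq> {}"
    using not_empty measurable_space[OF chain_measurable] by auto
  have QD: "Q \<in> measurable (distr D S (\<xi> k)) (subprob_algebra S)" using kernel_subprob by simp
  have "distr D S (\<xi> (k + 1)) = distr D S (\<xi> k) \<bind> Q"
  proof (rule measure_eqI)
    fix B assume "B \<in> sets (distr D S (\<xi> (k + 1)))"
    then have B[measurable]: "B \<in> sets S" by simp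
    have "emeasure (distr D S (\<xi> (k + 1))) B = (\<integral>\<^sup>+\<omega>. indicator B (\<xi> (k + 1) \<omega>) \<partial>D)"
      using distr[of "indicator B" "k + 1"] by simp
    also have "\<dots> = (\<integral>\<^sup>+\<omega>. emeasure (Q (\<xi> k \<omega>)) B \<partial>D)"
      using one_step_indicator[OF assms(1) int pos k B]
        measurable_compose[OF chain_measurable measurable_emeasure_kernel[OF kernel_subprob B], of k]
      by (simp add: D)
    also have "\<dots> = emeasure (distr D S (\<xi> k) \<bind> Q) B"
      using emeasure_bind[OF ne QD B] distr[OF measurable_emeasure_kernel[OF kernel_subprob B]] by simp
    finally show "emeasure (distr D S (\<xi> (k + 1))) B = emeasure (distr D S (\<xi> k) \<bind> Q) B" .
  qed (simp, rule sets_bind[OF _ ne, symmetric], simp add: kernel_prob)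
  then have "(\<integral>\<^sup>+\<omega>. f (\<xi> (k + 1) \<omega>) \<partial>D) = (\<integral>\<^sup>+x. f x \<partial>(distr D S (\<xi> k) \<bind> Q))"
    using distr[OF f, of "k + 1"] by simp
  also have "\<dots> = (\<integral>\<^sup>+\<omega>. (\<integral>\<^sup>+s. f s \<partial>Q (\<xi> k \<omega>)) \<partial>D)"
    using nn_integral_bind[OF f QD] distr[OF kernel_nn_integral_measurable[OF f]]
    by simp
  finally show ?thesis using qm[OF f] by (simp add: D)
qed

definition L2 :: "('s \<Rightarrow> real) \<Rightarrow> bool" where
  "L2 f \<longleftrightarrow> f \<in> borel_measurable S \<and> integrable \<pi> (\<lambda>x. (f x)\<^sup>2)"

lemma L2_measurable: "L2 f \<Longrightarrow> f \<in> borel_measurable S"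
  by (simp add: L2_def)

lemma L2_parts:
  assumes "L2 f"
  shows "L2 (\<lambda>x. max (f x) 0)" "L2 (\<lambda>x. max (- f x) 0)"
proof -
  have f[measurable]: "f \<in> borel_measurable S" and i: "integrable \<pi> (\<lambda>x. (f x)\<^sup>2)"
    using assms by (auto simp: L2_def)
  have m: "(\<lambda>x. (max (f x) 0)\<^sup>2) \<in> borel_measurable \<pi>" "(\<lambda>x. (max (- f x) 0)\<^sup>2) \<in> borel_measurable \<pi>"
    unfolding borel_measurable_marginal by measurable
  have "integrable \<pi> (\<lambda>x. (max (f x) 0)\<^sup>2)" "integrable \<pi> (\<lambda>x. (max (- f x) 0)\<^sup>2)"
    by (rule Bochner_Integration.integrable_bound[OF i], rule m, simp add: max_def)+
  then show "L2 (\<lambda>x. max (f x) 0)" "L2 (\<lambda>x. max (- f x) 0)"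
    by (auto simp: L2_def)
qed

lemma prob_space_marginal: "prob_space \<pi>"
  unfolding marginal by (rule prob_space_distr[OF chain_measurable])

lemma L2_integrable:
  assumes "L2 f" shows "integrable \<pi> f"
proof -
  interpret p: prob_space \<pi> by (rule prob_space_marginal)
  show ?thesis
  proof (rule p.square_integrable_imp_integrable)
    show "f \<in> borel_measurable \<pi>"
      unfolding borel_measurable_marginal using assms by (rule L2_measurable)
    show "integrable \<pi> (\<lambda>x. (f x)\<^sup>2)" using assms unfolding L2_def by blast
  qed
qed

lemma L2_mult:
  assumes \<phi>: "L2 \<phi>" and f: "L2 f"
  shows "integrable M (\<lambda>\<omega>. \<phi> (\<xi> i \<omega>) * f (\<xi> j \<omega>))"
proof (rule Bochner_Integration.integrable_bound)
  have "integrable M (\<lambda>\<omega>. (\<phi> (\<xi> i \<omega>))\<^sup>2)" "integrable M (\<lambda>\<omega>. (f (\<xi> j \<omega>))\<^sup>2)"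
    using assms integrable_chain[of "\<lambda>x. (\<phi> x)\<^sup>2" i] integrable_chain[of "\<lambda>x. (f x)\<^sup>2" j]
    by (auto simp: L2_def)
  then show "integrable M (\<lambda>\<omega>. (\<phi> (\<xi> i \<omega>))\<^sup>2 + (f (\<xi> j \<omega>))\<^sup>2)" by simp
  show "(\<lambda>\<omega>. \<phi> (\<xi> i \<omega>) * f (\<xi> j \<omega>)) \<in> borel_measurable M"
    using measurable_compose[OF chain_measurable L2_measurable[OF \<phi>]]
      measurable_compose[OF chain_measurable L2_measurable[OF f]] by measurable
  show "AE \<omega> in M. norm (\<phi> (\<xi> i \<omega>) * f (\<xi> j \<omega>)) \<le> norm ((\<phi> (\<xi> i \<omega>))\<^sup>2 + (f (\<xi> j \<omega>))\<^sup>2)"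
  proof (rule AE_I2)
    fix \<omega>
    have "2 * \<bar>\<phi> (\<xi> i \<omega>)\<bar> * \<bar>f (\<xi> j \<omega>)\<bar> \<le> \<bar>\<phi> (\<xi> i \<omega>)\<bar>\<^sup>2 + \<bar>f (\<xi> j \<omega>)\<bar>\<^sup>2" by (rule sum_squares_bound)
    then show "norm (\<phi> (\<xi> i \<omega>) * f (\<xi> j \<omega>)) \<le> norm ((\<phi> (\<xi> i \<omega>))\<^sup>2 + (f (\<xi> j \<omega>))\<^sup>2)"
      using mult_nonneg_nonneg[OF abs_ge_zero abs_ge_zero, of "\<phi> (\<xi> i \<omega>)" "f (\<xi> j \<omega>)"]
      unfolding real_norm_def abs_mult power2_abs by linarith
  qed
qed

lemma nn_integral_kernel:
  assumes "f \<in> borel_measurable S"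
  shows "(\<integral>\<^sup>+x. (\<integral>\<^sup>+s. f s \<partial>Q x) \<partial>\<pi>) = (\<integral>\<^sup>+x. f x \<partial>\<pi>)"
proof -
  have "(\<lambda>x. \<integral>\<^sup>+s. f s \<partial>Q x) \<in> borel_measurable S"
    by (rule kernel_nn_integral_measurable[OF assms])
  note nn_integral_chain[OF this, of 0, symmetric]
  also have "(\<integral>\<^sup>+\<omega>. (\<integral>\<^sup>+s. f s \<partial>Q (\<xi> 0 \<omega>)) \<partial>M) = (\<integral>\<^sup>+\<omega>. f (\<xi> (0 + 1) \<omega>) \<partial>M)"
  proof -
    have "(\<integral>\<^sup>+\<omega>. ennreal 1 * f (\<xi> (0 + 1) \<omega>) \<partial>M) = (\<integral>\<^sup>+\<omega>. ennreal 1 * (\<integral>\<^sup>+s. f s \<partial>Q (\<xi> 0 \<omega>)) \<partial>M)"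
      by (rule one_step_nn[of "\<lambda>_. 1"]) (auto simp: assms)
    then show ?thesis unfolding ennreal_1 mult_1_left by (rule sym)
  qed
  also have "\<dots> = (\<integral>\<^sup>+x. f x \<partial>\<pi>)" by (rule nn_integral_chain[OF assms])
  finally show ?thesis .
qed

lemma kernel_measurable: "f \<in> borel_measurable S \<Longrightarrow> x \<in> space S \<Longrightarrow> f \<in> borel_measurable (Q x)"
  using kernel_prob(2)[of x] by (simp cong: measurable_cong_sets)

lemma AE_integrable_kernel:
  fixes f :: "'s \<Rightarrow> real"
  assumes f: "f \<in> borel_measurable S" and i: "integrable \<pi> f"
  shows "AE x in \<pi>. integrable (Q x) f"
proof -
  have fm[measurable]: "(\<lambda>x. ennreal (norm (f x))) \<in> borel_measurable S" using f by measurable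
  have "(\<lambda>x. \<integral>\<^sup>+s. ennreal (norm (f s)) \<partial>Q x) \<in> borel_measurable \<pi>"
    unfolding borel_measurable_marginal
    by (rule kernel_nn_integral_measurable[OF fm])
  moreover have "(\<integral>\<^sup>+x. (\<integral>\<^sup>+s. ennreal (norm (f s)) \<partial>Q x) \<partial>\<pi>) \<noteq> \<infinity>"
    using i[unfolded integrable_iff_bounded, THEN conjunct2] unfolding nn_integral_kernel[OF fm] by simp
  ultimately have "AE x in \<pi>. (\<integral>\<^sup>+s. ennreal (norm (f s)) \<partial>Q x) \<noteq> \<infinity>"
    by (rule nn_integral_PInf_AE)
  then show ?thesis
    using AE_space
  proof eventually_elim
    case (elim x)
    then show ?case using kernel_measurable[OF f, of x]
      by (simp add: integrable_iff_bounded less_top space_marginal)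
  qed
qed

lemma transition_op_measurable: "f \<in> borel_measurable S \<Longrightarrow> transition_op Q f \<in> borel_measurable S"
  unfolding transition_op_def[abs_def]
  by (rule measurable_compose[OF kernel_subprob integral_measurable_subprob_algebra])

text \<open>
  Jensen's inequality for the probability measure Q x bounds the square of the image by the image of the square,
  whose \<pi>-integral is that of the square by stationarity.
\<close>

lemma L2_transition_op:
  assumes f: "L2 f" shows "L2 (transition_op Q f)"
proof -
  have fm[measurable]: "f \<in> borel_measurable S" and i: "integrable \<pi> (\<lambda>x. (f x)\<^sup>2)"
    using f by (auto simp: L2_def)
  have f2: "(\<lambda>x. ennreal ((f x)\<^sup>2)) \<in> borel_measurable S" by measurable
  have jensen: "AE x in \<pi>. ennreal ((transition_op Q f x)\<^sup>2) \<le> (\<integral>\<^sup>+s. ennreal ((f s)\<^sup>2) \<partial>Q x)"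
    using AE_integrable_kernel[OF fm L2_integrable[OF f]]
      AE_integrable_kernel[OF borel_measurable_power[OF fm, of 2] i] AE_space
  proof eventually_elim
    case (elim x)
    then interpret q: prob_space "Q x" by (intro kernel_prob) (simp add: space_marginal)
    have i2: "integrable (Q x) (\<lambda>x. (f x)\<^sup>2)" using elim fm by simp
    have "(transition_op Q f x)\<^sup>2 \<le> (\<integral>s. (f s)\<^sup>2 \<partial>Q x)"
      using q.variance_eq[OF elim(1) i2] q.variance_positive[of f] by (simp add: transition_op_def)
    then show ?case using nn_integral_eq_integral[OF i2] by (simp add: ennreal_leI)
  qed
  have "(\<integral>\<^sup>+x. ennreal ((transition_op Q f x)\<^sup>2) \<partial>\<pi>) \<le> (\<integral>\<^sup>+x. (\<integral>\<^sup>+s. ennreal ((f s)\<^sup>2) \<partial>Q x) \<partial>\<pi>)"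
    by (rule nn_integral_mono_AE[OF jensen])
  also have "\<dots> = (\<integral>\<^sup>+x. ennreal ((f x)\<^sup>2) \<partial>\<pi>)" by (rule nn_integral_kernel[OF f2])
  also have "\<dots> < \<infinity>" using i by (simp add: integrable_iff_bounded)
  finally show ?thesis
    using transition_op_measurable[OF fm]
    by (auto simp: L2_def integrable_iff_bounded borel_measurable_marginal intro!: borel_measurable_power)
qed

lemma one_step_nonneg:
  assumes \<phi>: "L2 \<phi>" and f: "L2 f"
    and pos: "\<And>x. \<phi> x \<ge> 0" "\<And>x. f x \<ge> 0" and k: "k \<ge> 0"
  shows "has_bochner_integral M (\<lambda>\<omega>. \<phi> (\<xi> 0 \<omega>) * transition_op Q f (\<xi> k \<omega>))
           (\<integral>\<omega>. \<phi> (\<xi> 0 \<omega>) * f (\<xi> (k + 1) \<omega>) \<partial>M)"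
proof (rule has_bochner_integral_nn_integral)
  let ?I = "\<integral>\<omega>. \<phi> (\<xi> 0 \<omega>) * f (\<xi> (k + 1) \<omega>) \<partial>M"
  let ?J = "\<lambda>\<omega>. \<phi> (\<xi> 0 \<omega>) * transition_op Q f (\<xi> k \<omega>)"
  let ?R = "\<lambda>\<omega>. ennreal (\<phi> (\<xi> 0 \<omega>)) * (\<integral>\<^sup>+s. ennreal (f s) \<partial>Q (\<xi> k \<omega>))"
  note [measurable] = L2_measurable[OF \<phi>] L2_measurable[OF f] chain_measurable
    transition_op_measurable[OF L2_measurable[OF f]]
  show "?J \<in> borel_measurable M" by measurable
  show "0 \<le> ?I" using pos by (intro integral_nonneg_AE) auto
  have Qf: "0 \<le> transition_op Q f x" for x using pos by (simp add: transition_op_def)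
  show "AE \<omega> in M. 0 \<le> ?J \<omega>" using pos Qf by simp
  have "AE x in \<pi>. ennreal (transition_op Q f x) = (\<integral>\<^sup>+s. ennreal (f s) \<partial>Q x)"
    using AE_integrable_kernel[OF L2_measurable[OF f] L2_integrable[OF f]]
    by eventually_elim (use pos in \<open>simp add: transition_op_def nn_integral_eq_integral\<close>)
  then have ae: "AE \<omega> in M. ennreal (transition_op Q f (\<xi> k \<omega>)) = (\<integral>\<^sup>+s. ennreal (f s) \<partial>Q (\<xi> k \<omega>))"
    by (rule AE_chain)
  have i\<phi>: "integrable M (\<lambda>\<omega>. \<phi> (\<xi> 0 \<omega>))"
    using integrable_chain[OF L2_measurable[OF \<phi>]] L2_integrable[OF \<phi>] by simp
  have "(\<integral>\<^sup>+\<omega>. ennreal (?J \<omega>) \<partial>M)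
      = (\<integral>\<^sup>+\<omega>. ?R \<omega> \<partial>M)"
  proof (rule nn_integral_cong_AE)
    show "AE \<omega> in M. ennreal (?J \<omega>) = ?R \<omega>"
      using ae by eventually_elim (use pos Qf in \<open>simp add: ennreal_mult\<close>)
  qed
  also have "\<dots> = (\<integral>\<^sup>+\<omega>. ennreal (\<phi> (\<xi> 0 \<omega>)) * ennreal (f (\<xi> (k + 1) \<omega>)) \<partial>M)"
    by (rule one_step_nn[symmetric]) (use i\<phi> pos k in auto)
  also have "\<dots> = (\<integral>\<^sup>+\<omega>. ennreal (\<phi> (\<xi> 0 \<omega>) * f (\<xi> (k + 1) \<omega>)) \<partial>M)"
    using pos by (simp add: ennreal_mult)
  also have "\<dots> = ennreal ?I"
    using pos by (intro nn_integral_eq_integral L2_mult[OF \<phi> f]) auto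
  finally show "(\<integral>\<^sup>+\<omega>. ennreal (?J \<omega>) \<partial>M) = ennreal ?I" .
qed

text \<open>
  Bilinear extension of the nonnegative case, with positive and negative parts of both functions.
\<close>

lemma one_step:
  assumes \<phi>: "L2 \<phi>" and f: "L2 f" and k: "k \<ge> 0"
  shows "(\<integral>\<omega>. \<phi> (\<xi> 0 \<omega>) * f (\<xi> (k + 1) \<omega>) \<partial>M) = (\<integral>\<omega>. \<phi> (\<xi> 0 \<omega>) * transition_op Q f (\<xi> k \<omega>) \<partial>M)"
proof -
  let ?I = "\<lambda>a b. \<integral>\<omega>. a (\<xi> 0 \<omega>) * b (\<xi> (k + 1) \<omega>) \<partial>M"
  let ?J = "\<lambda>a b \<omega>. a (\<xi> 0 \<omega>) * transition_op Q b (\<xi> k \<omega>)"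
  define p m where "p u x = max (u x) 0" and "m u x = max (- u x) 0" for u :: "'s \<Rightarrow> real" and x
  have pm: "u x = p u x - m u x" for u x by (auto simp: p_def m_def max_def)
  have pos: "p u x \<ge> 0" "m u x \<ge> 0" for u x by (auto simp: p_def m_def)
  have sq: "L2 (p u)" "L2 (m u)" if "L2 u" for u
    using L2_parts[OF that] by (simp_all add: p_def[abs_def] m_def[abs_def])
  have split_f: "has_bochner_integral M (?J \<psi> f) (?I \<psi> f)" if \<psi>: "L2 \<psi>" "\<And>x. \<psi> x \<ge> 0" for \<psi>
  proof -
    note [measurable] = L2_measurable[OF \<psi>(1)] chain_measurable
      transition_op_measurable[OF L2_measurable[OF f]]
    have "has_bochner_integral M (\<lambda>\<omega>. ?J \<psi> (p f) \<omega> - ?J \<psi> (m f) \<omega>)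
        (?I \<psi> (p f) - ?I \<psi> (m f))"
      by (intro has_bochner_integral_diff one_step_nonneg \<psi> sq f pos k)
    moreover have "?I \<psi> (p f) - ?I \<psi> (m f) = ?I \<psi> f"
      by (subst Bochner_Integration.integral_diff[symmetric])
        (auto intro!: L2_mult \<psi> sq f Bochner_Integration.integral_cong simp: right_diff_distrib[symmetric] pm[symmetric])
    moreover have "AE \<omega> in M. ?J \<psi> (p f) \<omega> - ?J \<psi> (m f) \<omega> = ?J \<psi> f \<omega>"
    proof -
      have "AE x in \<pi>. transition_op Q f x = transition_op Q (p f) x - transition_op Q (m f) x"
        using AE_integrable_kernel[OF L2_measurable L2_integrable, OF sq(1)[OF f] sq(1)[OF f]]
          AE_integrable_kernel[OF L2_measurable L2_integrable, OF sq(2)[OF f] sq(2)[OF f]]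
      proof eventually_elim
        case (elim x)
        have "transition_op Q f x = (\<integral>s. p f s - m f s \<partial>Q x)"
          unfolding transition_op_def by (rule Bochner_Integration.integral_cong[OF refl pm])
        also have "\<dots> = transition_op Q (p f) x - transition_op Q (m f) x"
          unfolding transition_op_def by (rule Bochner_Integration.integral_diff[OF elim])
        finally show ?case .
      qed
      from AE_chain[OF this, of k] show ?thesis by eventually_elim (simp only: right_diff_distrib)
    qed
    moreover note [measurable] = transition_op_measurable[OF L2_measurable[OF sq(1)[OF f]]]
      transition_op_measurable[OF L2_measurable[OF sq(2)[OF f]]]
    ultimately show ?thesis by (subst (asm) has_bochner_integral_cong_AE) auto
  qed
  have "has_bochner_integral M (\<lambda>\<omega>. ?J (p \<phi>) f \<omega> - ?J (m \<phi>) f \<omega>)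
      (?I (p \<phi>) f - ?I (m \<phi>) f)"
    by (intro has_bochner_integral_diff split_f sq \<phi> pos)
  moreover have "?I (p \<phi>) f - ?I (m \<phi>) f = ?I \<phi> f"
    by (subst Bochner_Integration.integral_diff[symmetric])
      (auto intro!: L2_mult sq f \<phi> Bochner_Integration.integral_cong simp: left_diff_distrib[symmetric] pm[symmetric])
  ultimately show ?thesis
    by (simp add: left_diff_distrib[symmetric] pm[symmetric] has_bochner_integral_iff)
qed

text \<open>
  Each application of the Markov property moves f one step back in time at the price of one transition operator.
\<close>

lemma covariance_eq_inner:
  assumes \<phi>: "L2 \<phi>" and f: "L2 f"
  shows "(\<integral>\<omega>. \<phi> (\<xi> 0 \<omega>) * f (\<xi> (int n) \<omega>) \<partial>M) = L2_inner \<pi> \<phi> ((transition_op Q ^^ n) f)"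
  using f
proof (induction n arbitrary: f)
  case 0
  then show ?case
    using integral_chain[OF borel_measurable_times[OF L2_measurable[OF \<phi>] L2_measurable], of f 0]
    by (simp add: L2_inner_def)
next
  case (Suc n)
  have "(\<integral>\<omega>. \<phi> (\<xi> 0 \<omega>) * f (\<xi> (int (Suc n)) \<omega>) \<partial>M) = (\<integral>\<omega>. \<phi> (\<xi> 0 \<omega>) * transition_op Q f (\<xi> (int n) \<omega>) \<partial>M)"
    using one_step[OF \<phi> Suc.prems, of "int n"] by (simp add: add.commute)
  also have "\<dots> = L2_inner \<pi> \<phi> ((transition_op Q ^^ n) (transition_op Q f))"
    by (rule Suc.IH[OF L2_transition_op[OF Suc.prems]])
  finally show ?case by (simp add: funpow_swap1)
qed

lemma covariance_lag:
  assumes g: "L2 g"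
  shows "(\<integral>\<omega>. g (\<xi> i \<omega>) * g (\<xi> j \<omega>) \<partial>M) = L2_inner \<pi> g ((transition_op Q ^^ nat \<bar>i - j\<bar>) g)"
proof -
  have le: "(\<integral>\<omega>. g (\<xi> i \<omega>) * g (\<xi> j \<omega>) \<partial>M) = L2_inner \<pi> g ((transition_op Q ^^ nat (j - i)) g)"
    if "i \<le> j" for i j
  proof -
    note [measurable] = L2_measurable[OF g]
    have "(\<lambda>x. g (x 0) * g (x (j - i))) \<in> borel_measurable (\<Pi>\<^sub>M i\<in>(UNIV :: int set). S)" by measurable
    from integral_shift[OF this, of i] covariance_eq_inner[OF g g, of "nat (j - i)"] show ?thesis
      using that by simp
  qed
  show ?thesis
  proof (cases "i \<le> j")
    case True
    then show ?thesis using le[OF True] by simp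
  next
    case False
    then show ?thesis using le[of j i] by (simp add: mult.commute)
  qed
qed

theorem partial_sum_var_spectral:
  assumes g: "g \<in> L2_0 \<pi>" and \<nu>: "transition_spectral_measure \<pi> Q g \<nu>"
  shows "partial_sum_var M \<xi> g n = (\<integral>t. (\<Sum>i=1..n. \<Sum>j=1..n. t ^ nat \<bar>int i - int j\<bar>) \<partial>\<nu>)"
proof -
  have sq: "L2 g" and mean: "(\<integral>x. g x \<partial>\<pi>) = 0"
    using g by (auto simp: L2_0_def L2_def borel_measurable_marginal)
  note gm = L2_measurable[OF sq]
  note ip = spectral_measure_powers_integrable[OF \<nu>]
  have mom: "L2_inner \<pi> g ((transition_op Q ^^ k) g) = (\<integral>t. t ^ k \<partial>\<nu>)" for k
    using \<nu> by (auto simp: transition_spectral_measure_def)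
  have "(\<integral>\<omega>. g (\<xi> i \<omega>) \<partial>M) = 0" for i using integral_chain[OF gm, of i] mean by simp
  moreover have "integrable M (\<lambda>\<omega>. g (\<xi> i \<omega>))" for i
    using integrable_chain[OF gm] L2_integrable[OF sq] by simp
  ultimately have "(\<integral>\<omega>. (\<Sum>i=1..n. g (\<xi> (int i) \<omega>)) \<partial>M) = 0" by simp
  then have "partial_sum_var M \<xi> g n = (\<integral>\<omega>. (\<Sum>i=1..n. g (\<xi> (int i) \<omega>))\<^sup>2 \<partial>M)"
    by (simp add: partial_sum_var_def)
  also have "\<dots> = (\<integral>\<omega>. (\<Sum>i=1..n. \<Sum>j=1..n. g (\<xi> (int i) \<omega>) * g (\<xi> (int j) \<omega>)) \<partial>M)"
    by (simp add: power2_eq_square sum_product)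
  also have "\<dots> = (\<Sum>i=1..n. \<Sum>j=1..n. (\<integral>\<omega>. g (\<xi> (int i) \<omega>) * g (\<xi> (int j) \<omega>) \<partial>M))"
    using L2_mult[OF sq sq] by simp
  also have "\<dots> = (\<Sum>i=1..n. \<Sum>j=1..n. (\<integral>t. t ^ nat \<bar>int i - int j\<bar> \<partial>\<nu>))"
    by (simp only: covariance_lag[OF sq] mom)
  also have "\<dots> = (\<integral>t. (\<Sum>i=1..n. \<Sum>j=1..n. t ^ nat \<bar>int i - int j\<bar>) \<partial>\<nu>)"
    using ip by simp
  finally show ?thesis .
qed

end

section \<open>Growth of partial sums and the spectral measure near one\<close>

text \<open>
  For D = 0 the left-hand side would say that f eventually vanishes, the right-hand side only that its ratio to r tends
  to 0.
\<close>

lemma asymp_equiv_iff_ratio: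
  fixes f r :: "'a \<Rightarrow> real"
  assumes r: "eventually (\<lambda>x. r x > 0) F" and D: "D \<noteq> 0"
  shows "f \<sim>[F] (\<lambda>x. D * r x) \<longleftrightarrow> ((\<lambda>x. f x / r x) \<longlongrightarrow> D) F"
proof -
  have "f \<sim>[F] (\<lambda>x. D * r x) \<longleftrightarrow> ((\<lambda>x. f x / r x / D) \<longlongrightarrow> 1) F"
    unfolding asymp_equiv_def
  proof (rule filterlim_cong[OF refl refl])
    show "eventually (\<lambda>x. (if f x = 0 \<and> D * r x = 0 then 1 else f x / (D * r x)) = f x / r x / D) F"
      using r by eventually_elim (use D in \<open>simp add: mult.commute\<close>)
  qed
  also have "\<dots> \<longleftrightarrow> ((\<lambda>x. f x / r x) \<longlongrightarrow> D) F"
  proof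
    assume "((\<lambda>x. f x / r x / D) \<longlongrightarrow> 1) F"
    then have "((\<lambda>x. f x / r x / D * D) \<longlongrightarrow> 1 * D) F" by (intro tendsto_mult tendsto_const)
    then show "((\<lambda>x. f x / r x) \<longlongrightarrow> D) F" using D by simp
  next
    assume "((\<lambda>x. f x / r x) \<longlongrightarrow> D) F"
    then have "((\<lambda>x. f x / r x / D) \<longlongrightarrow> D / D) F" using D by (intro tendsto_divide tendsto_const)
    then show "((\<lambda>x. f x / r x / D) \<longlongrightarrow> 1) F" using D by simp
  qed
  finally show ?thesis .
qed

lemma asymp_equiv_at_zero_iff_regular:
  assumes h: "slowly_varying h" and D: "D \<noteq> 0"
  shows "f \<sim>[at_right 0] (\<lambda>x. D * x powr (- \<sigma>) * h (1 / x)) \<longleftrightarrow> regular_limit h (\<lambda>t. f (1 / t)) \<sigma> D"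
proof -
  have "eventually (\<lambda>x. x powr (- \<sigma>) * h (1 / x) > 0) (at_right 0)"
    using eventually_at_right_less[of 0] by eventually_elim (simp add: slowly_varying_pos[OF h])
  from asymp_equiv_iff_ratio[OF this D, of f]
  have "f \<sim>[at_right 0] (\<lambda>x. D * x powr (- \<sigma>) * h (1 / x)) \<longleftrightarrow> ((\<lambda>x. f x / (x powr (- \<sigma>) * h (1 / x))) \<longlongrightarrow> D) (at_right 0)"
    by (simp add: mult.assoc)
  also have "\<dots> \<longleftrightarrow> regular_limit h (\<lambda>t. f (1 / t)) \<sigma> D"
    unfolding filterlim_at_right_to_top regular_limit_def
  proof (rule filterlim_cong[OF refl refl])
    show "eventually (\<lambda>T. f (inverse T) / (inverse T powr (- \<sigma>) * h (1 / inverse T)) = f (1 / T) / (T powr \<sigma> * h T)) at_top"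
      using eventually_gt_at_top[of 0]
      by eventually_elim (simp add: inverse_eq_divide powr_divide powr_minus)
  qed
  finally show ?thesis .
qed

lemma regular_limit_unique: "regular_limit h f \<sigma> C \<Longrightarrow> regular_limit h f \<sigma> D \<Longrightarrow> C = D"
  unfolding regular_limit_def by (rule tendsto_unique[OF trivial_limit_at_top_linorder])

lemma regular_limit_dominated:
  assumes h: "slowly_varying h" and \<tau>: "\<tau> < \<sigma>" and bound: "\<And>T. T > 0 \<Longrightarrow> \<bar>f T\<bar> \<le> B * T powr \<tau>"
  shows "regular_limit h f \<sigma> 0"
proof -
  have "((\<lambda>T. B * inverse (T powr (\<sigma> - \<tau>) * h T)) \<longlongrightarrow> B * 0) at_top"
    using \<tau> by (intro tendsto_mult_left tendsto_inverse_0_at_top slowly_varying_times_powr_at_top[OF h]) simp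
  then have lim: "((\<lambda>T. B * inverse (T powr (\<sigma> - \<tau>) * h T)) \<longlongrightarrow> 0) at_top" by simp
  show ?thesis unfolding regular_limit_def
  proof (rule Lim_null_comparison[OF _ lim])
    show "eventually (\<lambda>T. norm (f T / (T powr \<sigma> * h T)) \<le> B * inverse (T powr (\<sigma> - \<tau>) * h T)) at_top"
      using eventually_gt_at_top[of 0]
    proof eventually_elim
      case (elim T)
      have hT: "h T > 0" using slowly_varying_pos[OF h elim] .
      have "norm (f T / (T powr \<sigma> * h T)) = \<bar>f T\<bar> / (T powr \<sigma> * h T)" using hT by (simp add: abs_mult)
      also have "\<dots> \<le> B * T powr \<tau> / (T powr \<sigma> * h T)" using bound[OF elim] hT by (intro divide_right_mono) auto
      also have "\<dots> = B * inverse (T powr (\<sigma> - \<tau>) * h T)" using elim hT by (simp add: powr_diff field_simps)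
      finally show ?case .
    qed
  qed
qed

context shifted_spectral_measure
begin

lemma second_primitive_nonneg: "T \<ge> 0 \<Longrightarrow> second_primitive T \<ge> 0"
  unfolding second_primitive_def using second_primitive_kernel_bounds(1) by (intro integral_nonneg_AE) auto

lemma second_primitive_le: "T \<ge> 0 \<Longrightarrow> second_primitive T \<le> T * primitive T"
  using second_primitive_increment(2)[of 0 T] by (simp add: second_primitive_def)

lemma atom_le_second_primitive:
  assumes T: "T \<ge> 0" shows "T\<^sup>2 / 2 * measure \<mu> {0} \<le> second_primitive T"
proof -
  have "T\<^sup>2 / 2 * measure \<mu> {0} = (\<integral>s. T\<^sup>2 / 2 * indicator {0} s \<partial>\<mu>)"
    by (simp add: space_UNIV)
  also have "\<dots> \<le> second_primitive T" unfolding second_primitive_def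
  proof (rule integral_mono)
    show "integrable \<mu> (\<lambda>s. T\<^sup>2 / 2 * indicator {0} s)"
      by (intro integrable_mult_right integrable_real_indicator) (auto simp: sets_eq emeasure_eq_measure)
    show "T\<^sup>2 / 2 * indicator {0} s \<le> second_primitive_kernel T s" for s
      using second_primitive_kernel_bounds(1)[OF T, of s]
      by (cases "s = 0") (auto simp: second_primitive_kernel_def)
  qed (rule integrable_kernels(3)[OF T])
  finally show ?thesis .
qed

text \<open>
  An atom of \<mu> at 0 makes the second primitive grow at least quadratically.
\<close>

lemma regular_second_primitive_no_atom:
  assumes h: "slowly_varying h" and \<alpha>: "\<alpha> < 2" and L: "regular_limit h second_primitive \<alpha> C"
  shows "measure \<mu> {0} = 0"
proof -
  have "((\<lambda>T. second_primitive T / (T powr \<alpha> * h T) * (h T / T powr (2 - \<alpha>))) \<longlongrightarrow> C * 0) at_top"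
    using \<alpha> by (intro tendsto_mult L[unfolded regular_limit_def] slowly_varying_over_powr[OF h]) simp
  moreover have "eventually (\<lambda>T. measure \<mu> {0} / 2 \<le> second_primitive T / (T powr \<alpha> * h T) * (h T / T powr (2 - \<alpha>))) at_top"
    using eventually_gt_at_top[of 0]
  proof eventually_elim
    case (elim T)
    \<comment> \<open>For \<alpha> < 2 the second factor tends to 0, so the left-hand side does too.\<close>
    have "second_primitive T / (T powr \<alpha> * h T) * (h T / T powr (2 - \<alpha>)) = second_primitive T / (T powr \<alpha> * T powr (2 - \<alpha>))"
      using slowly_varying_pos[OF h elim] by simp
    also have "T powr \<alpha> * T powr (2 - \<alpha>) = T\<^sup>2" using elim by (simp add: powr_add[symmetric])
    finally have eq: "second_primitive T / (T powr \<alpha> * h T) * (h T / T powr (2 - \<alpha>)) = second_primitive T / T\<^sup>2" .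
    show ?case unfolding eq using atom_le_second_primitive[of T] elim by (simp add: field_simps)
  qed
  ultimately have "measure \<mu> {0} / 2 \<le> C * 0" by (intro tendsto_lowerbound) auto
  then show ?thesis using measure_nonneg[of \<mu> "{0}"] by simp
qed

text \<open>
  A gap at 0 bounds \<open>primitive\<close>.
\<close>

lemma second_primitive_linear_if_no_mass:
  assumes x: "x > 0" and U: "measure \<mu> {..<x} = 0" and T: "T \<ge> 0"
  shows "second_primitive T \<le> T * (total_mass / x)"
proof -
  have "emeasure \<mu> {..<x} = 0" using U by (simp add: emeasure_eq_measure)
  then have "AE s in \<mu>. s \<ge> x" by (intro AE_I[of _ _ "{..<x}"]) (auto simp: sets_eq)
  then have "AE s in \<mu>. primitive_kernel T s \<le> 1 / x"
  proof eventually_elim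
    case (elim s)
    have "(1 - exp (- (T * s))) / s \<le> 1 / x" using elim x by (intro frac_le) auto
    then show ?case using elim x by (simp add: primitive_kernel_def)
  qed
  then have "primitive T \<le> (\<integral>s. 1 / x \<partial>\<mu>)" unfolding primitive_def
    by (intro integral_mono_AE integrable_kernels(2)[OF T]) auto
  then have "T * primitive T \<le> T * (total_mass / x)" using T by (intro mult_left_mono) auto
  with second_primitive_le[OF T] show ?thesis by simp
qed

lemma second_primitive_zero_if_no_tail:
  assumes zero: "measure \<mu> {0} = 0" and x: "x > 0" and V: "\<And>y. 0 < y \<Longrightarrow> y < x \<Longrightarrow> inverse_tail y = 0" and T: "T > 0"
  shows "second_primitive T \<le> 0"
proof -
  have "inverse_tail y = 0" if y: "y > 0" for y
  proof (cases "y < x")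
    case False
    then have "inverse_tail y \<le> inverse_tail (x / 2)" using x by (intro inverse_tail_antimono) auto
    then show ?thesis using V[of "x / 2"] x inverse_tail_nonneg[OF y] by simp
  qed (use V y in simp)
  then have "(\<lambda>y. indicator {0<..} y * exp (- (T * y)) * inverse_tail y) = (\<lambda>y. 0)"
    by (auto simp: indicator_def)
  then have "primitive T / T = 0"
    using primitive_eq_inverse_tail_laplace[OF T zero] by (simp add: has_bochner_integral_iff)
  then show ?thesis using second_primitive_le[of T] T by simp
qed

context
  fixes h :: "real \<Rightarrow> real" and v :: "nat \<Rightarrow> real" and \<alpha> K :: real
  assumes h: "slowly_varying h"
    and approx: "\<And>n. \<bar>v n - 2 * second_primitive (real n)\<bar> \<le> K * real n"
    and superlinear: "filterlim (\<lambda>n. v n / real n) at_top sequentially"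
begin

lemma second_primitive_superlinear:
  "\<not> (\<forall>T>0. second_primitive T \<le> B * T)"
proof
  assume B: "\<forall>T>0. second_primitive T \<le> B * T"
  have "eventually (\<lambda>n. v n / real n > 2 * B + K) sequentially"
    using superlinear by (simp add: filterlim_at_top_dense)
  moreover have "eventually (\<lambda>n::nat. n > 0) sequentially" by (rule eventually_gt_at_top)
  ultimately have "eventually (\<lambda>n::nat. v n / real n > 2 * B + K \<and> n > 0) sequentially" by eventually_elim simp
  then obtain n :: nat where n: "v n / real n > 2 * B + K" "n > 0" by (auto dest: eventually_happens)
  have "(2 * B + K) * real n < v n" using n by (simp add: pos_less_divide_eq)
  moreover have "second_primitive (real n) \<le> B * real n" using B n by simp
  moreover have "v n \<le> 2 * second_primitive (real n) + K * real n" using approx[of n] by linarith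
  ultimately show False by (simp add: algebra_simps)
qed

text \<open>
  The error of order n is negligible because v grows faster than n.
\<close>

lemma growth_iff_regular_second_primitive:
  "v \<sim>[sequentially] (\<lambda>n. real n powr \<alpha> * h (real n)) \<longleftrightarrow> regular_limit h second_primitive \<alpha> (1 / 2)"
proof -
  let ?r = "\<lambda>n. real n powr \<alpha> * h (real n)"
  let ?G = "\<lambda>n. second_primitive (real n)"
  have pos: "eventually (\<lambda>n. ?r n > 0) sequentially"
    using eventually_gt_at_top[of 0] by eventually_elim (simp add: slowly_varying_pos[OF h])
  have "((\<lambda>n. K * inverse (v n / real n)) \<longlongrightarrow> K * 0) sequentially"
    by (intro tendsto_mult_left tendsto_inverse_0_at_top superlinear)
  then have lim: "((\<lambda>n. K * inverse (v n / real n)) \<longlongrightarrow> 0) sequentially" by simp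
  have v_pos: "eventually (\<lambda>n. v n / real n > 0) sequentially"
    using superlinear by (simp add: filterlim_at_top_dense)
  have "((\<lambda>n. 2 * ?G n / v n - 1) \<longlongrightarrow> 0) sequentially"
  proof (rule Lim_null_comparison[OF _ lim])
    show "eventually (\<lambda>n. norm (2 * ?G n / v n - 1) \<le> K * inverse (v n / real n)) sequentially"
      using v_pos
    proof eventually_elim
      case (elim n)
      then have vn: "v n > 0" by (simp add: zero_less_divide_iff)
      have "2 * ?G n / v n - 1 = (2 * ?G n - v n) / v n"
        using vn by (simp add: diff_divide_distrib)
      then have "norm (2 * ?G n / v n - 1) = \<bar>v n - 2 * ?G n\<bar> / v n"
        using vn by (simp add: abs_minus_commute)
      also have "\<dots> \<le> K * real n / v n" using approx[of n] vn by (intro divide_right_mono) auto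
      finally show ?case by (simp add: field_simps)
    qed
  qed
  from tendsto_add[OF this tendsto_const[of 1]]
  have "((\<lambda>n. 2 * ?G n / v n) \<longlongrightarrow> 1) sequentially" by simp
  then have eq: "(\<lambda>n. 2 * ?G n) \<sim>[sequentially] v" by (rule asymp_equivI')
  have "v \<sim>[sequentially] ?r
      \<longleftrightarrow> (\<lambda>n. 2 * ?G n) \<sim>[sequentially] ?r"
    using eq asymp_equiv_trans asymp_equiv_sym by blast
  also have "\<dots> \<longleftrightarrow> ((\<lambda>n. 2 * ?G n / ?r n) \<longlongrightarrow> 1) sequentially"
    using asymp_equiv_iff_ratio[OF pos, of 1 "\<lambda>n. 2 * ?G n"] by simp
  also have "\<dots> \<longleftrightarrow> ((\<lambda>n. ?G n / ?r n) \<longlongrightarrow> 1 / 2) sequentially"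
  proof
    assume "((\<lambda>n. 2 * ?G n / ?r n) \<longlongrightarrow> 1) sequentially"
    from tendsto_mult_left[OF this, of "1 / 2"]
    show "((\<lambda>n. ?G n / ?r n) \<longlongrightarrow> 1 / 2) sequentially" by simp
  next
    assume "((\<lambda>n. ?G n / ?r n) \<longlongrightarrow> 1 / 2) sequentially"
    from tendsto_mult_left[OF this, of 2]
    show "((\<lambda>n. 2 * ?G n / ?r n) \<longlongrightarrow> 1) sequentially" by simp
  qed
  also have "\<dots> \<longleftrightarrow> regular_limit h second_primitive \<alpha> (1 / 2)"
    using regular_limit_sequence[OF h second_primitive_mono] by simp
  finally show ?thesis .
qed

text \<open>
  The second primitive is at most of order T^2.
\<close>

lemma growth_exponent_at_most_two:
  assumes "\<alpha> > 2" shows "\<not> v \<sim>[sequentially] (\<lambda>n. real n powr \<alpha> * h (real n))"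
proof -
  have "regular_limit h second_primitive \<alpha> 0"
  proof (rule regular_limit_dominated[OF h assms])
    fix T :: real assume T: "T > 0"
    have "second_primitive T \<le> T * (T * total_mass)"
      using second_primitive_le[of T] primitive_bounds(2)[of T] T by (meson less_imp_le mult_left_mono order_trans)
    then show "\<bar>second_primitive T\<bar> \<le> total_mass * T powr 2"
      using second_primitive_nonneg[of T] T by (simp add: power2_eq_square mult_ac)
  qed
  then show ?thesis unfolding growth_iff_regular_second_primitive
    using regular_limit_unique by fastforce
qed

text \<open>
  For \<alpha> \<le> 2 one follows the chain from the second primitive down to the Laplace transform and then to
  \<mu>. For \<alpha> > 2 both sides are false: the mass is bounded, while the function it is compared with is
  either unbounded or, at integers \<alpha> \<ge> 3, zero. In the latter case \<mu> would have a gap at 0, and v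
  would grow linearly.
\<close>

lemma growth_iff_mass_near_zero:
  assumes \<alpha>: "\<alpha> > 1"
  defines "d \<equiv> \<alpha> * (\<alpha> - 1) / (2 * Gamma (3 - \<alpha>))"
  shows "v \<sim>[sequentially] (\<lambda>n. real n powr \<alpha> * h (real n)) \<longleftrightarrow>
    (\<lambda>x. measure \<mu> {..<x}) \<sim>[at_right 0] (\<lambda>x. d * x powr (2 - \<alpha>) * h (1 / x))"
proof -
  let ?U = "\<lambda>x. measure \<mu> {..<x}"
  let ?q = "\<lambda>x. d * x powr (2 - \<alpha>) * h (1 / x)"
  let ?r = "\<lambda>n. real n powr \<alpha> * h (real n)"
  let ?M = "\<lambda>t. measure \<mu> {..<1 / t}"
  show ?thesis
  proof (cases "\<alpha> \<le> 2")
    case True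
    have "Gamma (3 - \<alpha>) > 0" using True by (intro Gamma_real_pos) simp
    then have d: "d \<noteq> 0" using \<alpha> by (simp add: d_def)
    have "v \<sim>[sequentially] ?r \<longleftrightarrow> regular_limit h second_primitive \<alpha> (1 / 2)"
      by (rule growth_iff_regular_second_primitive)
    also have "\<dots> \<longleftrightarrow> regular_limit h primitive (\<alpha> - 1) (1 / 2 * \<alpha>)"
      using \<alpha> by (intro regular_second_primitive_iff h) simp
    also have "\<dots> \<longleftrightarrow> regular_limit h laplace (\<alpha> - 1 - 1) (1 / 2 * \<alpha> * (\<alpha> - 1))"
      using \<alpha> by (intro regular_primitive_iff h) simp
    also have "\<dots> \<longleftrightarrow> regular_limit h ?M (\<alpha> - 1 - 1) (1 / 2 * \<alpha> * (\<alpha> - 1) / Gamma (1 - (\<alpha> - 1 - 1)))"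
      using \<alpha> True by (intro regular_laplace_iff h) auto
    also have "\<dots> \<longleftrightarrow> regular_limit h ?M (\<alpha> - 2) d"
      by (simp add: d_def)
    also have "\<dots> \<longleftrightarrow> ?U \<sim>[at_right 0] ?q"
      using asymp_equiv_at_zero_iff_regular[OF h d, of "?U" "\<alpha> - 2"] by simp
    finally show ?thesis .
  next
    case False
    have "\<not> ?U \<sim>[at_right 0] ?q"
    proof
      assume U: "?U \<sim>[at_right 0] ?q"
      show False
      proof (cases "d = 0")
        case True
        then have "(\<lambda>_. 0) \<sim>[at_right 0] ?U" using U by (simp add: asymp_equiv_sym)
        then have "eventually (\<lambda>x. measure \<mu> {..<x} = 0) (at_right 0)" by simp
        then have "eventually (\<lambda>x. measure \<mu> {..<x} = 0 \<and> x > 0) (at_right (0::real))"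
          using eventually_at_right_less[of 0] by eventually_elim simp
        then obtain x where x: "measure \<mu> {..<x} = 0" "x > 0"
          by (auto dest: eventually_happens simp: trivial_limit_at_right_real)
        have "\<forall>T>0. second_primitive T \<le> total_mass / x * T"
          using second_primitive_linear_if_no_mass[OF x(2,1)] by (simp add: mult.commute)
        then show False using second_primitive_superlinear by blast
      next
        case d: False
        have "regular_limit h ?M (\<alpha> - 2) d"
          using asymp_equiv_at_zero_iff_regular[OF h d, of "?U" "\<alpha> - 2"] U by simp
        moreover have "regular_limit h ?M (\<alpha> - 2) 0"
          using False bounded_measure by (intro regular_limit_dominated[OF h, of 0 _ _ total_mass]) auto
        ultimately show False using d regular_limit_unique by blast
      qed
    qed
    then show ?thesis using growth_exponent_at_most_two False by simp
  qed
qed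

text \<open>
  Growth with \<alpha> < 2 excludes an atom at 0, so the representation of the primitive by
  \<open>inverse_tail\<close> is available.
\<close>

lemma growth_imp_inverse_tail:
  assumes \<alpha>: "\<alpha> \<ge> 1" "\<alpha> \<noteq> 2"
  defines "c \<equiv> \<alpha> * (2 - \<alpha>) / (2 * Gamma (3 - \<alpha>))"
  assumes v: "v \<sim>[sequentially] (\<lambda>n. real n powr \<alpha> * h (real n))"
  shows "inverse_tail \<sim>[at_right 0] (\<lambda>x. c * x powr (1 - \<alpha>) * h (1 / x))"
proof -
  have \<alpha>2: "\<alpha> < 2" using growth_exponent_at_most_two v \<alpha> by fastforce
  have "Gamma (3 - \<alpha>) > 0" using \<alpha>2 by (intro Gamma_real_pos) simp
  then have c: "c \<noteq> 0" using \<alpha> by (simp add: c_def)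
  have L: "regular_limit h second_primitive \<alpha> (1 / 2)" using v by (simp only: growth_iff_regular_second_primitive)
  have zero: "measure \<mu> {0} = 0" by (rule regular_second_primitive_no_atom[OF h \<alpha>2 L])
  have "regular_limit h primitive (\<alpha> - 1) (1 / 2 * \<alpha>)"
    using L \<alpha> regular_second_primitive_iff[OF h, of \<alpha> "1 / 2"] by simp
  then have "regular_limit h (\<lambda>t. inverse_tail (1 / t)) (\<alpha> - 1) (1 / 2 * \<alpha> * (1 - (\<alpha> - 1)) / Gamma (2 - (\<alpha> - 1)))"
    using \<alpha> \<alpha>2 by (intro regular_primitive_imp_inverse_tail[OF h _ zero]) auto
  then have "regular_limit h (\<lambda>t. inverse_tail (1 / t)) (\<alpha> - 1) c" by (simp add: c_def)
  then show ?thesis using asymp_equiv_at_zero_iff_regular[OF h c, of inverse_tail "\<alpha> - 1"] by simp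
qed

text \<open>
  For \<alpha> > 2 the hypothesis is contradictory: \<open>inverse_tail x\<close> is of order at most 1 / x, too
  small for the right-hand side unless c = 0, and then \<open>inverse_tail\<close> and with it the second
  primitive vanish.
\<close>

lemma inverse_tail_imp_growth:
  assumes \<alpha>: "\<alpha> \<ge> 1" "\<alpha> \<noteq> 2" and zero: "measure \<mu> {0} = 0"
  defines "c \<equiv> \<alpha> * (2 - \<alpha>) / (2 * Gamma (3 - \<alpha>))"
  assumes V: "inverse_tail \<sim>[at_right 0] (\<lambda>x. c * x powr (1 - \<alpha>) * h (1 / x))"
  shows "v \<sim>[sequentially] (\<lambda>n. real n powr \<alpha> * h (real n))"
proof (cases "c = 0")
  case True
  then have "(\<lambda>_. 0) \<sim>[at_right 0] inverse_tail" using V by (simp add: asymp_equiv_sym)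
  then have "eventually (\<lambda>x. inverse_tail x = 0) (at_right 0)" by simp
  then obtain x where x: "x > 0" "\<And>y. 0 < y \<Longrightarrow> y < x \<Longrightarrow> inverse_tail y = 0"
    by (auto simp: eventually_at_right_field)
  have "\<forall>T>0. second_primitive T \<le> 0 * T"
    using second_primitive_zero_if_no_tail[OF zero x] by simp
  then show ?thesis using second_primitive_superlinear by blast
next
  case c: False
  have L: "regular_limit h (\<lambda>t. inverse_tail (1 / t)) (\<alpha> - 1) c"
    using V asymp_equiv_at_zero_iff_regular[OF h c, of inverse_tail "\<alpha> - 1"] by simp
  show ?thesis
  proof (cases "\<alpha> < 2")
    case True
    have G: "Gamma (3 - \<alpha>) = (2 - \<alpha>) * Gamma (2 - \<alpha>)"
      using Gamma_plus1[of "2 - \<alpha>"] True nonpos_Ints_nonpos[of "2 - \<alpha>"] by (auto simp: algebra_simps)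
    have "Gamma (2 - \<alpha>) > 0" using True by (intro Gamma_real_pos) simp
    then have "Gamma (2 - \<alpha>) \<noteq> 0" by (metis less_irrefl)
    then have eq: "c * Gamma (1 - (\<alpha> - 1)) = 1 / 2 * \<alpha>" using True by (simp add: c_def G)
    have "regular_limit h primitive (\<alpha> - 1) (c * Gamma (1 - (\<alpha> - 1)))"
      using True by (intro regular_inverse_tail_imp_primitive[OF h _ zero L]) simp
    then have "regular_limit h primitive (\<alpha> - 1) (1 / 2 * \<alpha>)" unfolding eq .
    then show ?thesis
      using \<alpha> by (simp add: growth_iff_regular_second_primitive regular_second_primitive_iff[OF h])
  next
    case False
    have "regular_limit h (\<lambda>t. inverse_tail (1 / t)) (\<alpha> - 1) 0"
    proof (rule regular_limit_dominated[OF h])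
      show "\<bar>inverse_tail (1 / T)\<bar> \<le> total_mass * T powr 1" if "T > 0" for T
        using inverse_tail_nonneg[of "1 / T"] inverse_tail_le[of "1 / T"] that by simp
    qed (use False \<alpha> in simp)
    with L have "c = 0" by (rule regular_limit_unique)
    with c show ?thesis by simp
  qed
qed

end

end

theorem theorem9:
  fixes M :: "'w measure" and S :: "'s measure" and \<xi> :: "int \<Rightarrow> 'w \<Rightarrow> 's"
    and \<pi> :: "'s measure" and Q :: "'s \<Rightarrow> 's measure" and g :: "'s \<Rightarrow> real"
    and \<nu> :: "real measure" and h :: "real \<Rightarrow> real" and \<alpha> :: real
  defines "V \<equiv> (\<lambda>x::real. (LINT t:{-1..1 - x}|\<nu>. 1 / (1 - t)))"
    and "c \<equiv> \<alpha> * (2 - \<alpha>) / (2 * Gamma (3 - \<alpha>))"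
    and "d \<equiv> \<alpha> * (\<alpha> - 1) / (2 * Gamma (3 - \<alpha>))"
  assumes "stationary_markov_chain M S \<xi> \<pi> Q"
    and "g \<in> L2_0 \<pi>"
    and "transition_spectral_measure \<pi> Q g \<nu>"
    and "slowly_varying h"
    and "self_adjoint_kernel \<pi> Q"
    and "\<alpha> \<ge> 1"
    and "filterlim (\<lambda>n. partial_sum_var M \<xi> g n / real n) at_top sequentially"
  shows "(\<alpha> \<noteq> 2 \<longrightarrow>
           (measure \<nu> {1} = 0 \<longrightarrow>
             (V \<sim>[at_right 0] (\<lambda>x. c * x powr (1 - \<alpha>) * h (1 / x)) \<longleftrightarrow>
              partial_sum_var M \<xi> g \<sim>[sequentially] (\<lambda>n. real n powr \<alpha> * h (real n)))) \<and>
           (partial_sum_var M \<xi> g \<sim>[sequentially] (\<lambda>n. real n powr \<alpha> * h (real n)) \<longrightarrow>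
              V \<sim>[at_right 0] (\<lambda>x. c * x powr (1 - \<alpha>) * h (1 / x)))) \<and>
         (\<alpha> > 1 \<longrightarrow>
           (partial_sum_var M \<xi> g \<sim>[sequentially] (\<lambda>n. real n powr \<alpha> * h (real n)) \<longleftrightarrow>
            (\<lambda>x. measure \<nu> {1 - x<..1}) \<sim>[at_right 0] (\<lambda>x. d * x powr (2 - \<alpha>) * h (1 / x))))"
proof -
  interpret chain: stationary_markov_chain M S \<xi> \<pi> Q by fact
  note h = \<open>slowly_varying h\<close>
  interpret \<nu>: finite_measure \<nu> using assms(6) by (simp add: transition_spectral_measure_def)
  have sets_\<nu>[measurable_cong]: "sets \<nu> = sets borel"
    using assms(6) by (simp add: transition_spectral_measure_def)
  note supp = spectral_measure_support[OF assms(6)]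
  have space_\<nu>: "space \<nu> = UNIV" using sets_eq_imp_space_eq[OF sets_\<nu>] by simp
  define \<mu> where "\<mu> = distr \<nu> borel (\<lambda>t. 1 - t)"
  have mt: "(\<lambda>t. 1 - t) \<in> measurable \<nu> borel" by measurable
  interpret \<mu>: shifted_spectral_measure \<mu>
  proof (intro shifted_spectral_measure.intro shifted_spectral_measure_axioms.intro)
    show "finite_measure \<mu>" unfolding \<mu>_def using mt by (rule \<nu>.finite_measure_distr)
    have "AE t in \<nu>. 0 \<le> 1 - t \<and> 1 - t \<le> 2" using supp by eventually_elim auto
    then show "AE s in \<mu>. 0 \<le> s \<and> s \<le> 2"
      unfolding \<mu>_def by (subst AE_distr_iff[OF mt]) auto
  qed (simp add: \<mu>_def)
  have measure_\<mu>: "measure \<mu> A = measure \<nu> {t. 1 - t \<in> A}" if "A \<in> sets borel" for A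
    using measure_distr[OF mt that] by (simp add: \<mu>_def space_\<nu> vimage_def)
  have atom: "measure \<mu> {0} = measure \<nu> {1}"
    by (subst measure_\<mu>) (auto intro!: arg_cong[where f = "measure \<nu>"])
  have mass: "measure \<mu> {..<x} = measure \<nu> {1 - x<..1}" for x
  proof -
    have "AE t in \<nu>. t \<in> {t. 1 - t \<in> {..<x}} \<longleftrightarrow> t \<in> {1 - x<..1}"
      using supp by eventually_elim auto
    then have "measure \<nu> {t. 1 - t \<in> {..<x}} = measure \<nu> {1 - x<..1}"
      by (rule measure_eq_AE) (auto simp: sets_\<nu> greaterThan_def[symmetric])
    then show ?thesis by (subst measure_\<mu>) auto
  qed
  have V: "V x = \<mu>.inverse_tail x" for x
  proof -
    have "\<mu>.inverse_tail x = (\<integral>t. (if x \<le> 1 - t then 1 / (1 - t) else 0) \<partial>\<nu>)"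
      unfolding \<mu>.inverse_tail_def unfolding \<mu>_def by (rule integral_distr[OF mt]) measurable
    also have "\<dots> = (\<integral>t. indicator {-1..1 - x} t *\<^sub>R (1 / (1 - t)) \<partial>\<nu>)"
    proof (rule integral_cong_AE)
      show "AE t in \<nu>. (if x \<le> 1 - t then 1 / (1 - t) else 0) = indicator {-1..1 - x} t *\<^sub>R (1 / (1 - t))"
        using supp by eventually_elim (auto simp: indicator_def)
    qed measurable
    finally show ?thesis by (simp add: V_def set_lebesgue_integral_def)
  qed
  have approx: "\<bar>partial_sum_var M \<xi> g n - 2 * \<mu>.second_primitive (real n)\<bar> \<le> 9 * measure \<nu> (space \<nu>) * real n" for n
  proof -
    have F: "\<mu>.second_primitive (real n) = (\<integral>t. second_primitive_kernel (real n) (1 - t) \<partial>\<nu>)"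
      unfolding \<mu>.second_primitive_def unfolding \<mu>_def by (rule integral_distr[OF mt]) measurable
    have iF: "integrable \<nu> (\<lambda>t. second_primitive_kernel (real n) (1 - t))"
      using \<mu>.integrable_kernels(3)[of "real n"] integrable_distr_eq[OF mt, of "second_primitive_kernel (real n)"]
      by (simp add: \<mu>_def)
    have iw: "integrable \<nu> (lag_kernel n)"
      unfolding lag_kernel_def[abs_def] by (simp add: spectral_measure_powers_integrable[OF assms(6)])
    have "partial_sum_var M \<xi> g n - 2 * \<mu>.second_primitive (real n)
        = (\<integral>t. lag_kernel n t - 2 * second_primitive_kernel (real n) (1 - t) \<partial>\<nu>)"
      using chain.partial_sum_var_spectral[OF assms(5,6), of n] iF iw by (simp add: F lag_kernel_def[abs_def])
    also have "\<bar>\<dots>\<bar> \<le> (\<integral>t. 9 * real n \<partial>\<nu>)"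
    proof (rule integral_abs_bound[THEN order_trans], rule integral_mono_AE)
      show "AE t in \<nu>. \<bar>lag_kernel n t - 2 * second_primitive_kernel (real n) (1 - t)\<bar> \<le> 9 * real n"
        using supp by eventually_elim (rule lag_kernel_approximation; simp)
    qed (use iF iw in auto)
    finally show ?thesis by (simp add: mult_ac)
  qed
  note context_facts = h approx assms(10)
  show ?thesis
    unfolding V atom[symmetric] mass[symmetric] c_def d_def
    using \<mu>.growth_imp_inverse_tail[OF context_facts \<open>\<alpha> \<ge> 1\<close>]
      \<mu>.inverse_tail_imp_growth[OF context_facts \<open>\<alpha> \<ge> 1\<close>]
      \<mu>.growth_iff_mass_near_zero[OF context_facts]
    by blast
qed

end
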